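(* Let $\mathbb{K}$ be a field of characteristic $0$ and let $\mathfrak{L}$ be a finite-dimensional Lie-Yamaguti algebra over $\mathbb{K}$, with universal coacting Hopf algebra $(\mathcal{H}(\mathfrak{L}),\mathcal{X}_{\mathfrak{L}})$. Then for any commutative Hopf algebra $H$ and any Lie-Yamaguti algebra morphism $f:\mathfrak{L}\to\mathfrak{L}\otimes H$ that makes $\mathfrak{L}$ into a right $H$-comodule, there exists a unique Hopf algebra morphism $g:\mathcal{H}(\mathfrak{L})\to H$ such that $$(id_{\mathfrak{L}}\otimes g)\circ\mathcal{X}_{\mathfrak{L}}=f.$$
   Context: All vector spaces and (multi)linear maps are over a fixed field $\mathbb{K}$ of characteristic $0$; algebras are unital and associative, coalgebras are counital and coassociative. A Lie-Yamaguti algebra is a triple $(\mathfrak{L},[\cdot,\cdot],\{\cdot,\cdot,\cdot\})$ with $\mathfrak{L}$ a $\mathbb{K}$-vector space, $[\cdot,\cdot]$ bilinear and $\{\cdot,\cdot,\cdot\}$ trilinear (both with values in $\mathfrak{L}$) such that for all $a,b,c,d,e\in\mathfrak{L}$: (LY1) $[a,b]=-[b,a]$; (LY2) $\{a,b,c\}=-\{b,a,c\}$; (LY3) $[[a,b],c]+\{a,b,c\}+[[b,c],a]+\{b,c,a\}+[[c,a],b]+\{c,a,b\}=0$; (LY4) $\{[a,b],c,d\}+\{[b,c],a,d\}+\{[c,a],b,d\}=0$; (LY5) $\{a,b,[c,d]\}=[\{a,b,c\},d]+[c,\{a,b,d\}]$; (LY6) $\{a,b,\{c,d,e\}\}=\{\{a,b,c\},d,e\}+\{c,\{a,b,d\},e\}+\{c,d,\{a,b,e\}\}$.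 A Lie-Yamaguti algebra morphism is a linear map preserving both brackets. For a commutative algebra $A$, $\mathfrak{L}\otimes A$ is a Lie-Yamaguti algebra with $[x\otimes a,y\otimes b]=[x,y]\otimes ab$ and $\{x\otimes a,y\otimes b,z\otimes c\}=\{x,y,z\}\otimes abc$. Universal algebra of $\mathfrak{L}$: let $\{e_1,\dots,e_n\}$ be a basis of $\mathfrak{L}$ with structure constants $[e_i,e_j]=\sum_{s=1}^n\tau_{ij}^s e_s$ and $\{e_i,e_j,e_k\}=\sum_{s=1}^n\omega_{ijk}^s e_s$. Then $\mathcal{A}(\mathfrak{L}):=\mathbb{K}[X_{si}:s,i=1,\dots,n]/J$, where $J$ is the ideal generated by all polynomials $\sum_{u=1}^n\tau_{ij}^u X_{au}-\sum_{s,t=1}^n\tau_{st}^a X_{si}X_{tj}$ and $\sum_{u=1}^n\omega_{ijk}^u X_{au}-\sum_{r,s,t=1}^n\omega_{rst}^a X_{ri}X_{sj}X_{tk}$, for $a,i,j,k=1,\dots,n$; $x_{si}$ denotes the class of $X_{si}$. The map $\Phi_{\mathfrak{L}}:\mathfrak{L}\to\mathfrak{L}\otimes\mathcal{A}(\mathfrak{L})$, $\Phi_{\mathfrak{L}}(e_i)=\sum_{s=1}^n e_s\otimes x_{si}$, is a Lie-Yamaguti algebra morphism. $\mathcal{A}(\mathfrak{L})$ is a commutative bialgebra with $\Delta(x_{ij})=\sum_{s=1}^n x_{is}\otimes x_{sj}$ and $\varepsilon(x_{ij})=\delta_{ij}$. The forgetful functor $F:\operatorname{ComHopf}_{\mathbb{K}}\to\operatorname{ComBiAlg}_{\mathbb{K}}$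 from commutative Hopf algebras to commutative bialgebras has a left adjoint $L$ (the free commutative Hopf algebra generated by a commutative bialgebra; Takeuchi). Let $\mu:\mathrm{Id}_{\operatorname{ComBiAlg}_{\mathbb{K}}}\to FL$ be the unit of this adjunction. The universal coacting Hopf algebra of $\mathfrak{L}$ is the pair consisting of $\mathcal{H}(\mathfrak{L}):=L(\mathcal{A}(\mathfrak{L}))$ and $\mathcal{X}_{\mathfrak{L}}:=(id_{\mathfrak{L}}\otimes\mu_{\mathcal{A}(\mathfrak{L})})\circ\Phi_{\mathfrak{L}}:\mathfrak{L}\to\mathfrak{L}\otimes\mathcal{H}(\mathfrak{L})$. A right comodule over a coalgebra $(C,\Delta,\varepsilon)$ is a vector space $M$ with a linear map $f:M\to M\otimes C$ such that $(id\otimes\Delta)\circ f=(f\otimes id)\circ f$ and $(id\otimes\varepsilon)\circ f=id$ (identifying $M\otimes\mathbb{K}$ with $M$). *)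

theory Defs
  imports "HOL-Algebra.QuotRing" "HOL-Algebra.Module" "HOL-Library.Poly_Mapping"
begin

section \<open>Linear algebra over a field\<close>

text \<open>
  The ground field is a type \<open>'k\<close> of class \<open>field\<close>. Vector spaces and commutative algebras over it
  are the carrier-based structures \<open>module base V\<close> and \<open>algebra base A\<close> of HOL-Algebra. In a
  structure that is only a vector space the fields \<open>mult\<close> and \<open>one\<close> have no meaning.
\<close>

definition base :: "('k::field, 'k) module" where
  "base = \<lparr>carrier = UNIV, mult = (*), one = 1, zero = 0, add = (+), smult = (*)\<rparr>"

definition lin_hom ::
  "('k::field, 'm, 'x) module_scheme \<Rightarrow> ('k, 'n, 'y) module_scheme \<Rightarrow> ('m \<Rightarrow> 'n) \<Rightarrow> bool" where
  "lin_hom M N f \<longleftrightarrow>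
     f \<in> carrier M \<rightarrow> carrier N \<and>
     (\<forall>x\<in>carrier M. \<forall>y\<in>carrier M. f (x \<oplus>\<^bsub>M\<^esub> y) = f x \<oplus>\<^bsub>N\<^esub> f y) \<and>
     (\<forall>c. \<forall>x\<in>carrier M. f (c \<odot>\<^bsub>M\<^esub> x) = c \<odot>\<^bsub>N\<^esub> f x)"

definition alg_hom ::
  "('k::field, 'a, 'x) module_scheme \<Rightarrow> ('k, 'b, 'y) module_scheme \<Rightarrow> ('a \<Rightarrow> 'b) \<Rightarrow> bool" where
  "alg_hom A B f \<longleftrightarrow> lin_hom A B f \<and> f \<in> ring_hom A B"

definition is_basis :: "('k::field, 'm, 'x) module_scheme \<Rightarrow> nat \<Rightarrow> (nat \<Rightarrow> 'm) \<Rightarrow> bool" where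
  "is_basis M n e \<longleftrightarrow>
     e \<in> {..<n} \<rightarrow> carrier M \<and>
     (\<forall>x\<in>carrier M. \<exists>!c. c \<in> extensional {..<n} \<and> x = (\<Oplus>\<^bsub>M\<^esub>i\<in>{..<n}. c i \<odot>\<^bsub>M\<^esub> e i))"

definition coord ::
  "('k::field, 'm, 'x) module_scheme \<Rightarrow> nat \<Rightarrow> (nat \<Rightarrow> 'm) \<Rightarrow> 'm \<Rightarrow> nat \<Rightarrow> 'k" where
  "coord M n e x =
     (THE c. c \<in> extensional {..<n} \<and> x = (\<Oplus>\<^bsub>M\<^esub>i\<in>{..<n}. c i \<odot>\<^bsub>M\<^esub> e i))"

definition gen_submodule :: "('k::field, 'm, 'x) module_scheme \<Rightarrow> 'm set \<Rightarrow> 'm set" where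
  "gen_submodule M S = \<Inter>{N. submodule N base M \<and> S \<subseteq> N}"

text \<open>
  The quotient by a submodule, or by an ideal in the case of an algebra: the library's \<open>M Quot N\<close>
  with scalar multiplication added. For a mere submodule \<open>N\<close> only the vector space part is used.
\<close>

definition quot_module :: "('k::field, 'm, 'x) module_scheme \<Rightarrow> 'm set \<Rightarrow> ('k, 'm set) module" where
  "quot_module M N =
     ring.extend (M Quot N) (module.fields (\<lambda>c X. \<Union>x\<in>X. N +>\<^bsub>M\<^esub> (c \<odot>\<^bsub>M\<^esub> x)))"

definition rep :: "'a set \<Rightarrow> 'a" where
  "rep X = (SOME x. x \<in> X)"


section \<open>Tensor products\<close>

definition free_space ::
  "('k::field, 'm, 'x) module_scheme \<Rightarrow> ('k, 'n, 'y) module_scheme \<Rightarrow> ('k, 'm \<times> 'n \<Rightarrow>\<^sub>0 'k) module" where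
  "free_space M N =
     \<lparr>carrier = {p. Poly_Mapping.keys p \<subseteq> carrier M \<times> carrier N},
      mult = undefined, one = undefined, zero = 0, add = (+),
      smult = (\<lambda>c. Poly_Mapping.map ((*) c))\<rparr>"

abbreviation gen :: "'m \<Rightarrow> 'n \<Rightarrow> 'm \<times> 'n \<Rightarrow>\<^sub>0 'k::field" where
  "gen m n \<equiv> Poly_Mapping.single (m, n) 1"

definition tensor_rels ::
  "('k::field, 'm, 'x) module_scheme \<Rightarrow> ('k, 'n, 'y) module_scheme \<Rightarrow> ('m \<times> 'n \<Rightarrow>\<^sub>0 'k) set" where
  "tensor_rels M N =
     {gen (x \<oplus>\<^bsub>M\<^esub> y) z - gen x z - gen y z | x y z.
        x \<in> carrier M \<and> y \<in> carrier M \<and> z \<in> carrier N} \<union>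
     {gen x (y \<oplus>\<^bsub>N\<^esub> z) - gen x y - gen x z | x y z.
        x \<in> carrier M \<and> y \<in> carrier N \<and> z \<in> carrier N} \<union>
     {gen (c \<odot>\<^bsub>M\<^esub> x) y - Poly_Mapping.single (x, y) c | c x y. x \<in> carrier M \<and> y \<in> carrier N} \<union>
     {gen x (c \<odot>\<^bsub>N\<^esub> y) - Poly_Mapping.single (x, y) c | c x y. x \<in> carrier M \<and> y \<in> carrier N}"

definition tensor_null ::
  "('k::field, 'm, 'x) module_scheme \<Rightarrow> ('k, 'n, 'y) module_scheme \<Rightarrow> ('m \<times> 'n \<Rightarrow>\<^sub>0 'k) set" where
  "tensor_null M N = gen_submodule (free_space M N) (tensor_rels M N)"

definition tensor ::
  "('k::field, 'm, 'x) module_scheme \<Rightarrow> ('k, 'n, 'y) module_scheme \<Rightarrow>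
   ('k, ('m \<times> 'n \<Rightarrow>\<^sub>0 'k) set) module" where
  "tensor M N = quot_module (free_space M N) (tensor_null M N)"

definition tens ::
  "('k::field, 'm, 'x) module_scheme \<Rightarrow> ('k, 'n, 'y) module_scheme \<Rightarrow>
   'm \<Rightarrow> 'n \<Rightarrow> ('m \<times> 'n \<Rightarrow>\<^sub>0 'k) set" where
  "tens M N m n = tensor_null M N +>\<^bsub>free_space M N\<^esub> gen m n"

text \<open>
  The linear map \<open>M \<otimes> N \<rightarrow> Q\<close>, \<open>m \<otimes> n \<mapsto> b m n\<close>, induced by a bilinear map \<open>b\<close>. For bilinear \<open>b\<close> it
  does not depend on the representative.
\<close>

definition tlift ::
  "('k::field, 'm, 'x) module_scheme \<Rightarrow> ('k, 'n, 'y) module_scheme \<Rightarrow> ('k, 'q, 'z) module_scheme \<Rightarrow>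
   ('m \<Rightarrow> 'n \<Rightarrow> 'q) \<Rightarrow> ('m \<times> 'n \<Rightarrow>\<^sub>0 'k) set \<Rightarrow> 'q" where
  "tlift M N Q b T =
     (\<Oplus>\<^bsub>Q\<^esub>v\<in>Poly_Mapping.keys (rep T).
        Poly_Mapping.lookup (rep T) v \<odot>\<^bsub>Q\<^esub> b (fst v) (snd v))"

text \<open>\<open>f \<otimes> g : M \<otimes> N \<rightarrow> M' \<otimes> N'\<close>\<close>

definition tmap ::
  "('k::field, 'm, 'x) module_scheme \<Rightarrow> ('k, 'n, 'y) module_scheme \<Rightarrow>
   ('k, 'p, 'z) module_scheme \<Rightarrow> ('k, 'q, 'w) module_scheme \<Rightarrow>
   ('m \<Rightarrow> 'p) \<Rightarrow> ('n \<Rightarrow> 'q) \<Rightarrow> ('m \<times> 'n \<Rightarrow>\<^sub>0 'k) set \<Rightarrow> ('p \<times> 'q \<Rightarrow>\<^sub>0 'k) set" where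
  "tmap M N M' N' f g = tlift M N (tensor M' N') (\<lambda>m n. tens M' N' (f m) (g n))"

text \<open>The identifications \<open>(M \<otimes> N) \<otimes> P = M \<otimes> (N \<otimes> P)\<close>, \<open>M \<otimes> K = M\<close> and \<open>K \<otimes> M = M\<close>\<close>

definition tassoc ::
  "('k::field, 'm, 'x) module_scheme \<Rightarrow> ('k, 'n, 'y) module_scheme \<Rightarrow> ('k, 'p, 'z) module_scheme \<Rightarrow>
   (('m \<times> 'n \<Rightarrow>\<^sub>0 'k) set \<times> 'p \<Rightarrow>\<^sub>0 'k) set \<Rightarrow> ('m \<times> ('n \<times> 'p \<Rightarrow>\<^sub>0 'k) set \<Rightarrow>\<^sub>0 'k) set" where
  "tassoc M N P =
     tlift (tensor M N) P (tensor M (tensor N P))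
       (\<lambda>t p. tlift M N (tensor M (tensor N P)) (\<lambda>m n. tens M (tensor N P) m (tens N P n p)) t)"

definition runit :: "('k::field, 'm, 'x) module_scheme \<Rightarrow> ('m \<times> 'k \<Rightarrow>\<^sub>0 'k) set \<Rightarrow> 'm" where
  "runit M = tlift M base M (\<lambda>m c. c \<odot>\<^bsub>M\<^esub> m)"

definition lunit :: "('k::field, 'm, 'x) module_scheme \<Rightarrow> ('k \<times> 'm \<Rightarrow>\<^sub>0 'k) set \<Rightarrow> 'm" where
  "lunit M = tlift base M M (\<lambda>c m. c \<odot>\<^bsub>M\<^esub> m)"

text \<open>The algebra \<open>A \<otimes> B\<close> with \<open>(a \<otimes> b)(a' \<otimes> b') = aa' \<otimes> bb'\<close>\<close>

definition tensor_alg ::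
  "('k::field, 'a, 'x) module_scheme \<Rightarrow> ('k, 'b, 'y) module_scheme \<Rightarrow>
   ('k, ('a \<times> 'b \<Rightarrow>\<^sub>0 'k) set) module" where
  "tensor_alg A B = (tensor A B)
     \<lparr>mult := (\<lambda>s t. tlift A B (tensor A B) (\<lambda>a b. tlift A B (tensor A B)
                (\<lambda>a' b'. tens A B (a \<otimes>\<^bsub>A\<^esub> a') (b \<otimes>\<^bsub>B\<^esub> b')) t) s),
      one := tens A B \<one>\<^bsub>A\<^esub> \<one>\<^bsub>B\<^esub>\<rparr>"

definition mult_map :: "('k::field, 'a, 'x) module_scheme \<Rightarrow> ('a \<times> 'a \<Rightarrow>\<^sub>0 'k) set \<Rightarrow> 'a" where
  "mult_map A = tlift A A A (\<lambda>a b. a \<otimes>\<^bsub>A\<^esub> b)"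


section \<open>Commutative bialgebras and Hopf algebras, comodules\<close>

record (overloaded) ('k, 'a) bialgebra = "('k, 'a) module" +
  comult :: "'a \<Rightarrow> ('a \<times> 'a \<Rightarrow>\<^sub>0 'k) set"
  counit :: "'a \<Rightarrow> 'k"

record (overloaded) ('k, 'a) hopf_algebra = "('k, 'a) bialgebra" +
  antipode :: "'a \<Rightarrow> 'a"

definition comm_bialgebra :: "('k::field, 'a, 'x) bialgebra_scheme \<Rightarrow> bool" where
  "comm_bialgebra B \<longleftrightarrow>
     algebra base B \<and>
     alg_hom B (tensor_alg B B) (comult B) \<and>
     alg_hom B base (counit B) \<and>
     (\<forall>x\<in>carrier B.
        tassoc B B B (tmap B B (tensor B B) B (comult B) id (comult B x))
          = tmap B B B (tensor B B) id (comult B) (comult B x) \<and>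
        runit B (tmap B B B base id (counit B) (comult B x)) = x \<and>
        lunit B (tmap B B base B (counit B) id (comult B x)) = x)"

definition bialg_hom ::
  "('k::field, 'a, 'x) bialgebra_scheme \<Rightarrow> ('k, 'b, 'y) bialgebra_scheme \<Rightarrow> ('a \<Rightarrow> 'b) \<Rightarrow> bool" where
  "bialg_hom A B f \<longleftrightarrow>
     alg_hom A B f \<and>
     (\<forall>x\<in>carrier A. comult B (f x) = tmap A A B B f f (comult A x) \<and>
                    counit B (f x) = counit A x)"

definition comm_hopf_algebra :: "('k::field, 'a, 'x) hopf_algebra_scheme \<Rightarrow> bool" where
  "comm_hopf_algebra H \<longleftrightarrow>
     comm_bialgebra H \<and>
     lin_hom H H (antipode H) \<and>
     (\<forall>x\<in>carrier H.
        mult_map H (tmap H H H H (antipode H) id (comult H x)) = counit H x \<odot>\<^bsub>H\<^esub> \<one>\<^bsub>H\<^esub> \<and>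
        mult_map H (tmap H H H H id (antipode H) (comult H x)) = counit H x \<odot>\<^bsub>H\<^esub> \<one>\<^bsub>H\<^esub>)"

definition hopf_hom ::
  "('k::field, 'a, 'x) hopf_algebra_scheme \<Rightarrow> ('k, 'b, 'y) hopf_algebra_scheme \<Rightarrow>
   ('a \<Rightarrow> 'b) \<Rightarrow> bool" where
  "hopf_hom A B f \<longleftrightarrow>
     bialg_hom A B f \<and> (\<forall>x\<in>carrier A. f (antipode A x) = antipode B (f x))"

text \<open>Right comodules; of \<open>C\<close> only the coalgebra structure is used.\<close>

definition right_comodule ::
  "('k::field, 'm, 'x) module_scheme \<Rightarrow> ('k, 'c, 'y) bialgebra_scheme \<Rightarrow>
   ('m \<Rightarrow> ('m \<times> 'c \<Rightarrow>\<^sub>0 'k) set) \<Rightarrow> bool" where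
  "right_comodule M C f \<longleftrightarrow>
     module base M \<and>
     lin_hom M (tensor M C) f \<and>
     (\<forall>x\<in>carrier M.
        tmap M C M (tensor C C) id (comult C) (f x)
          = tassoc M C C (tmap M C (tensor M C) C f id (f x)) \<and>
        runit M (tmap M C M base id (counit C) (f x)) = x)"

text \<open>
  \<open>(U, \<mu>)\<close> is a free commutative Hopf algebra on the commutative bialgebra \<open>B\<close>: the bialgebra
  morphism \<open>\<mu>\<close> is a universal arrow from \<open>B\<close> to the forgetful functor from commutative Hopf algebras
  to commutative bialgebras, i.e. \<open>U\<close> is the value at \<open>B\<close> of its left adjoint and \<open>\<mu>\<close> the component
  of the unit. HOL cannot quantify over types inside a formula, so the Hopf algebras against which
  universality is tested live on the type given by the first argument. Uniqueness of a morphism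
  means uniqueness on the carrier, hence the use of \<open>extensional\<close>.
\<close>

definition free_comm_hopf ::
  "'h itself \<Rightarrow> ('k::field, 'b, 'x) bialgebra_scheme \<Rightarrow> ('k, 'u) hopf_algebra \<Rightarrow>
   ('b \<Rightarrow> 'u) \<Rightarrow> bool" where
  "free_comm_hopf T B U \<mu> \<longleftrightarrow>
     comm_hopf_algebra U \<and> bialg_hom B U \<mu> \<and>
     (\<forall>(H :: ('k, 'h) hopf_algebra) \<phi>. comm_hopf_algebra H \<and> bialg_hom B H \<phi> \<longrightarrow>
        (\<exists>!g. g \<in> extensional (carrier U) \<and> hopf_hom U H g \<and>
              (\<forall>b\<in>carrier B. g (\<mu> b) = \<phi> b)))"


section \<open>Lie-Yamaguti algebras\<close>

text \<open>\<open>\<langle>a, b\<rangle>\<close> stands for \<open>[a, b]\<close>, which would clash with list notation.\<close>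

record ('k, 'l) ly_algebra = "('k, 'l) module" +
  bracket :: "'l \<Rightarrow> 'l \<Rightarrow> 'l" (\<open>\<langle>_,_\<rangle>\<index>\<close>)
  triple :: "'l \<Rightarrow> 'l \<Rightarrow> 'l \<Rightarrow> 'l" (\<open>\<lbrace>_,_,_\<rbrace>\<index>\<close>)

locale lie_yamaguti =
  module "base :: ('k::field, 'k) module" L for L :: "('k::field, 'l, 'x) ly_algebra_scheme" (structure) +
  assumes bracket_bilinear:
      "\<And>a. a \<in> carrier L \<Longrightarrow> lin_hom L L (\<lambda>b. \<langle>a, b\<rangle>)"
      "\<And>b. b \<in> carrier L \<Longrightarrow> lin_hom L L (\<lambda>a. \<langle>a, b\<rangle>)"
    and triple_trilinear:
      "\<And>a b. a \<in> carrier L \<Longrightarrow> b \<in> carrier L \<Longrightarrow> lin_hom L L (\<lambda>c. \<lbrace>a, b, c\<rbrace>)"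
      "\<And>a c. a \<in> carrier L \<Longrightarrow> c \<in> carrier L \<Longrightarrow> lin_hom L L (\<lambda>b. \<lbrace>a, b, c\<rbrace>)"
      "\<And>b c. b \<in> carrier L \<Longrightarrow> c \<in> carrier L \<Longrightarrow> lin_hom L L (\<lambda>a. \<lbrace>a, b, c\<rbrace>)"
    and LY1: "\<And>a b. a \<in> carrier L \<Longrightarrow> b \<in> carrier L \<Longrightarrow> \<langle>a, b\<rangle> = \<ominus>\<^bsub>L\<^esub> \<langle>b, a\<rangle>"
    and LY2: "\<And>a b c. a \<in> carrier L \<Longrightarrow> b \<in> carrier L \<Longrightarrow> c \<in> carrier L \<Longrightarrow>
        \<lbrace>a, b, c\<rbrace> = \<ominus>\<^bsub>L\<^esub> \<lbrace>b, a, c\<rbrace>"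
    and LY3: "\<And>a b c. a \<in> carrier L \<Longrightarrow> b \<in> carrier L \<Longrightarrow> c \<in> carrier L \<Longrightarrow>
        \<langle>\<langle>a, b\<rangle>, c\<rangle> \<oplus>\<^bsub>L\<^esub> \<lbrace>a, b, c\<rbrace> \<oplus>\<^bsub>L\<^esub> \<langle>\<langle>b, c\<rangle>, a\<rangle> \<oplus>\<^bsub>L\<^esub> \<lbrace>b, c, a\<rbrace>
          \<oplus>\<^bsub>L\<^esub> \<langle>\<langle>c, a\<rangle>, b\<rangle> \<oplus>\<^bsub>L\<^esub> \<lbrace>c, a, b\<rbrace> = \<zero>\<^bsub>L\<^esub>"
    and LY4: "\<And>a b c d. a \<in> carrier L \<Longrightarrow> b \<in> carrier L \<Longrightarrow> c \<in> carrier L \<Longrightarrow> d \<in> carrier L \<Longrightarrow>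
        \<lbrace>\<langle>a, b\<rangle>, c, d\<rbrace> \<oplus>\<^bsub>L\<^esub> \<lbrace>\<langle>b, c\<rangle>, a, d\<rbrace> \<oplus>\<^bsub>L\<^esub> \<lbrace>\<langle>c, a\<rangle>, b, d\<rbrace> = \<zero>\<^bsub>L\<^esub>"
    and LY5: "\<And>a b c d. a \<in> carrier L \<Longrightarrow> b \<in> carrier L \<Longrightarrow> c \<in> carrier L \<Longrightarrow> d \<in> carrier L \<Longrightarrow>
        \<lbrace>a, b, \<langle>c, d\<rangle>\<rbrace> = \<langle>\<lbrace>a, b, c\<rbrace>, d\<rangle> \<oplus>\<^bsub>L\<^esub> \<langle>c, \<lbrace>a, b, d\<rbrace>\<rangle>"
    and LY6: "\<And>a b c d e. a \<in> carrier L \<Longrightarrow> b \<in> carrier L \<Longrightarrow> c \<in> carrier L \<Longrightarrow> d \<in> carrier L \<Longrightarrow>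
        e \<in> carrier L \<Longrightarrow>
        \<lbrace>a, b, \<lbrace>c, d, e\<rbrace>\<rbrace> =
          \<lbrace>\<lbrace>a, b, c\<rbrace>, d, e\<rbrace> \<oplus>\<^bsub>L\<^esub> \<lbrace>c, \<lbrace>a, b, d\<rbrace>, e\<rbrace> \<oplus>\<^bsub>L\<^esub> \<lbrace>c, d, \<lbrace>a, b, e\<rbrace>\<rbrace>"

definition ly_hom ::
  "('k::field, 'l, 'x) ly_algebra_scheme \<Rightarrow> ('k, 'm, 'y) ly_algebra_scheme \<Rightarrow> ('l \<Rightarrow> 'm) \<Rightarrow> bool" where
  "ly_hom L M f \<longleftrightarrow>
     lin_hom L M f \<and>
     (\<forall>a\<in>carrier L. \<forall>b\<in>carrier L. f (bracket L a b) = bracket M (f a) (f b)) \<and>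
     (\<forall>a\<in>carrier L. \<forall>b\<in>carrier L. \<forall>c\<in>carrier L.
        f (triple L a b c) = triple M (f a) (f b) (f c))"

text \<open>
  \<open>L \<otimes> A\<close> with \<open>[x \<otimes> a, y \<otimes> b] = [x, y] \<otimes> ab\<close> and
  \<open>{x \<otimes> a, y \<otimes> b, z \<otimes> c} = {x, y, z} \<otimes> abc\<close>
\<close>

definition tensor_ly ::
  "('k::field, 'l, 'x) ly_algebra_scheme \<Rightarrow> ('k, 'a, 'y) module_scheme \<Rightarrow>
   ('k, ('l \<times> 'a \<Rightarrow>\<^sub>0 'k) set) ly_algebra" where
  "tensor_ly L A = module.extend (tensor L A) (ly_algebra.fields
     (\<lambda>s t. tlift L A (tensor L A) (\<lambda>x a. tlift L A (tensor L A) (\<lambda>y b.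
        tens L A (bracket L x y) (a \<otimes>\<^bsub>A\<^esub> b)) t) s)
     (\<lambda>s t u. tlift L A (tensor L A) (\<lambda>x a. tlift L A (tensor L A) (\<lambda>y b.
        tlift L A (tensor L A) (\<lambda>z c.
          tens L A (triple L x y z) (a \<otimes>\<^bsub>A\<^esub> b \<otimes>\<^bsub>A\<^esub> c)) u) t) s))"


section \<open>The universal algebra of a Lie-Yamaguti algebra\<close>

text \<open>\<open>K[V]\<close>; a polynomial maps monomials (finitely supported exponent functions) to coefficients.\<close>

definition poly_alg :: "'v set \<Rightarrow> ('k::field, ('v \<Rightarrow>\<^sub>0 nat) \<Rightarrow>\<^sub>0 'k) module" where
  "poly_alg V =
     \<lparr>carrier = {p. \<forall>m\<in>Poly_Mapping.keys p. Poly_Mapping.keys m \<subseteq> V},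
      mult = (*), one = 1, zero = 0, add = (+),
      smult = (\<lambda>c. Poly_Mapping.map ((*) c))\<rparr>"

definition var :: "'v \<Rightarrow> ('v \<Rightarrow>\<^sub>0 nat) \<Rightarrow>\<^sub>0 'k::field" where
  "var v = Poly_Mapping.single (Poly_Mapping.single v 1) 1"

text \<open>The value of a polynomial under the substitution \<open>v \<mapsto> \<xi> v\<close> in a commutative algebra\<close>

definition poly_eval ::
  "('k::field, 'a, 'x) module_scheme \<Rightarrow> ('v \<Rightarrow> 'a) \<Rightarrow> (('v \<Rightarrow>\<^sub>0 nat) \<Rightarrow>\<^sub>0 'k) \<Rightarrow> 'a" where
  "poly_eval A \<xi> p =
     (\<Oplus>\<^bsub>A\<^esub>m\<in>Poly_Mapping.keys p. Poly_Mapping.lookup p m \<odot>\<^bsub>A\<^esub>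
        (\<Otimes>\<^bsub>A\<^esub>v\<in>Poly_Mapping.keys m. \<xi> v [^]\<^bsub>A\<^esub> Poly_Mapping.lookup m v))"

text \<open>
  Indices run over \<open>0, \<dots>, n - 1\<close>. The scalars \<open>\<tau> i j s\<close> and \<open>\<omega> i j k s\<close> are the structure constants
  of \<open>L\<close> with respect to the basis \<open>e\<close>.
\<close>

definition univ_ideal ::
  "('k::field, 'l, 'x) ly_algebra_scheme \<Rightarrow> nat \<Rightarrow> (nat \<Rightarrow> 'l) \<Rightarrow>
   ((nat \<times> nat \<Rightarrow>\<^sub>0 nat) \<Rightarrow>\<^sub>0 'k) set" where
  "univ_ideal L n e =
    (let P = poly_alg ({..<n} \<times> {..<n});
         \<tau> = (\<lambda>i j. coord L n e (bracket L (e i) (e j)));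
         \<omega> = (\<lambda>i j k. coord L n e (triple L (e i) (e j) (e k)))
     in Idl\<^bsub>P\<^esub>
       ({(\<Sum>u<n. \<tau> i j u \<odot>\<^bsub>P\<^esub> var (a, u))
           - (\<Sum>s<n. \<Sum>t<n. \<tau> s t a \<odot>\<^bsub>P\<^esub> (var (s, i) * var (t, j)))
         | a i j. a < n \<and> i < n \<and> j < n} \<union>
        {(\<Sum>u<n. \<omega> i j k u \<odot>\<^bsub>P\<^esub> var (a, u))
           - (\<Sum>r<n. \<Sum>s<n. \<Sum>t<n. \<omega> r s t a \<odot>\<^bsub>P\<^esub> (var (r, i) * var (s, j) * var (t, k)))
         | a i j k. a < n \<and> i < n \<and> j < n \<and> k < n}))"

definition univ_alg ::
  "('k::field, 'l, 'x) ly_algebra_scheme \<Rightarrow> nat \<Rightarrow> (nat \<Rightarrow> 'l) \<Rightarrow>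
   ('k, ((nat \<times> nat \<Rightarrow>\<^sub>0 nat) \<Rightarrow>\<^sub>0 'k) set) module" where
  "univ_alg L n e = quot_module (poly_alg ({..<n} \<times> {..<n})) (univ_ideal L n e)"

text \<open>The class \<open>x\<^bsub>si\<^esub>\<close> of the variable \<open>X\<^bsub>si\<^esub>\<close>\<close>

definition univ_gen ::
  "('k::field, 'l, 'x) ly_algebra_scheme \<Rightarrow> nat \<Rightarrow> (nat \<Rightarrow> 'l) \<Rightarrow> nat \<Rightarrow> nat \<Rightarrow>
   ((nat \<times> nat \<Rightarrow>\<^sub>0 nat) \<Rightarrow>\<^sub>0 'k) set" where
  "univ_gen L n e s i = univ_ideal L n e +>\<^bsub>poly_alg ({..<n} \<times> {..<n})\<^esub> var (s, i)"

text \<open>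
  The algebra maps \<open>\<Delta>\<close> and \<open>\<epsilon>\<close> are given by substituting the prescribed values
  \<open>\<Delta>(x\<^bsub>ij\<^esub>) = \<Sum>\<^bsub>s\<^esub> x\<^bsub>is\<^esub> \<otimes> x\<^bsub>sj\<^esub>\<close> and \<open>\<epsilon>(x\<^bsub>ij\<^esub>) = \<delta>\<^bsub>ij\<^esub>\<close> for the variables of a representative.
\<close>

definition univ_bialg ::
  "('k::field, 'l, 'x) ly_algebra_scheme \<Rightarrow> nat \<Rightarrow> (nat \<Rightarrow> 'l) \<Rightarrow>
   ('k, ((nat \<times> nat \<Rightarrow>\<^sub>0 nat) \<Rightarrow>\<^sub>0 'k) set) bialgebra" where
  "univ_bialg L n e =
    (let A = univ_alg L n e; x = univ_gen L n e
     in module.extend A (bialgebra.fields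
          (\<lambda>X. poly_eval (tensor_alg A A)
                 (\<lambda>(i, j). \<Oplus>\<^bsub>tensor_alg A A\<^esub>s\<in>{..<n}. tens A A (x i s) (x s j)) (rep X))
          (\<lambda>X. poly_eval base (\<lambda>(i, j). if i = j then 1 else 0) (rep X))))"

text \<open>The linear map \<open>\<Phi> : L \<rightarrow> L \<otimes> A(L)\<close> with \<open>\<Phi>(e\<^bsub>i\<^esub>) = \<Sum>\<^bsub>s\<^esub> e\<^bsub>s\<^esub> \<otimes> x\<^bsub>si\<^esub>\<close>\<close>

definition univ_coaction ::
  "('k::field, 'l, 'x) ly_algebra_scheme \<Rightarrow> nat \<Rightarrow> (nat \<Rightarrow> 'l) \<Rightarrow>
   'l \<Rightarrow> ('l \<times> ((nat \<times> nat \<Rightarrow>\<^sub>0 nat) \<Rightarrow>\<^sub>0 'k) set \<Rightarrow>\<^sub>0 'k) set" where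
  "univ_coaction L n e v =
    (let A = univ_alg L n e; T = tensor L A
     in \<Oplus>\<^bsub>T\<^esub>i\<in>{..<n}. coord L n e v i \<odot>\<^bsub>T\<^esub>
          (\<Oplus>\<^bsub>T\<^esub>s\<in>{..<n}. tens L A (e s) (univ_gen L n e s i)))"


section \<open>The universal coacting Hopf algebra\<close>

text \<open>
  \<open>(U, X)\<close> is the free commutative Hopf algebra on the bialgebra \<open>A(L)\<close> together with
  \<open>X = (id \<otimes> \<mu>) \<circ> \<Phi>\<close>. Like any value of a left adjoint it is determined only up to isomorphism,
  hence a predicate.
\<close>

definition universal_coacting_hopf ::
  "'h itself \<Rightarrow> ('k::field, 'l, 'x) ly_algebra_scheme \<Rightarrow> nat \<Rightarrow> (nat \<Rightarrow> 'l) \<Rightarrow>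
   ('k, 'u) hopf_algebra \<Rightarrow> ('l \<Rightarrow> ('l \<times> 'u \<Rightarrow>\<^sub>0 'k) set) \<Rightarrow> bool" where
  "universal_coacting_hopf T L n e U X \<longleftrightarrow>
     (\<exists>\<mu>. free_comm_hopf T (univ_bialg L n e) U \<mu> \<and>
          (\<forall>v\<in>carrier L. X v = tmap L (univ_alg L n e) L U id \<mu> (univ_coaction L n e v)))"

end

theory Submission
  imports Defs
begin

text \<open>
  Let \<open>A\<close> be the universal algebra of \<open>L\<close>, with generators \<open>x\<^sub>s\<^sub>i\<close>. A linear map \<open>f : L \<rightarrow> L \<otimes> H\<close> is
  the same as a matrix \<open>h\<close> over \<open>H\<close>, by \<open>f(e\<^sub>i) = \<Sum>\<^sub>s e\<^sub>s \<otimes> h\<^sub>s\<^sub>i\<close>, because tensors over a finite basis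
  have unique coefficients (\<open>tensor_expansion\<close>, \<open>tcoord_finsum\<close>). In terms of \<open>h\<close>, the map \<open>f\<close>
  preserves both brackets exactly when \<open>h\<close> satisfies the defining relations of \<open>A\<close> (used in
  \<open>h_bracket\<close>, \<open>h_triple\<close>), that is, when there is an algebra morphism \<open>\<phi> : A \<rightarrow> H\<close> with
  \<open>\<phi>(x\<^sub>s\<^sub>i) = h\<^sub>s\<^sub>i\<close>; and \<open>f\<close> is a comodule structure exactly when \<open>\<Delta>(h\<^sub>a\<^sub>i) = \<Sum>\<^sub>s h\<^sub>a\<^sub>s \<otimes> h\<^sub>s\<^sub>i\<close> and
  \<open>\<epsilon>(h\<^sub>a\<^sub>i) = \<delta>\<^sub>a\<^sub>i\<close> (used in \<open>h_comult\<close>, \<open>h_counit\<close>), that is, when \<open>\<phi>\<close> is a bialgebra morphism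
  (\<open>phi_bialg_hom\<close>).

  For a Hopf algebra morphism \<open>g : U \<rightarrow> H\<close>, the map \<open>(id \<otimes> g) \<circ> X = (id \<otimes> (g \<circ> \<mu>)) \<circ> \<Phi>\<close> has the matrix
  with entries \<open>g(\<mu>(x\<^sub>s\<^sub>i))\<close>. As \<open>A\<close> is generated by the \<open>x\<^sub>s\<^sub>i\<close>, it equals \<open>f\<close> if and only if
  \<open>g \<circ> \<mu> = \<phi>\<close> (\<open>recovers_iff\<close>). The free commutative Hopf algebra provides exactly one such \<open>g\<close>.

  Most of what follows is the algebra behind these statements for carrier-based structures: universal
  properties of tensor products (\<open>tlift_lin_hom\<close>, \<open>tlift_tens\<close>), quotients and polynomial algebras
  (\<open>poly_eval_alg_hom\<close>), and the fact that a tensor product of commutative algebras is one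
  (\<open>tensor_alg_algebra\<close>), which is needed to substitute into \<open>A \<otimes> A\<close> and \<open>H \<otimes> H\<close>.
\<close>

section \<open>Linear maps\<close>

lemma base_simps [simp]:
  "carrier base = UNIV" "mult base = (*)" "one base = 1" "zero base = 0" "add base = (+)"
  "smult base = (*)"
  by (simp_all add: base_def)

lemma cring_base: "cring (base :: ('k::field, 'k) module)"
proof (rule cringI)
  show "abelian_group (base :: ('k, 'k) module)"
  proof (rule abelian_groupI)
    fix x :: 'k
    show "\<exists>y\<in>carrier base. y \<oplus>\<^bsub>base\<^esub> x = \<zero>\<^bsub>base\<^esub>"
      by (rule bexI[of _ "- x"]) auto
  qed (auto simp: ac_simps)
  show "comm_monoid (base :: ('k, 'k) module)"
    by (rule comm_monoidI) (auto simp: ac_simps)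
qed (auto simp: algebra_simps)

lemma vector_spaceI:
  fixes M :: "('k::field, 'm, 'x) module_scheme"
  assumes "abelian_group M"
    and "\<And>c x. x \<in> carrier M \<Longrightarrow> c \<odot>\<^bsub>M\<^esub> x \<in> carrier M"
    and "\<And>c d x. x \<in> carrier M \<Longrightarrow> (c + d) \<odot>\<^bsub>M\<^esub> x = c \<odot>\<^bsub>M\<^esub> x \<oplus>\<^bsub>M\<^esub> d \<odot>\<^bsub>M\<^esub> x"
    and "\<And>c x y. x \<in> carrier M \<Longrightarrow> y \<in> carrier M \<Longrightarrow> c \<odot>\<^bsub>M\<^esub> (x \<oplus>\<^bsub>M\<^esub> y) = c \<odot>\<^bsub>M\<^esub> x \<oplus>\<^bsub>M\<^esub> c \<odot>\<^bsub>M\<^esub> y"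
    and "\<And>c d x. x \<in> carrier M \<Longrightarrow> (c * d) \<odot>\<^bsub>M\<^esub> x = c \<odot>\<^bsub>M\<^esub> (d \<odot>\<^bsub>M\<^esub> x)"
    and "\<And>x. x \<in> carrier M \<Longrightarrow> 1 \<odot>\<^bsub>M\<^esub> x = x"
  shows "module base M"
  by (rule moduleI) (use assms in \<open>simp_all add: cring_base\<close>)

lemma algebra_baseI:
  fixes A :: "('k::field, 'm, 'x) module_scheme"
  assumes "module base A" and "cring A"
    and "\<And>c x y. x \<in> carrier A \<Longrightarrow> y \<in> carrier A \<Longrightarrow> (c \<odot>\<^bsub>A\<^esub> x) \<otimes>\<^bsub>A\<^esub> y = c \<odot>\<^bsub>A\<^esub> (x \<otimes>\<^bsub>A\<^esub> y)"
  shows "algebra base A"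
  by (intro algebra.intro algebra_axioms.intro) (use assms in auto)

lemma lin_homI:
  assumes "\<And>x. x \<in> carrier M \<Longrightarrow> f x \<in> carrier N"
    and "\<And>x y. x \<in> carrier M \<Longrightarrow> y \<in> carrier M \<Longrightarrow> f (x \<oplus>\<^bsub>M\<^esub> y) = f x \<oplus>\<^bsub>N\<^esub> f y"
    and "\<And>c x. x \<in> carrier M \<Longrightarrow> f (c \<odot>\<^bsub>M\<^esub> x) = c \<odot>\<^bsub>N\<^esub> f x"
  shows "lin_hom M N f"
  using assms by (auto simp: lin_hom_def)

lemma lin_hom_closed: "lin_hom M N f \<Longrightarrow> x \<in> carrier M \<Longrightarrow> f x \<in> carrier N"
  and lin_hom_add: "lin_hom M N f \<Longrightarrow> x \<in> carrier M \<Longrightarrow> y \<in> carrier M \<Longrightarrow>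
    f (x \<oplus>\<^bsub>M\<^esub> y) = f x \<oplus>\<^bsub>N\<^esub> f y"
  and lin_hom_smult: "lin_hom M N f \<Longrightarrow> x \<in> carrier M \<Longrightarrow> f (c \<odot>\<^bsub>M\<^esub> x) = c \<odot>\<^bsub>N\<^esub> f x"
  by (auto simp: lin_hom_def)

lemma lin_hom_comp: "lin_hom M N f \<Longrightarrow> lin_hom N Q g \<Longrightarrow> lin_hom M Q (\<lambda>x. g (f x))"
  by (rule lin_homI) (simp_all add: lin_hom_closed lin_hom_add lin_hom_smult)

lemma lin_hom_id: "lin_hom M M (\<lambda>x. x)"
  and lin_hom_id_map: "lin_hom M M id"
  by (auto intro: lin_homI)

lemma lin_hom_cong:
  assumes "module base M" and "\<And>x. x \<in> carrier M \<Longrightarrow> f x = g x"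
  shows "lin_hom M N f \<longleftrightarrow> lin_hom M N g"
proof -
  interpret M: module base M by fact
  show ?thesis using assms(2) M.smult_closed by (auto simp: lin_hom_def Pi_def)
qed

lemma lin_hom_zero:
  assumes "module base M" and "module base N" and "lin_hom M N f"
  shows "f \<zero>\<^bsub>M\<^esub> = \<zero>\<^bsub>N\<^esub>"
proof -
  interpret M: module base M by fact
  interpret N: module base N by fact
  have "f \<zero>\<^bsub>M\<^esub> = f (0 \<odot>\<^bsub>M\<^esub> \<zero>\<^bsub>M\<^esub>)"
    using M.smult_r_null[of 0] by simp
  also have "\<dots> = 0 \<odot>\<^bsub>N\<^esub> f \<zero>\<^bsub>M\<^esub>"
    by (rule lin_hom_smult[OF assms(3)]) simp
  also have "\<dots> = \<zero>\<^bsub>N\<^esub>"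
    using N.smult_l_null[of "f \<zero>\<^bsub>M\<^esub>"] lin_hom_closed[OF assms(3)] by simp
  finally show ?thesis .
qed

lemma lin_hom_finsum:
  assumes "module base M" and "module base N" and "lin_hom M N f" and "g \<in> I \<rightarrow> carrier M"
  shows "f (\<Oplus>\<^bsub>M\<^esub>i\<in>I. g i) = (\<Oplus>\<^bsub>N\<^esub>i\<in>I. f (g i))"
proof -
  interpret M: module base M by fact
  interpret N: module base N by fact
  show ?thesis
    using assms(4)
  proof (induction I rule: infinite_finite_induct)
    case (infinite A)
    then show ?case by (simp add: lin_hom_zero[OF assms(1-3)])
  next
    case empty
    then show ?case by (simp add: lin_hom_zero[OF assms(1-3)])
  next
    case (insert x F)
    then show ?case
      by (simp add: Pi_def lin_hom_closed[OF assms(3)] lin_hom_add[OF assms(3)])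
  qed
qed

lemma lin_hom_finsum_fun:
  assumes "module base M" and "module base N" and "\<And>i. i \<in> I \<Longrightarrow> lin_hom M N (h i)"
  shows "lin_hom M N (\<lambda>x. \<Oplus>\<^bsub>N\<^esub>i\<in>I. h i x)"
proof -
  interpret M: module base M by fact
  interpret N: module base N by fact
  have cl: "\<And>i x. i \<in> I \<Longrightarrow> x \<in> carrier M \<Longrightarrow> h i x \<in> carrier N"
    by (rule lin_hom_closed[OF assms(3)])
  show ?thesis
  proof (rule lin_homI)
    fix x y assume xy: "x \<in> carrier M" "y \<in> carrier M"
    have "(\<Oplus>\<^bsub>N\<^esub>i\<in>I. h i (x \<oplus>\<^bsub>M\<^esub> y)) = (\<Oplus>\<^bsub>N\<^esub>i\<in>I. h i x \<oplus>\<^bsub>N\<^esub> h i y)"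
      by (rule N.finsum_cong') (auto simp: cl xy lin_hom_add[OF assms(3)])
    also have "\<dots> = (\<Oplus>\<^bsub>N\<^esub>i\<in>I. h i x) \<oplus>\<^bsub>N\<^esub> (\<Oplus>\<^bsub>N\<^esub>i\<in>I. h i y)"
      by (rule N.finsum_addf) (auto simp: cl xy)
    finally show "(\<Oplus>\<^bsub>N\<^esub>i\<in>I. h i (x \<oplus>\<^bsub>M\<^esub> y)) = (\<Oplus>\<^bsub>N\<^esub>i\<in>I. h i x) \<oplus>\<^bsub>N\<^esub> (\<Oplus>\<^bsub>N\<^esub>i\<in>I. h i y)" .
  next
    fix c x assume x: "x \<in> carrier M"
    have "(\<Oplus>\<^bsub>N\<^esub>i\<in>I. h i (c \<odot>\<^bsub>M\<^esub> x)) = (\<Oplus>\<^bsub>N\<^esub>i\<in>I. c \<odot>\<^bsub>N\<^esub> h i x)"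
      by (rule N.finsum_cong') (auto simp: cl x lin_hom_smult[OF assms(3)] N.smult_closed)
    also have "\<dots> = c \<odot>\<^bsub>N\<^esub> (\<Oplus>\<^bsub>N\<^esub>i\<in>I. h i x)"
      using N.finsum_smult_ldistr[of I c "\<lambda>i. h i x"] N.smult_r_null[of c]
      by (cases "finite I") (auto simp: cl x)
    finally show "(\<Oplus>\<^bsub>N\<^esub>i\<in>I. h i (c \<odot>\<^bsub>M\<^esub> x)) = c \<odot>\<^bsub>N\<^esub> (\<Oplus>\<^bsub>N\<^esub>i\<in>I. h i x)" .
  qed (auto intro!: N.finsum_closed cl)
qed

lemma lin_hom_smult_fun:
  assumes "module base N" and "lin_hom M N h"
  shows "lin_hom M N (\<lambda>x. c \<odot>\<^bsub>N\<^esub> h x)"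
proof -
  interpret N: module base N by fact
  show ?thesis
    using N.smult_assoc1[symmetric]
    by (intro lin_homI)
      (simp_all add: lin_hom_closed[OF assms(2)] lin_hom_add[OF assms(2)]
        lin_hom_smult[OF assms(2)] N.smult_closed N.smult_r_distr mult.commute)
qed

text \<open>Scalar multiplication is linear in the scalar.\<close>

lemma lin_hom_scalar:
  assumes "module base N" and "y \<in> carrier N"
  shows "lin_hom base N (\<lambda>c. c \<odot>\<^bsub>N\<^esub> y)"
proof -
  interpret N: module base N by fact
  show ?thesis
    using N.smult_l_distr[OF _ _ assms(2)] N.smult_assoc1[OF _ _ assms(2)] assms(2)
    by (intro lin_homI) auto
qed

lemma lin_hom_scale:
  assumes "module base N"
  shows "lin_hom N N (\<lambda>x. c \<odot>\<^bsub>N\<^esub> x)"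
  by (rule lin_hom_smult_fun[OF assms lin_hom_id])

lemma lin_hom_kernel:
  assumes "module base M" and "module base N" and "lin_hom M N f"
  shows "submodule {x \<in> carrier M. f x = \<zero>\<^bsub>N\<^esub>} base M"
proof -
  interpret M: module base M by fact
  interpret N: module base N by fact
  have neg: "\<ominus>\<^bsub>M\<^esub> a = (- 1) \<odot>\<^bsub>M\<^esub> a" if "a \<in> carrier M" for a
    using M.smult_l_minus[of 1 a] M.smult_one[of a] that
    by (metis M.R.minus_equality M.R.one_closed UNIV_I add.left_inverse base_simps)
  show ?thesis
    using N.smult_r_null
    by (intro M.submoduleI)
       (auto simp: lin_hom_zero[OF assms] neg lin_hom_add[OF assms(3)] lin_hom_smult[OF assms(3)] 
         M.smult_closed)
qed

text \<open>Bilinear maps, the maps that \<^const>\<open>tlift\<close> extends to a tensor product\<close>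

definition bilin ::
  "('k::field, 'm, 'x) module_scheme \<Rightarrow> ('k, 'n, 'y) module_scheme \<Rightarrow> ('k, 'q, 'z) module_scheme \<Rightarrow>
   ('m \<Rightarrow> 'n \<Rightarrow> 'q) \<Rightarrow> bool" where
  "bilin M N Q b \<longleftrightarrow>
     (\<forall>x\<in>carrier M. lin_hom N Q (b x)) \<and> (\<forall>y\<in>carrier N. lin_hom M Q (\<lambda>x. b x y))"

lemma bilinI:
  assumes "\<And>x. x \<in> carrier M \<Longrightarrow> lin_hom N Q (b x)"
    and "\<And>y. y \<in> carrier N \<Longrightarrow> lin_hom M Q (\<lambda>x. b x y)"
  shows "bilin M N Q b"
  using assms by (simp add: bilin_def)

lemma bilinD:
  assumes "bilin M N Q b"
  shows "x \<in> carrier M \<Longrightarrow> lin_hom N Q (b x)"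
    and "y \<in> carrier N \<Longrightarrow> lin_hom M Q (\<lambda>x. b x y)"
  using assms by (simp_all add: bilin_def)

lemma bilin_closed: "bilin M N Q b \<Longrightarrow> x \<in> carrier M \<Longrightarrow> y \<in> carrier N \<Longrightarrow> b x y \<in> carrier Q"
  using bilinD(1) lin_hom_closed by metis

lemma bilin_pre:
  assumes "bilin M' N' Q b" and "lin_hom M M' f" and "lin_hom N N' g"
  shows "bilin M N Q (\<lambda>x y. b (f x) (g y))"
proof (rule bilinI)
  fix x assume "x \<in> carrier M"
  then show "lin_hom N Q (\<lambda>y. b (f x) (g y))"
    using lin_hom_comp[OF assms(3) bilinD(1)[OF assms(1)]] lin_hom_closed[OF assms(2)] by blast
next
  fix y assume "y \<in> carrier N"
  then show "lin_hom M Q (\<lambda>x. b (f x) (g y))"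
    using lin_hom_comp[OF assms(2) bilinD(2)[OF assms(1)]] lin_hom_closed[OF assms(3)] by blast
qed


section \<open>Free modules and quotients\<close>

text \<open>
  The linear extension of a map \<open>b\<close> on basis elements. Both \<^const>\<open>tlift\<close> and \<^const>\<open>poly_eval\<close>
  are instances: a polynomial is a formal linear combination of monomials.
\<close>

definition lin_ext :: "('k::field, 'q, 'z) module_scheme \<Rightarrow> ('i \<Rightarrow> 'q) \<Rightarrow> ('i \<Rightarrow>\<^sub>0 'k) \<Rightarrow> 'q" where
  "lin_ext Q b p =
     (\<Oplus>\<^bsub>Q\<^esub>v\<in>Poly_Mapping.keys p. Poly_Mapping.lookup p v \<odot>\<^bsub>Q\<^esub> b v)"

lemma lookup_scale: "Poly_Mapping.lookup (Poly_Mapping.map ((*) c) p) v = c * Poly_Mapping.lookup p v"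
  for c :: "'k::field"
  by (auto simp: Poly_Mapping.map.rep_eq when_def)

lemma keys_scale: "Poly_Mapping.keys (Poly_Mapping.map ((*) c) p) \<subseteq> Poly_Mapping.keys p"
  for c :: "'k::field"
  by (auto simp: in_keys_iff lookup_scale)

text \<open>A structure whose elements are the formal linear combinations of elements of \<open>S\<close>\<close>

definition is_free :: "'i set \<Rightarrow> ('k::field, 'i \<Rightarrow>\<^sub>0 'k, 'x) module_scheme \<Rightarrow> bool" where
  "is_free S F \<longleftrightarrow>
     carrier F = {p. Poly_Mapping.keys p \<subseteq> S} \<and> add F = (+) \<and> zero F = 0 \<and>
     smult F = (\<lambda>c. Poly_Mapping.map ((*) c))"

lemma is_free_simps:
  assumes "is_free S F"
  shows "p \<in> carrier F \<longleftrightarrow> Poly_Mapping.keys p \<subseteq> S" "p \<oplus>\<^bsub>F\<^esub> q = p + q" "\<zero>\<^bsub>F\<^esub> = 0"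
    "c \<odot>\<^bsub>F\<^esub> p = Poly_Mapping.map ((*) c) p"
  using assms by (auto simp: is_free_def)

lemma is_free_module:
  assumes "is_free S F"
  shows "module base F"
proof (rule vector_spaceI)
  note [simp] = is_free_simps[OF assms]
  show "abelian_group F"
  proof (rule abelian_groupI)
    fix x assume "x \<in> carrier F"
    then show "\<exists>y\<in>carrier F. y \<oplus>\<^bsub>F\<^esub> x = \<zero>\<^bsub>F\<^esub>"
      by (intro bexI[of _ "- x"]) (auto simp: in_keys_iff)
  next
    fix x y assume "x \<in> carrier F" "y \<in> carrier F"
    then show "x \<oplus>\<^bsub>F\<^esub> y \<in> carrier F"
      using Poly_Mapping.keys_add[of x y] by auto
  qed (auto simp: ac_simps)
  fix c x assume "x \<in> carrier F"
  then show "c \<odot>\<^bsub>F\<^esub> x \<in> carrier F"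
    using keys_scale[of c x] by auto
qed (auto intro!: poly_mapping_eqI simp: is_free_simps[OF assms] lookup_scale lookup_add algebra_simps)

lemma lin_ext_superset:
  assumes "module base Q" and "finite S" and "Poly_Mapping.keys p \<subseteq> S"
    and "\<And>v. v \<in> S \<Longrightarrow> b v \<in> carrier Q"
  shows "lin_ext Q b p = (\<Oplus>\<^bsub>Q\<^esub>v\<in>S. Poly_Mapping.lookup p v \<odot>\<^bsub>Q\<^esub> b v)"
proof -
  interpret Q: module base Q by fact
  have "Poly_Mapping.lookup p v \<odot>\<^bsub>Q\<^esub> b v = \<zero>\<^bsub>Q\<^esub>" if "v \<in> S - Poly_Mapping.keys p" for v
    using Q.smult_l_null[of "b v"] that assms(4) by (simp add: in_keys_iff)
  then show ?thesis
    unfolding lin_ext_def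
    by (intro Q.add.finprod_mono_neutral_cong_left) (use assms in \<open>auto simp: Q.smult_closed\<close>)
qed

lemma lin_ext_single:
  assumes "module base Q" and "b v \<in> carrier Q"
  shows "lin_ext Q b (Poly_Mapping.single v c) = c \<odot>\<^bsub>Q\<^esub> b v"
proof -
  interpret Q: module base Q by fact
  have "lin_ext Q b (Poly_Mapping.single v c)
      = (\<Oplus>\<^bsub>Q\<^esub>w\<in>{v}. Poly_Mapping.lookup (Poly_Mapping.single v c) w \<odot>\<^bsub>Q\<^esub> b w)"
    by (rule lin_ext_superset) (use assms in auto)
  also have "\<dots> = c \<odot>\<^bsub>Q\<^esub> b v"
    using assms(2) by (simp add: Q.smult_closed)
  finally show ?thesis .
qed

lemma lin_ext_lin_hom:
  assumes "module base Q" and F: "is_free S F" and b: "\<And>v. v \<in> S \<Longrightarrow> b v \<in> carrier Q"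
  shows "lin_hom F Q (lin_ext Q b)"
proof (rule lin_homI)
  interpret Q: module base Q by fact
  note simps = is_free_simps[OF F]
  fix p q assume p: "p \<in> carrier F" and q: "q \<in> carrier F"
  let ?S = "Poly_Mapping.keys p \<union> Poly_Mapping.keys q"
  have bS: "b v \<in> carrier Q" if "v \<in> ?S" for v
    using that p q b by (auto simp: simps)
  have "lin_ext Q b (p \<oplus>\<^bsub>F\<^esub> q) = (\<Oplus>\<^bsub>Q\<^esub>v\<in>?S. Poly_Mapping.lookup (p + q) v \<odot>\<^bsub>Q\<^esub> b v)"
    unfolding simps by (rule lin_ext_superset) (use assms bS Poly_Mapping.keys_add[of p q] in auto)
  also have "\<dots> = (\<Oplus>\<^bsub>Q\<^esub>v\<in>?S. Poly_Mapping.lookup p v \<odot>\<^bsub>Q\<^esub> b v \<oplus>\<^bsub>Q\<^esub> Poly_Mapping.lookup q v \<odot>\<^bsub>Q\<^esub> b v)"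
    using Q.smult_l_distr by (intro Q.finsum_cong') (auto simp: lookup_add bS Q.smult_closed)
  also have "\<dots> = (\<Oplus>\<^bsub>Q\<^esub>v\<in>?S. Poly_Mapping.lookup p v \<odot>\<^bsub>Q\<^esub> b v) \<oplus>\<^bsub>Q\<^esub>
      (\<Oplus>\<^bsub>Q\<^esub>v\<in>?S. Poly_Mapping.lookup q v \<odot>\<^bsub>Q\<^esub> b v)"
    by (intro Q.finsum_addf) (auto simp: bS Q.smult_closed)
  also have "\<dots> = lin_ext Q b p \<oplus>\<^bsub>Q\<^esub> lin_ext Q b q"
    using bS by (intro arg_cong2[of _ _ _ _ "add Q"] lin_ext_superset[symmetric]) (use assms in auto)
  finally show "lin_ext Q b (p \<oplus>\<^bsub>F\<^esub> q) = lin_ext Q b p \<oplus>\<^bsub>Q\<^esub> lin_ext Q b q" .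
next
  interpret Q: module base Q by fact
  note simps = is_free_simps[OF F]
  fix p c assume p: "p \<in> carrier F"
  have bS: "b v \<in> carrier Q" if "v \<in> Poly_Mapping.keys p" for v
    using that p b by (auto simp: simps)
  have "lin_ext Q b (c \<odot>\<^bsub>F\<^esub> p)
      = (\<Oplus>\<^bsub>Q\<^esub>v\<in>Poly_Mapping.keys p. Poly_Mapping.lookup (Poly_Mapping.map ((*) c) p) v \<odot>\<^bsub>Q\<^esub> b v)"
    unfolding simps by (rule lin_ext_superset) (use assms bS keys_scale[of c p] in auto)
  also have "\<dots> = (\<Oplus>\<^bsub>Q\<^esub>v\<in>Poly_Mapping.keys p. c \<odot>\<^bsub>Q\<^esub> (Poly_Mapping.lookup p v \<odot>\<^bsub>Q\<^esub> b v))"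
    using Q.smult_assoc1 by (intro Q.finsum_cong') (auto simp: lookup_scale bS Q.smult_closed)
  also have "\<dots> = c \<odot>\<^bsub>Q\<^esub> lin_ext Q b p"
    unfolding lin_ext_def by (rule Q.finsum_smult_ldistr[symmetric]) (auto simp: bS Q.smult_closed)
  finally show "lin_ext Q b (c \<odot>\<^bsub>F\<^esub> p) = c \<odot>\<^bsub>Q\<^esub> lin_ext Q b p" .
next
  interpret Q: module base Q by fact
  fix p assume "p \<in> carrier F"
  then show "lin_ext Q b p \<in> carrier Q"
    unfolding lin_ext_def
    by (intro Q.finsum_closed) (use b in \<open>auto simp: is_free_simps[OF F] Q.smult_closed\<close>)
qed

text \<open>The coefficients are arbitrary, so that the rule also covers monomials, with exponents in \<open>nat\<close>.\<close>

lemma free_induct [consumes 1, case_names zero add]: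
  fixes p :: "'i \<Rightarrow>\<^sub>0 'c::comm_monoid_add"
  assumes "Poly_Mapping.keys p \<subseteq> S" and "P 0"
    and "\<And>p v c. Poly_Mapping.keys p \<subseteq> S \<Longrightarrow> v \<in> S \<Longrightarrow> P p \<Longrightarrow> P (p + Poly_Mapping.single v c)"
  shows "P p"
  using assms(1)
proof (induction p rule: update_induct)
  case const
  then show ?case using assms(2) by simp
next
  case (update f a b)
  have eq: "Poly_Mapping.update a b f = f + Poly_Mapping.single a b"
    using update(1) 
    by (intro poly_mapping_eqI) (auto simp: lookup_update lookup_add lookup_single when_def in_keys_iff)
  have "insert a (Poly_Mapping.keys f) \<subseteq> S"
    using update by (auto simp: keys_update split: if_splits)
  then show ?case
    unfolding eq using update.IH by (intro assms(3)) auto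
qed

lemma submoduleD:
  assumes "module base M" and "submodule N base M"
  shows "N \<subseteq> carrier M" "\<zero>\<^bsub>M\<^esub> \<in> N" "\<And>a b. a \<in> N \<Longrightarrow> b \<in> N \<Longrightarrow> a \<oplus>\<^bsub>M\<^esub> b \<in> N"
    "\<And>a. a \<in> N \<Longrightarrow> \<ominus>\<^bsub>M\<^esub> a \<in> N" "\<And>c a. a \<in> N \<Longrightarrow> c \<odot>\<^bsub>M\<^esub> a \<in> N"
proof -
  interpret M: module base M by fact
  note E = M.submoduleE[OF assms(2)]
  show "N \<subseteq> carrier M" "\<And>a b. a \<in> N \<Longrightarrow> b \<in> N \<Longrightarrow> a \<oplus>\<^bsub>M\<^esub> b \<in> N"
    "\<And>a. a \<in> N \<Longrightarrow> \<ominus>\<^bsub>M\<^esub> a \<in> N" "\<And>c a. a \<in> N \<Longrightarrow> c \<odot>\<^bsub>M\<^esub> a \<in> N"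
    using E by auto
  obtain a where "a \<in> N" using E(2) by blast
  then show "\<zero>\<^bsub>M\<^esub> \<in> N"
    using E(1) E(3)[of a] E(5)[of a "\<ominus>\<^bsub>M\<^esub> a"] M.r_neg[of a] by auto
qed

lemma gen_submodule:
  assumes "module base M" and "S \<subseteq> carrier M"
  shows "submodule (gen_submodule M S) base M" and "S \<subseteq> gen_submodule M S"
    and "\<And>N. submodule N base M \<Longrightarrow> S \<subseteq> N \<Longrightarrow> gen_submodule M S \<subseteq> N"
proof -
  interpret M: module base M by fact
  show "submodule (gen_submodule M S) base M"
  proof (rule M.submoduleI)
    show "gen_submodule M S \<subseteq> carrier M"
      using M.carrier_is_submodule assms(2) by (auto simp: gen_submodule_def)
  qed (use submoduleD[OF assms(1)] in \<open>auto simp: gen_submodule_def\<close>)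
qed (auto simp: gen_submodule_def)

text \<open>
  The quotient \<open>Q\<close> of a vector space \<open>M\<close> by a subspace \<open>N\<close>. A linear map that vanishes on \<open>N\<close> induces
  a map on \<open>Q\<close> by evaluation at the representative chosen by \<^const>\<open>rep\<close>.
\<close>

locale vs_quotient =
  fixes M :: "('k::field, 'm, 'x) module_scheme" and N :: "'m set"
  assumes module: "module base M" and submodule: "submodule N base M"
begin

interpretation M: module base M by (rule module)

interpretation N: abelian_subgroup N M
  by (rule abelian_subgroupI3) (use submodule in \<open>auto intro!: additive_subgroup.intro simp: submodule_def M.abelian_group_axioms\<close>)

abbreviation "Q \<equiv> quot_module M N"
abbreviation proj where "proj x \<equiv> N +>\<^bsub>M\<^esub> x"

lemma carrier_quot: "carrier Q = proj ` carrier M"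
  by (auto simp: quot_module_def ring.defs module.defs FactRing_def A_RCOSETS_def')

lemma zero_quot: "\<zero>\<^bsub>Q\<^esub> = N"
  by (auto simp: quot_module_def ring.defs module.defs FactRing_def)

lemma add_quot: "x \<in> carrier M \<Longrightarrow> y \<in> carrier M \<Longrightarrow> proj x \<oplus>\<^bsub>Q\<^esub> proj y = proj (x \<oplus>\<^bsub>M\<^esub> y)"
  by (auto simp: quot_module_def ring.defs module.defs FactRing_def N.a_rcos_sum)

lemma proj_mem: "y \<in> proj x \<longleftrightarrow> (\<exists>h\<in>N. y = h \<oplus>\<^bsub>M\<^esub> x)"
  by (auto simp: a_r_coset_def')

lemma proj_add_null: "h \<in> N \<Longrightarrow> x \<in> carrier M \<Longrightarrow> proj (h \<oplus>\<^bsub>M\<^esub> x) = proj x"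
  using M.a_coset_add_assoc[of N h x] N.a_rcos_const[of h] submoduleD(1)[OF module submodule]
  by (simp add: subset_iff)

lemma smult_quot: "x \<in> carrier M \<Longrightarrow> c \<odot>\<^bsub>Q\<^esub> proj x = proj (c \<odot>\<^bsub>M\<^esub> x)"
proof -
  assume x: "x \<in> carrier M"
  have "proj (c \<odot>\<^bsub>M\<^esub> y) = proj (c \<odot>\<^bsub>M\<^esub> x)" if y: "y \<in> proj x" for y
  proof -
    obtain h where h: "h \<in> N" "y = h \<oplus>\<^bsub>M\<^esub> x" using y proj_mem by blast
    then have "c \<odot>\<^bsub>M\<^esub> y = c \<odot>\<^bsub>M\<^esub> h \<oplus>\<^bsub>M\<^esub> c \<odot>\<^bsub>M\<^esub> x"
      using x submoduleD(1)[OF module submodule] M.smult_r_distr[of c h x] by auto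
    then show ?thesis
      using h x submoduleD(5)[OF module submodule] by (simp add: proj_add_null M.smult_closed)
  qed
  moreover have "x \<in> proj x" using x by (rule N.a_rcos_self)
  ultimately have "(\<Union>y\<in>proj x. proj (c \<odot>\<^bsub>M\<^esub> y)) = proj (c \<odot>\<^bsub>M\<^esub> x)"
    by blast
  then show ?thesis
    by (simp add: quot_module_def ring.defs module.defs)
qed

lemma zero_quot': "\<zero>\<^bsub>Q\<^esub> = proj \<zero>\<^bsub>M\<^esub>"
  using M.a_coset_add_zero[of N] submoduleD(1)[OF module submodule] by (simp add: zero_quot)

lemma quot_module: "module base Q"
proof (rule vector_spaceI)
  show "abelian_group Q"
  proof (rule abelian_groupI)
    fix x assume "x \<in> carrier Q"
    then obtain a where a: "a \<in> carrier M" "x = proj a" by (auto simp: carrier_quot)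
    then show "\<exists>y\<in>carrier Q. y \<oplus>\<^bsub>Q\<^esub> x = \<zero>\<^bsub>Q\<^esub>"
      by (intro bexI[of _ "proj (\<ominus>\<^bsub>M\<^esub> a)"])
        (auto simp: add_quot zero_quot' carrier_quot M.l_neg)
  qed (auto simp: carrier_quot add_quot zero_quot' M.a_ac)
next
  fix X :: "'m set" and c :: 'k assume "X \<in> carrier Q"
  then show "c \<odot>\<^bsub>Q\<^esub> X \<in> carrier Q"
    by (auto simp: carrier_quot smult_quot M.smult_closed)
next
  fix X :: "'m set" and c d :: 'k assume "X \<in> carrier Q"
  then show "(c + d) \<odot>\<^bsub>Q\<^esub> X = c \<odot>\<^bsub>Q\<^esub> X \<oplus>\<^bsub>Q\<^esub> d \<odot>\<^bsub>Q\<^esub> X"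
    using M.smult_l_distr[of c d] by (auto simp: carrier_quot smult_quot add_quot M.smult_closed)
next
  fix X Y :: "'m set" and c :: 'k assume "X \<in> carrier Q" "Y \<in> carrier Q"
  then show "c \<odot>\<^bsub>Q\<^esub> (X \<oplus>\<^bsub>Q\<^esub> Y) = c \<odot>\<^bsub>Q\<^esub> X \<oplus>\<^bsub>Q\<^esub> c \<odot>\<^bsub>Q\<^esub> Y"
    using M.smult_r_distr[of c] by (auto simp: carrier_quot smult_quot add_quot M.smult_closed)
next
  fix X :: "'m set" and c d :: 'k assume "X \<in> carrier Q"
  then show "(c * d) \<odot>\<^bsub>Q\<^esub> X = c \<odot>\<^bsub>Q\<^esub> (d \<odot>\<^bsub>Q\<^esub> X)"
    using M.smult_assoc1[of c d] by (auto simp: carrier_quot smult_quot M.smult_closed)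
next
  fix X :: "'m set" assume "X \<in> carrier Q"
  then show "1 \<odot>\<^bsub>Q\<^esub> X = X"
    using M.smult_one by (auto simp: carrier_quot smult_quot)
qed

lemma proj_lin_hom: "lin_hom M Q (\<lambda>x. proj x)"
  by (rule lin_homI) (auto simp: carrier_quot add_quot smult_quot)

lemma rep_coset:
  assumes "x \<in> carrier M"
  obtains h where "h \<in> N" "rep (proj x) = h \<oplus>\<^bsub>M\<^esub> x"
proof -
  have "rep (proj x) \<in> proj x"
    unfolding rep_def by (rule someI) (rule N.a_rcos_self[OF assms])
  then show thesis using that proj_mem by blast
qed

lemma rep_carrier: 
  assumes "X \<in> carrier Q" shows "rep X \<in> carrier M"
proof -
  obtain x where x: "x \<in> carrier M" "X = proj x" using assms carrier_quot by blast
  then obtain h where "h \<in> N" "rep X = h \<oplus>\<^bsub>M\<^esub> x" using rep_coset by blast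
  then show ?thesis using x submoduleD(1)[OF module submodule] by auto
qed

context
  fixes P :: "('k, 'p, 'z) module_scheme" and f :: "'m \<Rightarrow> 'p"
  assumes P: "module base P" and f: "lin_hom M P f" and null: "\<And>x. x \<in> N \<Longrightarrow> f x = \<zero>\<^bsub>P\<^esub>"
begin

interpretation P: module base P by (rule P)

lemma lift_proj: "x \<in> carrier M \<Longrightarrow> f (rep (proj x)) = f x"
proof -
  assume x: "x \<in> carrier M"
  then obtain h where h: "h \<in> N" "rep (proj x) = h \<oplus>\<^bsub>M\<^esub> x"
    using rep_coset by blast
  then show ?thesis
    using x submoduleD(1)[OF module submodule] lin_hom_closed[OF f]
    by (auto simp: lin_hom_add[OF f] null subset_iff)
qed

lemma lift_lin_hom: "lin_hom Q P (\<lambda>X. f (rep X))"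
  by (rule lin_homI)
    (auto simp: carrier_quot add_quot smult_quot lift_proj M.smult_closed
      lin_hom_closed[OF f] lin_hom_add[OF f] lin_hom_smult[OF f])

end

end


section \<open>Tensor products\<close>

lemma keys_diff_subset: "Poly_Mapping.keys (p - q) \<subseteq> Poly_Mapping.keys p \<union> Poly_Mapping.keys q"
  for p q :: "'i \<Rightarrow>\<^sub>0 'k::field"
  by (auto simp: in_keys_iff lookup_minus)

lemma is_free_free_space: "is_free (carrier M \<times> carrier N) (free_space M N)"
  by (simp add: is_free_def free_space_def)

lemma tensor_rels_carrier:
  assumes "module base M" and "module base N"
  shows "tensor_rels M N \<subseteq> carrier (free_space M N)"
proof -
  interpret M: module base M by fact
  interpret N: module base N by fact
  let ?S = "carrier M \<times> carrier N"
  have diff: "Poly_Mapping.keys (p - q) \<subseteq> ?S"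
    if "Poly_Mapping.keys p \<subseteq> ?S" "Poly_Mapping.keys q \<subseteq> ?S" for p q :: "'b \<times> 'd \<Rightarrow>\<^sub>0 'a"
    using that keys_diff_subset[of p q] by blast
  show ?thesis
  proof
    fix r assume "r \<in> tensor_rels M N"
    then have "Poly_Mapping.keys r \<subseteq> ?S"
      unfolding tensor_rels_def
      by (elim UnE CollectE exE conjE; hypsubst; intro diff; simp add: M.smult_closed N.smult_closed)
    then show "r \<in> carrier (free_space M N)"
      by (simp add: is_free_simps[OF is_free_free_space])
  qed
qed

lemma vs_quotient_tensor:
  assumes "module base M" and "module base N"
  shows "vs_quotient (free_space M N) (tensor_null M N)"
  unfolding tensor_null_def
  by (intro vs_quotient.intro gen_submodule is_free_module[OF is_free_free_space]
      tensor_rels_carrier assms)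

lemma tensor_module:
  assumes "module base M" and "module base N"
  shows "module base (tensor M N)"
  unfolding tensor_def by (rule vs_quotient.quot_module[OF vs_quotient_tensor[OF assms]])

lemma tens_bilin:
  assumes M: "module base M" and N: "module base N"
  shows "bilin M N (tensor M N) (tens M N)"
proof -
  interpret M: module base M by fact
  interpret N: module base N by fact
  interpret Q: vs_quotient "free_space M N" "tensor_null M N"
    by (rule vs_quotient_tensor[OF assms])
  note simps = is_free_simps[OF is_free_free_space]
  have rels: "tensor_rels M N \<subseteq> tensor_null M N"
    unfolding tensor_null_def
    by (intro gen_submodule is_free_module[OF is_free_free_space] tensor_rels_carrier assms)
  \<comment> \<open>Two representatives that differ by a relation have the same class.\<close>
  have eqI: "Q.proj p = Q.proj q"
    if "p - q \<in> tensor_rels M N" and q: "Poly_Mapping.keys q \<subseteq> carrier M \<times> carrier N" for p q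
    using Q.proj_add_null[of "p - q" q] that rels by (auto simp: simps)
  have closed: "tens M N x y \<in> carrier (tensor M N)" if "x \<in> carrier M" "y \<in> carrier N" for x y
    using that lin_hom_closed[OF Q.proj_lin_hom] by (simp add: tens_def tensor_def simps)
  have add: "tens M N x y \<oplus>\<^bsub>tensor M N\<^esub> tens M N x' y' = Q.proj (gen x y + gen x' y')"
    if "x \<in> carrier M" "y \<in> carrier N" "x' \<in> carrier M" "y' \<in> carrier N" for x y x' y'
    using that Q.add_quot[of "gen x y" "gen x' y'"] by (simp add: tens_def tensor_def simps)
  have smult: "c \<odot>\<^bsub>tensor M N\<^esub> tens M N x y = Q.proj (Poly_Mapping.single (x, y) c)"
    if "x \<in> carrier M" "y \<in> carrier N" for x y c
    using that Q.smult_quot[of "gen x y" c] 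
    by (simp add: tens_def tensor_def simps map_single)
  have sumc: "Poly_Mapping.keys (gen x y + gen x' y' :: 'b \<times> 'd \<Rightarrow>\<^sub>0 'a) \<subseteq> carrier M \<times> carrier N"
    if "x \<in> carrier M" "y \<in> carrier N" "x' \<in> carrier M" "y' \<in> carrier N" for x y x' y'
    using that Poly_Mapping.keys_add[of "gen x y" "gen x' y' :: 'b \<times> 'd \<Rightarrow>\<^sub>0 'a"] by auto
  show ?thesis
  proof (rule bilinI; rule lin_homI)
    fix x y z assume *: "x \<in> carrier M" "y \<in> carrier N" "z \<in> carrier N"
    have "gen x (y \<oplus>\<^bsub>N\<^esub> z) - (gen x y + gen x z) \<in> tensor_rels M N"
      unfolding tensor_rels_def diff_diff_eq[symmetric] using * by blast
    then show "tens M N x (y \<oplus>\<^bsub>N\<^esub> z) = tens M N x y \<oplus>\<^bsub>tensor M N\<^esub> tens M N x z"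
      using eqI sumc * by (simp add: add) (simp add: tens_def)
  next
    fix x y z assume *: "x \<in> carrier M" "y \<in> carrier M" "z \<in> carrier N"
    have "gen (x \<oplus>\<^bsub>M\<^esub> y) z - (gen x z + gen y z) \<in> tensor_rels M N"
      unfolding tensor_rels_def diff_diff_eq[symmetric] using * by blast
    then show "tens M N (x \<oplus>\<^bsub>M\<^esub> y) z = tens M N x z \<oplus>\<^bsub>tensor M N\<^esub> tens M N y z"
      using eqI sumc * by (simp add: add) (simp add: tens_def)
  next
    fix x y c assume *: "x \<in> carrier M" "y \<in> carrier N"
    have "gen x (c \<odot>\<^bsub>N\<^esub> y) - Poly_Mapping.single (x, y) c \<in> tensor_rels M N"
      unfolding tensor_rels_def using * by blast
    then show "tens M N x (c \<odot>\<^bsub>N\<^esub> y) = c \<odot>\<^bsub>tensor M N\<^esub> tens M N x y"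
      using eqI * by (simp add: smult) (simp add: tens_def)
    have "gen (c \<odot>\<^bsub>M\<^esub> x) y - Poly_Mapping.single (x, y) c \<in> tensor_rels M N"
      unfolding tensor_rels_def using * by blast
    then show "tens M N (c \<odot>\<^bsub>M\<^esub> x) y = c \<odot>\<^bsub>tensor M N\<^esub> tens M N x y"
      using eqI * by (simp add: smult) (simp add: tens_def)
  qed (auto intro: closed)
qed

lemma tens_closed:
  assumes "module base M" and "module base N" and "x \<in> carrier M" and "y \<in> carrier N"
  shows "tens M N x y \<in> carrier (tensor M N)"
  using bilin_closed[OF tens_bilin[OF assms(1,2)] assms(3,4)] .

lemma tensor_induct [consumes 3, case_names tens add]:
  assumes M: "module base M" and N: "module base N"
    and t: "t \<in> carrier (tensor M N)"
    and tens: "\<And>x y. x \<in> carrier M \<Longrightarrow> y \<in> carrier N \<Longrightarrow> P (tens M N x y)"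
    and add: "\<And>s t. s \<in> carrier (tensor M N) \<Longrightarrow> t \<in> carrier (tensor M N) \<Longrightarrow> P s \<Longrightarrow> P t \<Longrightarrow>
      P (s \<oplus>\<^bsub>tensor M N\<^esub> t)"
  shows "P t"
proof -
  interpret M: module base M by fact
  interpret N: module base N by fact
  interpret Q: vs_quotient "free_space M N" "tensor_null M N"
    by (rule vs_quotient_tensor[OF M N])
  note simps = is_free_simps[OF is_free_free_space]
  have single: "Q.proj (Poly_Mapping.single (x, y) c) = tens M N (c \<odot>\<^bsub>M\<^esub> x) y"
    if "x \<in> carrier M" "y \<in> carrier N" for x y c
    using that Q.smult_quot[of "gen x y" c] lin_hom_smult[OF bilinD(2)[OF tens_bilin[OF M N], of y], of x c]
    by (simp add: tens_def tensor_def simps map_single)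
  have "P (Q.proj p)" if "Poly_Mapping.keys p \<subseteq> carrier M \<times> carrier N" for p
    using that
  proof (induction p rule: free_induct)
    case zero
    show ?case
      using single[OF M.zero_closed N.zero_closed, of 0] tens[of "0 \<odot>\<^bsub>M\<^esub> \<zero>\<^bsub>M\<^esub>" "\<zero>\<^bsub>N\<^esub>"]
        M.smult_closed[of 0 "\<zero>\<^bsub>M\<^esub>"]
      by (simp only: single_zero base_simps UNIV_I M.zero_closed N.zero_closed simp_thms)
  next
    case (add p v c)
    obtain x y where v: "v = (x, y)" "x \<in> carrier M" "y \<in> carrier N" using add.hyps by auto
    have p: "p \<in> carrier (free_space M N)" "Poly_Mapping.single v c \<in> carrier (free_space M N)"
      using add.hyps by (auto simp: simps)
    have "Q.proj (p + Poly_Mapping.single v c) = Q.proj p \<oplus>\<^bsub>tensor M N\<^esub> tens M N (c \<odot>\<^bsub>M\<^esub> x) y"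
      using Q.add_quot[OF p] v by (simp add: single simps tensor_def)
    moreover have "Q.proj p \<in> carrier (tensor M N)"
      using lin_hom_closed[OF Q.proj_lin_hom p(1)] by (simp add: tensor_def)
    ultimately show ?case
      using v add.IH assms(5)[OF _ tens_closed[OF M N] _ tens] M.smult_closed[of c x] by simp
  qed
  moreover obtain p where "Poly_Mapping.keys p \<subseteq> carrier M \<times> carrier N" "t = Q.proj p"
    using t unfolding tensor_def Q.carrier_quot by (auto simp: simps)
  ultimately show ?thesis by blast
qed

lemma tensor_lin_eqI:
  assumes "module base M" and "module base N" and "lin_hom (tensor M N) Q f"
    and "lin_hom (tensor M N) Q g"
    and "\<And>x y. x \<in> carrier M \<Longrightarrow> y \<in> carrier N \<Longrightarrow> f (tens M N x y) = g (tens M N x y)"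
    and "t \<in> carrier (tensor M N)"
  shows "f t = g t"
  using assms(1,2,6)
  by (induction rule: tensor_induct)
    (simp_all add: assms(5) lin_hom_add[OF assms(3)] lin_hom_add[OF assms(4)])

context
  fixes M :: "('k::field, 'm, 'x) module_scheme" and N :: "('k, 'n, 'y) module_scheme"
    and Q :: "('k, 'q, 'z) module_scheme"
  assumes M: "module base M" and N: "module base N" and Q: "module base Q"
begin

interpretation M: module base M by (rule M)
interpretation N: module base N by (rule N)
interpretation Q: module base Q by (rule Q)
interpretation T: vs_quotient "free_space M N" "tensor_null M N"
  by (rule vs_quotient_tensor[OF M N])

text \<open>
  If a family of maps depends linearly on a parameter, then so does the value of the induced map at
  a fixed tensor. Bilinearity of the maps in the family is not needed, because the representative
  of the tensor is the same throughout. This yields the linearity in the remaining arguments of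
  operations defined by nested uses of \<^const>\<open>tlift\<close>.
\<close>

lemma tlift_fun_lin:
  assumes "\<And>x y. x \<in> carrier M \<Longrightarrow> y \<in> carrier N \<Longrightarrow> lin_hom P Q (\<lambda>z. b z x y)"
    and "module base P" and "t \<in> carrier (tensor M N)"
  shows "lin_hom P Q (\<lambda>z. tlift M N Q (b z) t)"
proof -
  have "Poly_Mapping.keys (rep t) \<subseteq> carrier M \<times> carrier N"
    using T.rep_carrier[of t] assms(3) is_free_simps(1)[OF is_free_free_space, of "rep t" M N]
    by (simp add: tensor_def)
  then show ?thesis
    unfolding tlift_def
    by (intro lin_hom_finsum_fun lin_hom_smult_fun assms Q) auto
qed

context
  fixes b
  assumes b: "bilin M N Q b"
begin

text \<open>The linear extension of a bilinear map kills the defining relations of the tensor product.\<close>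

lemma lin_ext_null:
  assumes "p \<in> tensor_null M N"
  shows "lin_ext Q (\<lambda>v. b (fst v) (snd v)) p = \<zero>\<^bsub>Q\<^esub>" (is "?F p = _")
proof -
  let ?FS = "free_space M N"
  note free = is_free_free_space[of M N]
  note simps = is_free_simps[OF free]
  have lin: "lin_hom ?FS Q ?F"
    by (rule lin_ext_lin_hom[OF Q free]) (auto intro: bilin_closed[OF b])
  let ?K = "{p \<in> carrier ?FS. ?F p = \<zero>\<^bsub>Q\<^esub>}"
  have diff: "?F (p - q) = \<zero>\<^bsub>Q\<^esub>"
    if "p - q \<in> carrier ?FS" "q \<in> carrier ?FS" "?F p = ?F q" for p q
  proof -
    have "?F (p - q) \<oplus>\<^bsub>Q\<^esub> ?F q = ?F q"
      using lin_hom_add[OF lin, of "p - q" q] that by (simp add: simps)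
    then show ?thesis
      using lin_hom_closed[OF lin] that by (simp add: Q.add.r_cancel_one)
  qed
  have single: "?F (Poly_Mapping.single (x, y) c) = c \<odot>\<^bsub>Q\<^esub> b x y"
    if "x \<in> carrier M" "y \<in> carrier N" for x y c
    using lin_ext_single[OF Q, of "\<lambda>v. b (fst v) (snd v)" "(x, y)"] bilin_closed[OF b] that by simp
  have gen: "?F (gen x y) = b x y" if "x \<in> carrier M" "y \<in> carrier N" for x y
    using single[OF that] bilin_closed[OF b that] Q.smult_one by simp
  have single_carrier: "Poly_Mapping.single (x, y) c \<in> carrier ?FS" if "x \<in> carrier M" "y \<in> carrier N" for x y c
    using that by (simp add: simps)
  have add: "?F (gen x y + gen x' y') = b x y \<oplus>\<^bsub>Q\<^esub> b x' y'" "gen x y + gen x' y' \<in> carrier ?FS"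
    if "x \<in> carrier M" "y \<in> carrier N" "x' \<in> carrier M" "y' \<in> carrier N" for x y x' y'
    using lin_hom_add[OF lin, of "gen x y" "gen x' y'"] single_carrier that
      Poly_Mapping.keys_add[of "gen x y" "gen x' y' :: 'm \<times> 'n \<Rightarrow>\<^sub>0 'k"]
    by (auto simp: simps gen)
  have "tensor_rels M N \<subseteq> ?K"
  proof
    fix r assume r: "r \<in> tensor_rels M N"
    then have rc: "r \<in> carrier ?FS" using tensor_rels_carrier[OF M N] by blast
    moreover have "?F r = \<zero>\<^bsub>Q\<^esub>"
      using r unfolding tensor_rels_def
    proof (elim UnE CollectE exE conjE)
      fix x y z assume *: "r = gen (x \<oplus>\<^bsub>M\<^esub> y) z - gen x z - gen y z"
        "x \<in> carrier M" "y \<in> carrier M" "z \<in> carrier N"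
      then have eq: "r = gen (x \<oplus>\<^bsub>M\<^esub> y) z - (gen x z + gen y z)" by (simp add: diff_diff_eq)
      show ?thesis
        unfolding eq using *(2-4) rc[unfolded eq] diff[of "gen (x \<oplus>\<^bsub>M\<^esub> y) z" "gen x z + gen y z"] lin_hom_add[OF bilinD(2)[OF b]]
        by (simp add: add gen)
    next
      fix x y z assume *: "r = gen x (y \<oplus>\<^bsub>N\<^esub> z) - gen x y - gen x z"
        "x \<in> carrier M" "y \<in> carrier N" "z \<in> carrier N"
      then have eq: "r = gen x (y \<oplus>\<^bsub>N\<^esub> z) - (gen x y + gen x z)" by (simp add: diff_diff_eq)
      show ?thesis
        unfolding eq using *(2-4) rc[unfolded eq] diff[of "gen x (y \<oplus>\<^bsub>N\<^esub> z)" "gen x y + gen x z"] lin_hom_add[OF bilinD(1)[OF b]]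
        by (simp add: add gen)
    next
      fix c x y assume *: "r = gen (c \<odot>\<^bsub>M\<^esub> x) y - Poly_Mapping.single (x, y) c"
        "x \<in> carrier M" "y \<in> carrier N"
      show ?thesis
        unfolding *(1)
        by (rule diff) (use * rc lin_hom_smult[OF bilinD(2)[OF b]] in
            \<open>simp_all add: single gen single_carrier M.smult_closed Q.smult_closed
              Q.smult_one[unfolded base_simps] bilin_closed[OF b]\<close>)
    next
      fix c x y assume *: "r = gen x (c \<odot>\<^bsub>N\<^esub> y) - Poly_Mapping.single (x, y) c"
        "x \<in> carrier M" "y \<in> carrier N"
      show ?thesis
        unfolding *(1)
        by (rule diff) (use * rc lin_hom_smult[OF bilinD(1)[OF b]] in
            \<open>simp_all add: single gen single_carrier N.smult_closed Q.smult_closed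
              Q.smult_one[unfolded base_simps] bilin_closed[OF b]\<close>)
    qed
    ultimately show "r \<in> ?K" by simp
  qed
  then have "tensor_null M N \<subseteq> ?K"
    unfolding tensor_null_def
    by (intro gen_submodule(3) lin_hom_kernel lin Q is_free_module[OF free] tensor_rels_carrier M N)
  then show ?thesis using assms by blast
qed

lemma tlift_lin_hom: "lin_hom (tensor M N) Q (tlift M N Q b)"
  and tlift_tens: "x \<in> carrier M \<Longrightarrow> y \<in> carrier N \<Longrightarrow> tlift M N Q b (tens M N x y) = b x y"
proof -
  let ?F = "lin_ext Q (\<lambda>v. b (fst v) (snd v))"
  note free = is_free_free_space[of M N]
  have lin: "lin_hom (free_space M N) Q ?F"
    by (rule lin_ext_lin_hom[OF Q free]) (auto intro: bilin_closed[OF b])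
  have eq: "tlift M N Q b = (\<lambda>X. ?F (rep X))"
    by (simp add: fun_eq_iff tlift_def lin_ext_def)
  show "lin_hom (tensor M N) Q (tlift M N Q b)"
    unfolding eq tensor_def by (rule T.lift_lin_hom[OF Q lin lin_ext_null])
  assume xy: "x \<in> carrier M" "y \<in> carrier N"
  have "?F (rep (T.proj (gen x y))) = ?F (gen x y)"
    by (rule T.lift_proj[OF Q lin lin_ext_null]) (use xy in \<open>auto simp: is_free_simps[OF free]\<close>)
  also have "\<dots> = b x y"
    using lin_ext_single[OF Q, of "\<lambda>v. b (fst v) (snd v)" "(x, y)" 1] bilin_closed[OF b xy]
      Q.smult_one by simp
  finally show "tlift M N Q b (tens M N x y) = b x y"
    by (simp add: eq tens_def)
qed

end

end

lemma tmap_bilin: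
  assumes "module base M'" "module base N'" "lin_hom M M' f" "lin_hom N N' g"
  shows "bilin M N (tensor M' N') (\<lambda>x y. tens M' N' (f x) (g y))"
  by (rule bilin_pre[OF tens_bilin[OF assms(1,2)] assms(3,4)])

lemma tmap_lin_hom:
  assumes "module base M" "module base N" "module base M'" "module base N'"
    and "lin_hom M M' f" "lin_hom N N' g"
  shows "lin_hom (tensor M N) (tensor M' N') (tmap M N M' N' f g)"
  unfolding tmap_def by (intro tlift_lin_hom tensor_module tmap_bilin assms)

lemma tmap_tens:
  assumes "module base M" "module base N" "module base M'" "module base N'"
    and "lin_hom M M' f" "lin_hom N N' g" and "x \<in> carrier M" "y \<in> carrier N"
  shows "tmap M N M' N' f g (tens M N x y) = tens M' N' (f x) (g y)"
  unfolding tmap_def by (intro tlift_tens tensor_module tmap_bilin assms)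


section \<open>Algebras and their tensor products\<close>

text \<open>
  Structures with the same underlying vector space, such as \<open>A \<otimes> B\<close> as a vector space and as an
  algebra
\<close>

definition same_space ::
  "('k::field, 'm, 'x) module_scheme \<Rightarrow> ('k, 'm, 'y) module_scheme \<Rightarrow> bool" where
  "same_space M M' \<longleftrightarrow> carrier M = carrier M' \<and> add M = add M' \<and> zero M = zero M' \<and> smult M = smult M'"

lemma same_space_module:
  assumes "same_space M M'" and "module base M"
  shows "module base M'"
proof -
  interpret M: module base M by fact
  have simps: "carrier M' = carrier M" "add M' = add M" "zero M' = zero M" "smult M' = smult M"
    using assms(1) by (simp_all add: same_space_def)
  show ?thesis
  proof (rule vector_spaceI)
    show "abelian_group M'"
    proof (rule abelian_groupI)
      fix x assume "x \<in> carrier M'"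
      then show "\<exists>y\<in>carrier M'. y \<oplus>\<^bsub>M'\<^esub> x = \<zero>\<^bsub>M'\<^esub>"
        using M.l_neg[of x] by (auto simp: simps)
    qed (auto simp: simps M.a_ac)
  qed (use M.smult_l_distr M.smult_r_distr M.smult_assoc1 M.smult_one M.smult_closed in \<open>simp_all add: simps\<close>)
qed

lemma same_space_finsum: "same_space M M' \<Longrightarrow> finsum M' = finsum M"
  by (intro ext) (simp add: finsum_def finprod_def same_space_def)

lemma same_space_lin_hom:
  "same_space M M' \<Longrightarrow> same_space N N' \<Longrightarrow> lin_hom M' N' f \<longleftrightarrow> lin_hom M N f"
  by (simp add: lin_hom_def same_space_def)

lemma
  assumes "algebra base A"
  shows algebra_module: "module base A" and algebra_cring: "cring A"
proof -
  interpret algebra base A by fact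
  show "module base A" "cring A" by unfold_locales
qed

lemma mult_bilin:
  assumes "algebra base A"
  shows "bilin A A A (mult A)"
proof -
  interpret A: algebra base A by fact
  have l: "lin_hom A A (\<lambda>x. x \<otimes>\<^bsub>A\<^esub> y)" if "y \<in> carrier A" for y
    using that A.smult_assoc2 by (intro lin_homI) (auto simp: A.l_distr)
  have "lin_hom A A (\<lambda>x. y \<otimes>\<^bsub>A\<^esub> x)" if "y \<in> carrier A" for y
    using l[OF that] lin_hom_cong[OF algebra_module[OF assms], of "\<lambda>x. x \<otimes>\<^bsub>A\<^esub> y" "\<lambda>x. y \<otimes>\<^bsub>A\<^esub> x"]
      A.m_comm that by blast
  with l show ?thesis by (intro bilinI)
qed

lemma alg_homD:
  assumes "alg_hom A B f"
  shows "lin_hom A B f" "f \<in> ring_hom A B"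
  using assms by (simp_all add: alg_hom_def)

lemma alg_homI:
  assumes "lin_hom A B f" and "\<And>x y. x \<in> carrier A \<Longrightarrow> y \<in> carrier A \<Longrightarrow> f (x \<otimes>\<^bsub>A\<^esub> y) = f x \<otimes>\<^bsub>B\<^esub> f y"
    and "f \<one>\<^bsub>A\<^esub> = \<one>\<^bsub>B\<^esub>"
  shows "alg_hom A B f"
  using assms by (auto simp: alg_hom_def ring_hom_def lin_hom_def)

lemma alg_hom_comp: "alg_hom A B f \<Longrightarrow> alg_hom B C g \<Longrightarrow> alg_hom A C (\<lambda>x. g (f x))"
  by (auto simp: alg_hom_def intro: lin_hom_comp) (auto simp: ring_hom_def Pi_def)

lemma same_space_tensor_alg: "same_space (tensor A B) (tensor_alg A B)"
  by (simp add: same_space_def tensor_alg_def)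

context
  fixes A :: "('k::field, 'a, 'x) module_scheme" and B :: "('k, 'b, 'y) module_scheme"
  assumes A: "algebra base A" and B: "algebra base B"
begin

interpretation A: algebra base A by (rule A)
interpretation B: algebra base B by (rule B)

private lemma MA: "module base A" and MB: "module base B"
  using algebra_module A B by auto

private lemma MT: "module base (tensor A B)"
  by (rule tensor_module[OF MA MB])

private lemma bilin_inner:
  assumes "a \<in> carrier A" "b \<in> carrier B"
  shows "bilin A B (tensor A B) (\<lambda>a' b'. tens A B (a \<otimes>\<^bsub>A\<^esub> a') (b \<otimes>\<^bsub>B\<^esub> b'))"
  by (intro bilin_pre[OF tens_bilin[OF MA MB]] bilinD(1)[OF mult_bilin] A B assms)

private lemma bilin_outer:
  assumes "t \<in> carrier (tensor A B)"
  shows "bilin A B (tensor A B)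
    (\<lambda>a b. tlift A B (tensor A B) (\<lambda>a' b'. tens A B (a \<otimes>\<^bsub>A\<^esub> a') (b \<otimes>\<^bsub>B\<^esub> b')) t)"
proof -
  have "bilin A B (tensor A B) (\<lambda>a b. tens A B (a \<otimes>\<^bsub>A\<^esub> a') (b \<otimes>\<^bsub>B\<^esub> b'))"
    if "a' \<in> carrier A" "b' \<in> carrier B" for a' b'
    by (intro bilin_pre[OF tens_bilin[OF MA MB]] bilinD(2)[OF mult_bilin] A B that)
  then show ?thesis
    by (intro bilinI tlift_fun_lin MA MB MT assms) (auto dest: bilinD)
qed

lemma tensor_alg_mult_bilin: "bilin (tensor A B) (tensor A B) (tensor A B) (mult (tensor_alg A B))"
  and tensor_alg_mult_tens: "a \<in> carrier A \<Longrightarrow> b \<in> carrier B \<Longrightarrow> a' \<in> carrier A \<Longrightarrow> b' \<in> carrier B \<Longrightarrow>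
    tens A B a b \<otimes>\<^bsub>tensor_alg A B\<^esub> tens A B a' b' = tens A B (a \<otimes>\<^bsub>A\<^esub> a') (b \<otimes>\<^bsub>B\<^esub> b')"
proof -
  let ?G = "\<lambda>t a b. tlift A B (tensor A B) (\<lambda>a' b'. tens A B (a \<otimes>\<^bsub>A\<^esub> a') (b \<otimes>\<^bsub>B\<^esub> b')) t"
  have eq: "mult (tensor_alg A B) = (\<lambda>s t. tlift A B (tensor A B) (?G t) s)"
    by (simp add: tensor_alg_def)
  show "bilin (tensor A B) (tensor A B) (tensor A B) (mult (tensor_alg A B))"
    unfolding eq
  proof (rule bilinI)
    fix s assume s: "s \<in> carrier (tensor A B)"
    show "lin_hom (tensor A B) (tensor A B) (\<lambda>t. tlift A B (tensor A B) (?G t) s)"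
      by (rule tlift_fun_lin[OF MA MB MT _ MT s]) (rule tlift_lin_hom[OF MA MB MT bilin_inner])
  next
    fix t assume t: "t \<in> carrier (tensor A B)"
    show "lin_hom (tensor A B) (tensor A B) (tlift A B (tensor A B) (?G t))"
      by (rule tlift_lin_hom[OF MA MB MT bilin_outer[OF t]])
  qed
  assume ab: "a \<in> carrier A" "b \<in> carrier B" and ab': "a' \<in> carrier A" "b' \<in> carrier B"
  show "tens A B a b \<otimes>\<^bsub>tensor_alg A B\<^esub> tens A B a' b' = tens A B (a \<otimes>\<^bsub>A\<^esub> a') (b \<otimes>\<^bsub>B\<^esub> b')"
    unfolding eq tlift_tens[OF MA MB MT bilin_outer[OF tens_closed[OF MA MB ab']] ab]
    by (rule tlift_tens[OF MA MB MT bilin_inner[OF ab] ab'])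
qed

text \<open>
  The algebra axioms are identities between multilinear maps, so they are checked on pure tensors,
  one argument after the other.
\<close>

lemma tensor_alg_algebra: "algebra base (tensor_alg A B)"
proof -
  let ?T = "tensor_alg A B"
  note bil = tensor_alg_mult_bilin
  note mt = tensor_alg_mult_tens
  note tc = tens_closed[OF MA MB]
  note eqI = tensor_lin_eqI[OF MA MB]
  have MT': "module base ?T"
    by (rule same_space_module[OF same_space_tensor_alg MT])
  interpret T: module base ?T by fact
  have car: "carrier ?T = carrier (tensor A B)" and add: "add ?T = add (tensor A B)"
    and smult: "smult ?T = smult (tensor A B)"
    using same_space_tensor_alg[of A B] by (simp_all add: same_space_def)
  have one: "\<one>\<^bsub>?T\<^esub> = tens A B \<one>\<^bsub>A\<^esub> \<one>\<^bsub>B\<^esub>"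
    by (simp add: tensor_alg_def)
  have closed: "s \<otimes>\<^bsub>?T\<^esub> t \<in> carrier (tensor A B)"
    if "s \<in> carrier (tensor A B)" "t \<in> carrier (tensor A B)" for s t
    by (rule bilin_closed[OF bil that])
  have comm1: "s \<otimes>\<^bsub>?T\<^esub> tens A B a b = tens A B a b \<otimes>\<^bsub>?T\<^esub> s"
    if "s \<in> carrier (tensor A B)" "a \<in> carrier A" "b \<in> carrier B" for s a b
    by (rule eqI[OF bilinD(2)[OF bil] bilinD(1)[OF bil]])
      (use that in \<open>auto intro: tc simp: mt A.m_comm B.m_comm\<close>)
  have comm: "s \<otimes>\<^bsub>?T\<^esub> t = t \<otimes>\<^bsub>?T\<^esub> s"
    if "s \<in> carrier (tensor A B)" "t \<in> carrier (tensor A B)" for s t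
    by (rule eqI[OF bilinD(1)[OF bil] bilinD(2)[OF bil]]) (use that comm1 in blast)+
  have assoc1: "(s \<otimes>\<^bsub>?T\<^esub> tens A B a b) \<otimes>\<^bsub>?T\<^esub> tens A B c d = s \<otimes>\<^bsub>?T\<^esub> (tens A B a b \<otimes>\<^bsub>?T\<^esub> tens A B c d)"
    if "s \<in> carrier (tensor A B)" "a \<in> carrier A" "b \<in> carrier B" "c \<in> carrier A" "d \<in> carrier B"
    for s a b c d
    by (rule eqI[OF lin_hom_comp[OF bilinD(2)[OF bil] bilinD(2)[OF bil]] bilinD(2)[OF bil]])
      (use that in \<open>auto intro: tc simp: mt A.m_assoc B.m_assoc\<close>)
  have assoc2: "(s \<otimes>\<^bsub>?T\<^esub> t) \<otimes>\<^bsub>?T\<^esub> tens A B c d = s \<otimes>\<^bsub>?T\<^esub> (t \<otimes>\<^bsub>?T\<^esub> tens A B c d)"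
    if "s \<in> carrier (tensor A B)" "t \<in> carrier (tensor A B)" "c \<in> carrier A" "d \<in> carrier B"
    for s t c d
    by (rule eqI[OF lin_hom_comp[OF bilinD(1)[OF bil] bilinD(2)[OF bil]] lin_hom_comp[OF bilinD(2)[OF bil] bilinD(1)[OF bil]]])
      (use that in \<open>auto intro: tc simp: assoc1\<close>)
  have assoc: "(s \<otimes>\<^bsub>?T\<^esub> t) \<otimes>\<^bsub>?T\<^esub> u = s \<otimes>\<^bsub>?T\<^esub> (t \<otimes>\<^bsub>?T\<^esub> u)"
    if "s \<in> carrier (tensor A B)" "t \<in> carrier (tensor A B)" "u \<in> carrier (tensor A B)" for s t u
    by (rule eqI[OF bilinD(1)[OF bil] lin_hom_comp[OF bilinD(1)[OF bil] bilinD(1)[OF bil]]])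
      (use that in \<open>auto intro: tc closed simp: assoc2\<close>)
  have unit: "\<one>\<^bsub>?T\<^esub> \<otimes>\<^bsub>?T\<^esub> s = s" if "s \<in> carrier (tensor A B)" for s
    unfolding one
    by (rule eqI[OF bilinD(1)[OF bil] lin_hom_id]) (use that in \<open>auto intro: tc simp: mt\<close>)
  have "\<one>\<^bsub>?T\<^esub> \<in> carrier (tensor A B)"
    unfolding one by (rule tc) simp_all
  then have "comm_monoid ?T"
  proof (intro comm_monoidI)
    fix s t assume "s \<in> carrier ?T" "t \<in> carrier ?T"
    then show "s \<otimes>\<^bsub>?T\<^esub> t = t \<otimes>\<^bsub>?T\<^esub> s" unfolding car by (rule comm)
  qed (simp_all add: car closed assoc unit)
  then have "cring ?T"
    by (intro cringI T.abelian_group_axioms) (auto simp: car add lin_hom_add[OF bilinD(2)[OF bil]])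
  then show ?thesis
    by (intro algebra_baseI MT') (auto simp: car smult lin_hom_smult[OF bilinD(2)[OF bil]])
qed

end

lemma tmap_alg_hom:
  assumes A: "algebra base A" and B: "algebra base B" and A': "algebra base A'" and B': "algebra base B'"
    and f: "alg_hom A A' f" and g: "alg_hom B B' g"
  shows "alg_hom (tensor_alg A B) (tensor_alg A' B') (tmap A B A' B' f g)"
proof -
  interpret A: algebra base A by fact
  interpret B: algebra base B by fact
  note M = algebra_module[OF A] algebra_module[OF B]
  note M' = algebra_module[OF A'] algebra_module[OF B']
  note lf = alg_homD(1)[OF f] and lg = alg_homD(1)[OF g]
  let ?h = "tmap A B A' B' f g"
  have lin: "lin_hom (tensor A B) (tensor A' B') ?h"
    by (rule tmap_lin_hom[OF M M' lf lg])
  note tens = tmap_tens[OF M M' lf lg]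
  note bil = tensor_alg_mult_bilin[OF A B] and bil' = tensor_alg_mult_bilin[OF A' B']
  have car: "carrier (tensor_alg A B) = carrier (tensor A B)"
    using same_space_tensor_alg[of A B] by (simp add: same_space_def)
  have mult1: "?h (s \<otimes>\<^bsub>tensor_alg A B\<^esub> tens A B a b) = ?h s \<otimes>\<^bsub>tensor_alg A' B'\<^esub> ?h (tens A B a b)"
    if "s \<in> carrier (tensor A B)" "a \<in> carrier A" "b \<in> carrier B" for s a b
    by (rule tensor_lin_eqI[OF M lin_hom_comp[OF bilinD(2)[OF bil] lin] lin_hom_comp[OF lin bilinD(2)[OF bil']]])
      (use that lin_hom_closed[OF lin] tens_closed[OF M] tens_closed[OF M'] lin_hom_closed[OF lf] lin_hom_closed[OF lg]
       in \<open>auto simp: tens tensor_alg_mult_tens[OF A B] tensor_alg_mult_tens[OF A' B']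
           ring_hom_mult[OF alg_homD(2)[OF f]] ring_hom_mult[OF alg_homD(2)[OF g]]\<close>)
  have mult: "?h (s \<otimes>\<^bsub>tensor_alg A B\<^esub> t) = ?h s \<otimes>\<^bsub>tensor_alg A' B'\<^esub> ?h t"
    if "s \<in> carrier (tensor A B)" "t \<in> carrier (tensor A B)" for s t
    by (rule tensor_lin_eqI[OF M lin_hom_comp[OF bilinD(1)[OF bil] lin] lin_hom_comp[OF lin bilinD(1)[OF bil']]])
      (use that mult1 lin_hom_closed[OF lin] in auto)
  show ?thesis
  proof (rule alg_homI)
    show "lin_hom (tensor_alg A B) (tensor_alg A' B') ?h"
      using lin same_space_lin_hom[OF same_space_tensor_alg same_space_tensor_alg] by blast
    show "?h \<one>\<^bsub>tensor_alg A B\<^esub> = \<one>\<^bsub>tensor_alg A' B'\<^esub>"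
      by (simp add: tensor_alg_def tens ring_hom_one[OF alg_homD(2)[OF f]] ring_hom_one[OF alg_homD(2)[OF g]])
  qed (use mult in \<open>auto simp: car\<close>)
qed

lemma base_algebra: "algebra base (base :: ('k::field, 'k) module)"
proof -
  have "abelian_group (base :: ('k, 'k) module)" 
    using cring_base ring.is_abelian_group cring.axioms(1) by metis
  then show ?thesis
    by (intro algebra_baseI vector_spaceI cring_base) (auto simp: algebra_simps)
qed


section \<open>Quotient algebras\<close>

lemma ideal_submodule:
  assumes "algebra base A" and "ideal I A"
  shows "submodule I base A"
proof -
  interpret A: algebra base A by fact
  interpret I: ideal I A by fact
  have "c \<odot>\<^bsub>A\<^esub> x \<in> I" if "x \<in> I" for c x
  proof -
    have x: "x \<in> carrier A" using that I.a_subset by blast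
    have c: "c \<odot>\<^bsub>A\<^esub> \<one>\<^bsub>A\<^esub> \<in> carrier A" using A.smult_closed[of c] by simp
    have "c \<odot>\<^bsub>A\<^esub> x = (c \<odot>\<^bsub>A\<^esub> \<one>\<^bsub>A\<^esub>) \<otimes>\<^bsub>A\<^esub> x"
      using A.smult_assoc2[of c "\<one>\<^bsub>A\<^esub>" x] x by simp
    then show ?thesis using I.I_l_closed[OF that c] by simp
  qed
  then show ?thesis
    by (intro submodule.intro I.a_subgroup submodule_axioms.intro)
qed

text \<open>The quotient of a commutative algebra by an ideal\<close>

locale alg_quotient =
  fixes A :: "('k::field, 'a, 'x) module_scheme" and I :: "'a set"
  assumes algebra: "algebra base A" and ideal: "ideal I A"
begin

interpretation A: algebra base A by (rule algebra)
interpretation I: ideal I A by (rule ideal)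

sublocale vs_quotient A I
  by (intro vs_quotient.intro algebra_module ideal_submodule algebra ideal)

lemma mult_quot: "x \<in> carrier A \<Longrightarrow> y \<in> carrier A \<Longrightarrow> proj x \<otimes>\<^bsub>Q\<^esub> proj y = proj (x \<otimes>\<^bsub>A\<^esub> y)"
  by (simp add: quot_module_def ring.defs module.defs FactRing_def I.rcoset_mult_add)

lemma one_quot: "\<one>\<^bsub>Q\<^esub> = proj \<one>\<^bsub>A\<^esub>"
  by (simp add: quot_module_def ring.defs module.defs FactRing_def)

lemma quot_algebra: "algebra base Q"
proof (rule algebra_baseI[OF quot_module])
  interpret Q: module base Q by (rule quot_module)
  have "comm_monoid Q"
    by (rule comm_monoidI) (auto simp: carrier_quot mult_quot one_quot A.m_ac)
  then show "cring Q"
    by (intro cringI Q.abelian_group_axioms)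
      (auto simp: carrier_quot mult_quot add_quot A.l_distr)
  fix c X Y assume "X \<in> carrier Q" "Y \<in> carrier Q"
  then show "(c \<odot>\<^bsub>Q\<^esub> X) \<otimes>\<^bsub>Q\<^esub> Y = c \<odot>\<^bsub>Q\<^esub> (X \<otimes>\<^bsub>Q\<^esub> Y)"
    using A.smult_closed[of c] A.smult_assoc2[of c] by (auto simp: carrier_quot mult_quot smult_quot)
qed

lemma proj_alg_hom: "alg_hom A Q (\<lambda>x. proj x)"
  by (rule alg_homI[OF proj_lin_hom]) (auto simp: mult_quot one_quot)

lemma lift_alg_hom:
  assumes P: "algebra base P" and f: "alg_hom A P f" and null: "\<And>x. x \<in> I \<Longrightarrow> f x = \<zero>\<^bsub>P\<^esub>"
  shows "alg_hom Q P (\<lambda>X. f (rep X))"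
proof -
  note lift = lift_proj[OF algebra_module[OF P] alg_homD(1)[OF f] null]
  show ?thesis
    by (rule alg_homI[OF lift_lin_hom[OF algebra_module[OF P] alg_homD(1)[OF f] null]])
      (auto simp: carrier_quot mult_quot one_quot lift ring_hom_mult[OF alg_homD(2)[OF f]]
        ring_hom_one[OF alg_homD(2)[OF f]])
qed

end


section \<open>Polynomial algebras\<close>

text \<open>The value of the monomial \<open>m\<close> under the substitution \<open>\<xi>\<close>\<close>

definition mon_eval :: "('k::field, 'a, 'x) module_scheme \<Rightarrow> ('v \<Rightarrow> 'a) \<Rightarrow> ('v \<Rightarrow>\<^sub>0 nat) \<Rightarrow> 'a" where
  "mon_eval A \<xi> m = (\<Otimes>\<^bsub>A\<^esub>v\<in>Poly_Mapping.keys m. \<xi> v [^]\<^bsub>A\<^esub> Poly_Mapping.lookup m v)"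

lemma poly_eval_eq: "poly_eval A \<xi> = lin_ext A (mon_eval A \<xi>)"
  by (simp add: fun_eq_iff poly_eval_def lin_ext_def mon_eval_def)

lemma is_free_poly_alg: "is_free {m. Poly_Mapping.keys m \<subseteq> V} (poly_alg V)"
  by (auto simp: is_free_def poly_alg_def)

lemma poly_alg_simps:
  "mult (poly_alg V) = (*)" "one (poly_alg V) = 1" "zero (poly_alg V) = 0" "add (poly_alg V) = (+)"
  by (simp_all add: poly_alg_def)

lemma poly_alg_algebra: "algebra base (poly_alg V)"
proof -
  note simps = is_free_simps[OF is_free_poly_alg] poly_alg_simps
  have mod: "module base (poly_alg V)" by (rule is_free_module[OF is_free_poly_alg])
  interpret module base "poly_alg V" by fact
  have "comm_monoid (poly_alg V :: ('a, ('b \<Rightarrow>\<^sub>0 nat) \<Rightarrow>\<^sub>0 'a) module)"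
  proof (rule comm_monoidI)
    fix p q :: "('b \<Rightarrow>\<^sub>0 nat) \<Rightarrow>\<^sub>0 'a"
    assume "p \<in> carrier (poly_alg V)" "q \<in> carrier (poly_alg V)"
    then have pq: "Poly_Mapping.keys p \<subseteq> {m. Poly_Mapping.keys m \<subseteq> V}"
      "Poly_Mapping.keys q \<subseteq> {m. Poly_Mapping.keys m \<subseteq> V}" by (simp_all add: simps)
    have "Poly_Mapping.keys (a + b) \<subseteq> V"
      if "a \<in> Poly_Mapping.keys p" "b \<in> Poly_Mapping.keys q" for a b
      using that pq Poly_Mapping.keys_add[of a b] by blast
    then have "Poly_Mapping.keys (p * q) \<subseteq> {m. Poly_Mapping.keys m \<subseteq> V}"
      using keys_mult[of p q] by blast
    then show "p \<otimes>\<^bsub>poly_alg V\<^esub> q \<in> carrier (poly_alg V)" by (simp add: simps)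
  qed (auto simp: simps mult.assoc mult.commute)
  then have "cring (poly_alg V :: ('a, ('b \<Rightarrow>\<^sub>0 nat) \<Rightarrow>\<^sub>0 'a) module)"
    by (intro cringI M.abelian_group_axioms) (auto simp: simps distrib_right)
  then show ?thesis
    by (intro algebra_baseI mod) (auto simp: simps mult_map_scale_conv_mult mult.assoc)
qed

context
  fixes A :: "('k::field, 'a, 'x) module_scheme" and \<xi> :: "'v \<Rightarrow> 'a" and V :: "'v set"
  assumes A: "algebra base A" and \<xi>: "\<And>v. v \<in> V \<Longrightarrow> \<xi> v \<in> carrier A"
begin

interpretation A: algebra base A by (rule A)

lemma mon_eval_superset:
  assumes "finite S" and "Poly_Mapping.keys m \<subseteq> S" and "S \<subseteq> V"
  shows "mon_eval A \<xi> m = (\<Otimes>\<^bsub>A\<^esub>v\<in>S. \<xi> v [^]\<^bsub>A\<^esub> Poly_Mapping.lookup m v)"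
  unfolding mon_eval_def
  by (rule A.finprod_mono_neutral_cong_left) (use assms \<xi> in \<open>auto simp: in_keys_iff subset_iff\<close>)

lemma mon_eval_closed: "Poly_Mapping.keys m \<subseteq> V \<Longrightarrow> mon_eval A \<xi> m \<in> carrier A"
  unfolding mon_eval_def by (intro A.finprod_closed) (use \<xi> in auto)

lemma mon_eval_zero: "mon_eval A \<xi> 0 = \<one>\<^bsub>A\<^esub>"
  by (simp add: mon_eval_def)

lemma mon_eval_single: "v \<in> V \<Longrightarrow> mon_eval A \<xi> (Poly_Mapping.single v k) = \<xi> v [^]\<^bsub>A\<^esub> k"
  using mon_eval_superset[of "{v}" "Poly_Mapping.single v k"] \<xi> by simp

lemma mon_eval_add:
  assumes "Poly_Mapping.keys m \<subseteq> V" and "Poly_Mapping.keys m' \<subseteq> V"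
  shows "mon_eval A \<xi> (m + m') = mon_eval A \<xi> m \<otimes>\<^bsub>A\<^esub> mon_eval A \<xi> m'"
proof -
  let ?S = "Poly_Mapping.keys m \<union> Poly_Mapping.keys m'"
  have S: "finite ?S" "?S \<subseteq> V" using assms by auto
  have "mon_eval A \<xi> (m + m') = (\<Otimes>\<^bsub>A\<^esub>v\<in>?S. \<xi> v [^]\<^bsub>A\<^esub> Poly_Mapping.lookup (m + m') v)"
    using Poly_Mapping.keys_add[of m m'] S by (intro mon_eval_superset) auto
  also have "\<dots> = (\<Otimes>\<^bsub>A\<^esub>v\<in>?S. \<xi> v [^]\<^bsub>A\<^esub> Poly_Mapping.lookup m v \<otimes>\<^bsub>A\<^esub> \<xi> v [^]\<^bsub>A\<^esub> Poly_Mapping.lookup m' v)"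
    by (rule A.finprod_cong') (use S \<xi> in \<open>auto simp: lookup_add A.nat_pow_mult subset_iff\<close>)
  also have "\<dots> = mon_eval A \<xi> m \<otimes>\<^bsub>A\<^esub> mon_eval A \<xi> m'"
    using S \<xi> by (subst (1 2) mon_eval_superset[of ?S]) (auto intro!: A.finprod_multf)
  finally show ?thesis .
qed

lemma poly_eval_lin_hom: "lin_hom (poly_alg V) A (poly_eval A \<xi>)"
  unfolding poly_eval_eq
  by (rule lin_ext_lin_hom[OF algebra_module[OF A] is_free_poly_alg]) (auto intro: mon_eval_closed)

lemma poly_eval_single:
  "Poly_Mapping.keys m \<subseteq> V \<Longrightarrow> poly_eval A \<xi> (Poly_Mapping.single m c) = c \<odot>\<^bsub>A\<^esub> mon_eval A \<xi> m"
  unfolding poly_eval_eq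
  by (rule lin_ext_single[OF algebra_module[OF A]]) (rule mon_eval_closed)

lemma poly_eval_var: "v \<in> V \<Longrightarrow> poly_eval A \<xi> (var v) = \<xi> v"
  unfolding var_def using \<xi> A.smult_one[unfolded base_simps]
  by (subst poly_eval_single) (auto simp: mon_eval_single)

lemma poly_eval_alg_hom: "alg_hom (poly_alg V) A (poly_eval A \<xi>)"
proof (rule alg_homI[OF poly_eval_lin_hom])
  note simps = is_free_simps[OF is_free_poly_alg[of V]]
  interpret P: algebra base "poly_alg V :: ('k, ('v \<Rightarrow>\<^sub>0 nat) \<Rightarrow>\<^sub>0 'k) module"
    by (rule poly_alg_algebra)
  note bilP = mult_bilin[OF poly_alg_algebra] and bilA = mult_bilin[OF A]
  let ?M = "{m :: 'v \<Rightarrow>\<^sub>0 nat. Poly_Mapping.keys m \<subseteq> V}"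
  note lin = poly_eval_lin_hom
  \<comment> \<open>Both sides are bilinear, so it suffices to compare them on monomials.\<close>
  have add: "poly_eval A \<xi> (p + q) = poly_eval A \<xi> p \<oplus>\<^bsub>A\<^esub> poly_eval A \<xi> q"
    if "Poly_Mapping.keys p \<subseteq> ?M" "Poly_Mapping.keys q \<subseteq> ?M" for p q
    using lin_hom_add[OF lin, of p q] that by (simp add: simps)
  have closed: "poly_eval A \<xi> p \<in> carrier A" if "Poly_Mapping.keys p \<subseteq> ?M" for p
    using lin_hom_closed[OF lin, of p] that by (simp add: simps)
  have mc: "Poly_Mapping.keys (p * q) \<subseteq> ?M" if "Poly_Mapping.keys p \<subseteq> ?M" "Poly_Mapping.keys q \<subseteq> ?M" 
    for p q :: "('v \<Rightarrow>\<^sub>0 nat) \<Rightarrow>\<^sub>0 'k"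
    using P.m_closed[of p q] that by (simp add: simps poly_alg_simps)
  have zero: "poly_eval A \<xi> 0 = \<zero>\<^bsub>A\<^esub>"
    using lin_hom_zero[OF algebra_module[OF poly_alg_algebra] algebra_module[OF A] lin]
    by (simp add: poly_alg_simps)
  have single: "poly_eval A \<xi> (Poly_Mapping.single m c * Poly_Mapping.single m' c')
      = poly_eval A \<xi> (Poly_Mapping.single m c) \<otimes>\<^bsub>A\<^esub> poly_eval A \<xi> (Poly_Mapping.single m' c')"
    if "m \<in> ?M" "m' \<in> ?M" for m m' c c'
  proof -
    have m: "Poly_Mapping.keys (m + m') \<subseteq> V" using that Poly_Mapping.keys_add[of m m'] by auto
    have swap: "c \<odot>\<^bsub>A\<^esub> (c' \<odot>\<^bsub>A\<^esub> x) = c' \<odot>\<^bsub>A\<^esub> (c \<odot>\<^bsub>A\<^esub> x)" if "x \<in> carrier A" for x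
      using A.smult_assoc1[of c c' x] A.smult_assoc1[of c' c x] that by (simp add: mult.commute)
    have "poly_eval A \<xi> (Poly_Mapping.single m c * Poly_Mapping.single m' c')
      = (c * c') \<odot>\<^bsub>A\<^esub> (mon_eval A \<xi> m \<otimes>\<^bsub>A\<^esub> mon_eval A \<xi> m')"
      using that m by (simp add: mult_single poly_eval_single mon_eval_add)
    also have "\<dots> = (c \<odot>\<^bsub>A\<^esub> mon_eval A \<xi> m) \<otimes>\<^bsub>A\<^esub> (c' \<odot>\<^bsub>A\<^esub> mon_eval A \<xi> m')"
      using that A.smult_assoc1[of c c'] swap
      by (simp add: lin_hom_smult[OF bilinD(1)[OF bilA]] lin_hom_smult[OF bilinD(2)[OF bilA]] 
          mon_eval_closed A.smult_closed)
    finally show ?thesis using that by (simp add: poly_eval_single)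
  qed
  have mult1: "poly_eval A \<xi> (p * Poly_Mapping.single m c)
      = poly_eval A \<xi> p \<otimes>\<^bsub>A\<^esub> poly_eval A \<xi> (Poly_Mapping.single m c)"
    if "Poly_Mapping.keys p \<subseteq> ?M" and m: "m \<in> ?M" for p m c
    using that(1)
  proof (induction p rule: free_induct)
    case zero
    have "Poly_Mapping.keys (Poly_Mapping.single m c) \<subseteq> ?M" using m by simp
    from closed[OF this] show ?case by (simp add: \<open>poly_eval A \<xi> 0 = _\<close>)
  next
    case (add q v d)
    have k: "Poly_Mapping.keys (Poly_Mapping.single m c) \<subseteq> ?M" 
      "Poly_Mapping.keys (Poly_Mapping.single v d) \<subseteq> ?M" using m add by simp_all
    show ?case
      using add k m by (simp add: distrib_right \<open>\<And>p q. _ \<Longrightarrow> _ \<Longrightarrow> poly_eval A \<xi> (p + q) = _\<close> mc single closed A.l_distr)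
  qed
  fix p q :: "('v \<Rightarrow>\<^sub>0 nat) \<Rightarrow>\<^sub>0 'k"
  assume "p \<in> carrier (poly_alg V)" "q \<in> carrier (poly_alg V)"
  then have p: "Poly_Mapping.keys p \<subseteq> ?M" and q: "Poly_Mapping.keys q \<subseteq> ?M" by (simp_all add: simps)
  have "poly_eval A \<xi> (p * q) = poly_eval A \<xi> p \<otimes>\<^bsub>A\<^esub> poly_eval A \<xi> q"
    using q
  proof (induction q rule: free_induct)
    case zero
    then show ?case using p by (simp add: \<open>poly_eval A \<xi> 0 = _\<close> closed)
  next
    case (add q v d)
    have k: "Poly_Mapping.keys (Poly_Mapping.single v d) \<subseteq> ?M" using add by simp_all
    show ?case
      using add k p by (simp add: distrib_left \<open>\<And>p q. _ \<Longrightarrow> _ \<Longrightarrow> poly_eval A \<xi> (p + q) = _\<close> mc mult1 closed A.r_distr)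
  qed
  then show "poly_eval A \<xi> (p \<otimes>\<^bsub>poly_alg V\<^esub> q) = poly_eval A \<xi> p \<otimes>\<^bsub>A\<^esub> poly_eval A \<xi> q"
    by (simp add: poly_alg_simps)
next
  have "poly_eval A \<xi> (Poly_Mapping.single 0 1) = 1 \<odot>\<^bsub>A\<^esub> mon_eval A \<xi> 0"
    by (rule poly_eval_single) simp
  then show "poly_eval A \<xi> \<one>\<^bsub>poly_alg V\<^esub> = \<one>\<^bsub>A\<^esub>"
    using A.smult_one[OF A.one_closed] by (simp add: poly_alg_simps mon_eval_zero)
qed

text \<open>Algebra morphisms commute with substitution.\<close>

lemma alg_hom_poly_eval:
  assumes B: "algebra base B" and f: "alg_hom A B f" and p: "p \<in> carrier (poly_alg V)"
  shows "f (poly_eval A \<xi> p) = poly_eval B (\<lambda>v. f (\<xi> v)) p"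
proof -
  interpret B: algebra base B by fact
  interpret f: ring_hom_cring A B f
    by (intro ring_hom_cring.intro ring_hom_cring_axioms.intro algebra_cring A B alg_homD(2)[OF f])
  note lf = alg_homD(1)[OF f]
  have pow: "f (x [^]\<^bsub>A\<^esub> k) = f x [^]\<^bsub>B\<^esub> k" if "x \<in> carrier A" for x and k :: nat
    by (induction k) (simp_all add: that)
  have keys: "Poly_Mapping.keys m \<subseteq> V" if "m \<in> Poly_Mapping.keys p" for m
    using p that by (auto simp: is_free_simps[OF is_free_poly_alg])
  have mon: "f (mon_eval A \<xi> m) = mon_eval B (\<lambda>v. f (\<xi> v)) m" if m: "m \<in> Poly_Mapping.keys p" for m
  proof -
    have \<xi>m: "\<xi> v \<in> carrier A" if "v \<in> Poly_Mapping.keys m" for v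
      using \<xi> keys[OF m] that by blast
    have "f (mon_eval A \<xi> m) = (\<Otimes>\<^bsub>B\<^esub>v\<in>Poly_Mapping.keys m. f (\<xi> v [^]\<^bsub>A\<^esub> Poly_Mapping.lookup m v))"
      unfolding mon_eval_def by (subst f.hom_finprod) (auto simp: \<xi>m o_def)
    also have "\<dots> = mon_eval B (\<lambda>v. f (\<xi> v)) m"
      unfolding mon_eval_def by (rule B.finprod_cong') (auto simp: \<xi>m pow)
    finally show ?thesis .
  qed
  have "f (poly_eval A \<xi> p)
      = (\<Oplus>\<^bsub>B\<^esub>m\<in>Poly_Mapping.keys p. f (Poly_Mapping.lookup p m \<odot>\<^bsub>A\<^esub> mon_eval A \<xi> m))"
    unfolding poly_eval_eq lin_ext_def
    by (rule lin_hom_finsum[OF algebra_module[OF A] algebra_module[OF B] lf])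
      (auto intro!: A.smult_closed mon_eval_closed keys)
  also have "\<dots> = poly_eval B (\<lambda>v. f (\<xi> v)) p"
    unfolding poly_eval_eq lin_ext_def
    by (rule B.finsum_cong')
      (use lin_hom_closed[OF lf] in \<open>auto simp: lin_hom_smult[OF lf] mon_eval_closed keys mon[symmetric] B.smult_closed\<close>)
  finally show ?thesis .
qed

end

lemma poly_eval_cong:
  assumes A: "algebra base A" and "p \<in> carrier (poly_alg V)" and "\<And>v. v \<in> V \<Longrightarrow> \<xi> v = \<eta> v"
    and "\<And>v. v \<in> V \<Longrightarrow> \<eta> v \<in> carrier A"
  shows "poly_eval A \<xi> p = poly_eval A \<eta> p"
proof -
  interpret A: algebra base A by fact
  have keys: "Poly_Mapping.keys m \<subseteq> V" if "m \<in> Poly_Mapping.keys p" for m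
    using assms(2) that by (auto simp: is_free_simps[OF is_free_poly_alg])
  have "mon_eval A \<xi> m = mon_eval A \<eta> m" if "m \<in> Poly_Mapping.keys p" for m
    unfolding mon_eval_def
    by (rule A.finprod_cong') (use assms(3,4) keys[OF that] in \<open>auto dest: subsetD\<close>)
  then show ?thesis
    unfolding poly_eval_eq lin_ext_def
    by (intro A.finsum_cong') (auto intro!: A.smult_closed mon_eval_closed[OF A assms(4)] dest: keys)
qed

lemma var_carrier: "v \<in> V \<Longrightarrow> var v \<in> carrier (poly_alg V)"
  by (simp add: is_free_simps[OF is_free_poly_alg] var_def)

lemma poly_eval_self:
  assumes "p \<in> carrier (poly_alg V)"
  shows "poly_eval (poly_alg V) var p = p"
proof -
  let ?P = "poly_alg V :: ('b, ('a \<Rightarrow>\<^sub>0 nat) \<Rightarrow>\<^sub>0 'b) module"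
  interpret P: algebra base ?P by (rule poly_alg_algebra)
  note alg = poly_alg_algebra[of V]
  have vc: "\<And>v. v \<in> V \<Longrightarrow> var v \<in> carrier ?P" by (rule var_carrier)
  note lin = poly_eval_lin_hom[where V = V and \<xi> = var, OF alg vc]
  have pow: "var v [^]\<^bsub>?P\<^esub> k = Poly_Mapping.single (Poly_Mapping.single v k) 1" if "v \<in> V" for v k
    by (induction k) (simp_all add: poly_alg_simps var_def mult_single flip: single_add)
  have mon: "mon_eval ?P var m = Poly_Mapping.single m 1" if "Poly_Mapping.keys m \<subseteq> V" for m
    using that
  proof (induction m rule: free_induct)
    case zero
    show ?case by (simp add: mon_eval_zero[where V = V and \<xi> = var, OF alg vc] poly_alg_simps)
  next
    case (add m v k)
    have "Poly_Mapping.keys (Poly_Mapping.single v k) \<subseteq> V" using add by simp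
    then have "mon_eval ?P var (m + Poly_Mapping.single v k)
        = Poly_Mapping.single m 1 * Poly_Mapping.single (Poly_Mapping.single v k) 1"
      using add by (simp add: mon_eval_add[where V = V and \<xi> = var, OF alg vc] mon_eval_single[where V = V and \<xi> = var, OF alg vc]
          pow poly_alg_simps)
    then show ?case by (simp add: mult_single)
  qed
  have "Poly_Mapping.keys p \<subseteq> {m. Poly_Mapping.keys m \<subseteq> V}"
    using assms by (simp add: is_free_simps[OF is_free_poly_alg])
  then show ?thesis
  proof (induction p rule: free_induct)
    case zero
    show ?case
      using lin_hom_zero[OF algebra_module[OF alg] algebra_module[OF alg] lin]
      by (simp add: poly_alg_simps)
  next
    case (add p m c)
    have "poly_eval ?P var (p + Poly_Mapping.single m c)
        = poly_eval ?P var p + poly_eval ?P var (Poly_Mapping.single m c)"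
      using lin_hom_add[OF lin, of p "Poly_Mapping.single m c"] add
      by (simp add: is_free_simps[OF is_free_poly_alg])
    also have "poly_eval ?P var (Poly_Mapping.single m c) = Poly_Mapping.single m c"
      using add by (simp add: poly_eval_single[where V = V and \<xi> = var, OF alg vc] mon is_free_simps[OF is_free_poly_alg] map_single)
    finally show ?case using add by simp
  qed
qed

text \<open>An algebra morphism on polynomials is the substitution of its values on the variables.\<close>

lemma alg_hom_poly_alg_eq:
  assumes "algebra base B" and "alg_hom (poly_alg V) B f" and "p \<in> carrier (poly_alg V)"
  shows "f p = poly_eval B (\<lambda>v. f (var v)) p"
  using alg_hom_poly_eval[where V = V and \<xi> = var, OF poly_alg_algebra var_carrier assms] poly_eval_self[OF assms(3)] by simp


section \<open>Coordinates\<close>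

lemma finsum_delta:
  fixes n :: nat
  assumes "module base N" and "i < n" and "y \<in> carrier N"
    and "\<And>j. j < n \<Longrightarrow> g j = (if j = i then y else \<zero>\<^bsub>N\<^esub>)"
  shows "(\<Oplus>\<^bsub>N\<^esub>j\<in>{..<n}. g j) = y"
proof -
  interpret N: module base N by fact
  have "(\<Oplus>\<^bsub>N\<^esub>j\<in>{..<n}. g j) = (\<Oplus>\<^bsub>N\<^esub>j\<in>{..<n}. if i = j then y else \<zero>\<^bsub>N\<^esub>)"
    by (rule N.finsum_cong') (use assms in auto)
  also have "\<dots> = y"
    by (rule N.add.finprod_singleton) (use assms in auto)
  finally show ?thesis .
qed

text \<open>The coefficient in \<open>N\<close> of \<open>e\<^sub>s\<close> in an element of \<open>M \<otimes> N\<close>\<close>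

definition tcoord ::
  "('k::field, 'm, 'x) module_scheme \<Rightarrow> nat \<Rightarrow> (nat \<Rightarrow> 'm) \<Rightarrow> ('k, 'n, 'y) module_scheme \<Rightarrow>
   nat \<Rightarrow> ('m \<times> 'n \<Rightarrow>\<^sub>0 'k) set \<Rightarrow> 'n" where
  "tcoord M n e N s = tlift M N N (\<lambda>m y. coord M n e m s \<odot>\<^bsub>N\<^esub> y)"

context
  fixes M :: "('k::field, 'm, 'x) module_scheme" and n :: nat and e :: "nat \<Rightarrow> 'm"
  assumes M: "module base M" and basis: "is_basis M n e"
begin

interpretation M: module base M by (rule M)

lemma basis_closed: "i < n \<Longrightarrow> e i \<in> carrier M"
  using basis by (auto simp: is_basis_def)

private lemma lincomb_closed: "(\<Oplus>\<^bsub>M\<^esub>i\<in>{..<n}. c i \<odot>\<^bsub>M\<^esub> e i) \<in> carrier M"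
  by (intro M.finsum_closed) (auto simp: M.smult_closed basis_closed)

lemma basis_expansion:
  assumes "v \<in> carrier M"
  shows "v = (\<Oplus>\<^bsub>M\<^esub>i\<in>{..<n}. coord M n e v i \<odot>\<^bsub>M\<^esub> e i)"
proof -
  have "\<exists>!c. c \<in> extensional {..<n} \<and> v = (\<Oplus>\<^bsub>M\<^esub>i\<in>{..<n}. c i \<odot>\<^bsub>M\<^esub> e i)"
    using basis assms by (simp add: is_basis_def)
  from theI'[OF this] show ?thesis by (simp add: coord_def)
qed

lemma coord_unique:
  assumes v: "v = (\<Oplus>\<^bsub>M\<^esub>i\<in>{..<n}. c i \<odot>\<^bsub>M\<^esub> e i)" and "i < n"
  shows "coord M n e v i = c i"
proof -
  have "v \<in> carrier M" using lincomb_closed v by simp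
  then have ex1: "\<exists>!c. c \<in> extensional {..<n} \<and> v = (\<Oplus>\<^bsub>M\<^esub>i\<in>{..<n}. c i \<odot>\<^bsub>M\<^esub> e i)"
    using basis by (simp add: is_basis_def)
  have "v = (\<Oplus>\<^bsub>M\<^esub>i\<in>{..<n}. restrict c {..<n} i \<odot>\<^bsub>M\<^esub> e i)"
    unfolding v by (rule M.finsum_cong') (auto simp: M.smult_closed basis_closed)
  then have "coord M n e v = restrict c {..<n}"
    unfolding coord_def by (intro the1_equality[OF ex1]) auto
  then show ?thesis using assms(2) by simp
qed

lemma coord_lin_hom:
  assumes "i < n"
  shows "lin_hom M base (\<lambda>v. coord M n e v i)"
proof (rule lin_homI)
  fix x y assume x: "x \<in> carrier M" and y: "y \<in> carrier M"
  let ?c = "coord M n e x" and ?d = "coord M n e y"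
  have "(\<Oplus>\<^bsub>M\<^esub>i\<in>{..<n}. (?c i + ?d i) \<odot>\<^bsub>M\<^esub> e i)
      = (\<Oplus>\<^bsub>M\<^esub>i\<in>{..<n}. ?c i \<odot>\<^bsub>M\<^esub> e i \<oplus>\<^bsub>M\<^esub> ?d i \<odot>\<^bsub>M\<^esub> e i)"
    using M.smult_l_distr by (intro M.finsum_cong') (auto simp: M.smult_closed basis_closed)
  also have "\<dots> = (\<Oplus>\<^bsub>M\<^esub>i\<in>{..<n}. ?c i \<odot>\<^bsub>M\<^esub> e i) \<oplus>\<^bsub>M\<^esub> (\<Oplus>\<^bsub>M\<^esub>i\<in>{..<n}. ?d i \<odot>\<^bsub>M\<^esub> e i)"
    by (rule M.finsum_addf) (auto simp: M.smult_closed basis_closed)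
  also have "\<dots> = x \<oplus>\<^bsub>M\<^esub> y"
    by (simp only: basis_expansion[OF x, symmetric] basis_expansion[OF y, symmetric])
  finally have "x \<oplus>\<^bsub>M\<^esub> y = (\<Oplus>\<^bsub>M\<^esub>i\<in>{..<n}. (?c i + ?d i) \<odot>\<^bsub>M\<^esub> e i)" ..
  from coord_unique[OF this assms]
  show "coord M n e (x \<oplus>\<^bsub>M\<^esub> y) i = coord M n e x i \<oplus>\<^bsub>base\<^esub> coord M n e y i" by simp
next
  fix c x assume x: "x \<in> carrier M"
  have "(\<Oplus>\<^bsub>M\<^esub>i\<in>{..<n}. (c * coord M n e x i) \<odot>\<^bsub>M\<^esub> e i)
      = (\<Oplus>\<^bsub>M\<^esub>i\<in>{..<n}. c \<odot>\<^bsub>M\<^esub> (coord M n e x i \<odot>\<^bsub>M\<^esub> e i))"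
    using M.smult_assoc1 by (intro M.finsum_cong') (auto simp: M.smult_closed basis_closed)
  also have "\<dots> = c \<odot>\<^bsub>M\<^esub> x"
    by (subst (2) basis_expansion[OF x], rule M.finsum_smult_ldistr[symmetric])
      (auto simp: M.smult_closed basis_closed)
  finally have "c \<odot>\<^bsub>M\<^esub> x = (\<Oplus>\<^bsub>M\<^esub>i\<in>{..<n}. (c * coord M n e x i) \<odot>\<^bsub>M\<^esub> e i)" ..
  from coord_unique[OF this assms]
  show "coord M n e (c \<odot>\<^bsub>M\<^esub> x) i = c \<odot>\<^bsub>base\<^esub> coord M n e x i" by simp
qed auto

lemma coord_basis: "i < n \<Longrightarrow> j < n \<Longrightarrow> coord M n e (e j) i = (if i = j then 1 else 0)"
proof (rule coord_unique)
  assume j: "j < n"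
  show "e j = (\<Oplus>\<^bsub>M\<^esub>i\<in>{..<n}. (if i = j then 1 else 0) \<odot>\<^bsub>M\<^esub> e i)"
    using M.smult_one M.smult_l_null
    by (intro finsum_delta[symmetric, OF M j]) (auto simp: basis_closed j)
qed

lemma basis_lin_eqI:
  assumes "module base Q" and "lin_hom M Q f" and "lin_hom M Q g"
    and "\<And>i. i < n \<Longrightarrow> f (e i) = g (e i)" and v: "v \<in> carrier M"
  shows "f v = g v"
proof -
  interpret Q: module base Q by fact
  have "h v = (\<Oplus>\<^bsub>Q\<^esub>i\<in>{..<n}. coord M n e v i \<odot>\<^bsub>Q\<^esub> h (e i))" if h: "lin_hom M Q h" for h
  proof -
    have "h v = (\<Oplus>\<^bsub>Q\<^esub>i\<in>{..<n}. h (coord M n e v i \<odot>\<^bsub>M\<^esub> e i))"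
      by (subst basis_expansion[OF v], rule lin_hom_finsum[OF M assms(1) h])
        (auto simp: M.smult_closed basis_closed)
    also have "\<dots> = (\<Oplus>\<^bsub>Q\<^esub>i\<in>{..<n}. coord M n e v i \<odot>\<^bsub>Q\<^esub> h (e i))"
      by (rule Q.finsum_cong')
        (auto simp: lin_hom_smult[OF h] basis_closed Q.smult_closed lin_hom_closed[OF h])
    finally show ?thesis .
  qed
  from this[OF assms(2)] this[OF assms(3)] show ?thesis
    by (simp, intro Q.finsum_cong')
      (auto simp: assms(4) Q.smult_closed lin_hom_closed[OF assms(3)] basis_closed)
qed

context
  fixes N :: "('k, 'n, 'y) module_scheme"
  assumes N: "module base N"
begin

interpretation N: module base N by (rule N)

private lemma MN: "module base (tensor M N)"
  by (rule tensor_module[OF M N])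

interpretation MN: module base "tensor M N" by (rule MN)

private lemma tcoord_bilin:
  assumes "s < n"
  shows "bilin M N N (\<lambda>m y. coord M n e m s \<odot>\<^bsub>N\<^esub> y)"
  using lin_hom_scale[OF N] lin_hom_comp[OF coord_lin_hom[OF assms] lin_hom_scalar[OF N]]
  by (intro bilinI) auto

lemma tcoord_lin_hom: "s < n \<Longrightarrow> lin_hom (tensor M N) N (tcoord M n e N s)"
  unfolding tcoord_def by (rule tlift_lin_hom[OF M N N tcoord_bilin])

lemma tcoord_tens:
  "s < n \<Longrightarrow> m \<in> carrier M \<Longrightarrow> y \<in> carrier N \<Longrightarrow>
    tcoord M n e N s (tens M N m y) = coord M n e m s \<odot>\<^bsub>N\<^esub> y"
  unfolding tcoord_def by (rule tlift_tens[OF M N N tcoord_bilin])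

lemma tcoord_finsum:
  assumes s: "s < n" and h: "\<And>t. t < n \<Longrightarrow> h t \<in> carrier N"
  shows "tcoord M n e N s (\<Oplus>\<^bsub>tensor M N\<^esub>t\<in>{..<n}. tens M N (e t) (h t)) = h s"
proof -
  have "tcoord M n e N s (\<Oplus>\<^bsub>tensor M N\<^esub>t\<in>{..<n}. tens M N (e t) (h t))
      = (\<Oplus>\<^bsub>N\<^esub>t\<in>{..<n}. tcoord M n e N s (tens M N (e t) (h t)))"
    by (rule lin_hom_finsum[OF MN N tcoord_lin_hom[OF s]]) (auto intro: tens_closed[OF M N] h basis_closed)
  also have "\<dots> = h s"
    using N.smult_one N.smult_l_null 
    by (intro finsum_delta[OF N s]) (auto simp: h s tcoord_tens basis_closed coord_basis)
  finally show ?thesis .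
qed

lemma tensor_expansion:
  assumes "t \<in> carrier (tensor M N)"
  shows "t = (\<Oplus>\<^bsub>tensor M N\<^esub>s\<in>{..<n}. tens M N (e s) (tcoord M n e N s t))"
proof (rule tensor_lin_eqI[OF M N lin_hom_id _ _ assms])
  show "lin_hom (tensor M N) (tensor M N) (\<lambda>t. \<Oplus>\<^bsub>tensor M N\<^esub>s\<in>{..<n}. tens M N (e s) (tcoord M n e N s t))"
    by (intro lin_hom_finsum_fun MN lin_hom_comp[OF tcoord_lin_hom bilinD(1)[OF tens_bilin[OF M N]]] basis_closed)
      simp_all
  fix x y assume x: "x \<in> carrier M" and y: "y \<in> carrier N"
  have bil: "lin_hom M (tensor M N) (\<lambda>x. tens M N x y)"
    by (rule bilinD(2)[OF tens_bilin[OF M N] y])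
  have "tens M N x y = (\<Oplus>\<^bsub>tensor M N\<^esub>s\<in>{..<n}. tens M N (coord M n e x s \<odot>\<^bsub>M\<^esub> e s) y)"
    by (subst basis_expansion[OF x], rule lin_hom_finsum[OF M MN bil])
      (auto simp: M.smult_closed basis_closed)
  also have "\<dots> = (\<Oplus>\<^bsub>tensor M N\<^esub>s\<in>{..<n}. tens M N (e s) (tcoord M n e N s (tens M N x y)))"
    by (rule MN.finsum_cong')
      (auto simp: lin_hom_smult[OF bilinD(2)[OF tens_bilin[OF M N]]]
        lin_hom_smult[OF bilinD(1)[OF tens_bilin[OF M N]]] tcoord_tens x y basis_closed
        N.smult_closed intro!: tens_closed[OF M N])
  finally show "tens M N x y = (\<Oplus>\<^bsub>tensor M N\<^esub>s\<in>{..<n}. tens M N (e s) (tcoord M n e N s (tens M N x y)))" .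
qed

end

end


section \<open>Canonical identifications of tensor products\<close>

context
  fixes M :: "('k::field, 'm, 'x) module_scheme" and N :: "('k, 'n, 'y) module_scheme"
    and P :: "('k, 'p, 'z) module_scheme"
  assumes M: "module base M" and N: "module base N" and P: "module base P"
begin

private lemma inner: "p \<in> carrier P \<Longrightarrow>
    bilin M N (tensor M (tensor N P)) (\<lambda>m n. tens M (tensor N P) m (tens N P n p))"
  using bilin_pre[OF tens_bilin[OF M tensor_module[OF N P]] lin_hom_id bilinD(2)[OF tens_bilin[OF N P]]] .

private lemma outer: "bilin (tensor M N) P (tensor M (tensor N P))
    (\<lambda>t p. tlift M N (tensor M (tensor N P)) (\<lambda>m n. tens M (tensor N P) m (tens N P n p)) t)"
proof (rule bilinI)
  fix t assume "t \<in> carrier (tensor M N)"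
  then show "lin_hom P (tensor M (tensor N P))
      (\<lambda>p. tlift M N (tensor M (tensor N P)) (\<lambda>m n. tens M (tensor N P) m (tens N P n p)) t)"
    by (intro tlift_fun_lin tensor_module M N P
        lin_hom_comp[OF bilinD(1)[OF tens_bilin[OF N P]] bilinD(1)[OF tens_bilin]])
next
  fix p assume "p \<in> carrier P"
  then show "lin_hom (tensor M N) (tensor M (tensor N P))
      (tlift M N (tensor M (tensor N P)) (\<lambda>m n. tens M (tensor N P) m (tens N P n p)))"
    by (intro tlift_lin_hom tensor_module M N P inner)
qed

lemma tassoc_lin_hom: "lin_hom (tensor (tensor M N) P) (tensor M (tensor N P)) (tassoc M N P)"
  unfolding tassoc_def by (intro tlift_lin_hom tensor_module M N P outer)

lemma tassoc_tens:
  assumes "m \<in> carrier M" and "n \<in> carrier N" and "p \<in> carrier P"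
  shows "tassoc M N P (tens (tensor M N) P (tens M N m n) p) = tens M (tensor N P) m (tens N P n p)"
  unfolding tassoc_def
  by (subst tlift_tens[OF tensor_module[OF M N] P tensor_module[OF M tensor_module[OF N P]] outer])
    (use assms in \<open>simp_all add: tens_closed M N P tensor_module
      tlift_tens[OF M N tensor_module[OF M tensor_module[OF N P]] inner]\<close>)

end

context
  fixes M :: "('k::field, 'm, 'x) module_scheme"
  assumes M: "module base M"
begin

private lemma runit_bilin: "bilin M base M (\<lambda>m c. c \<odot>\<^bsub>M\<^esub> m)"
  using lin_hom_scalar[OF M] lin_hom_scale[OF M] by (intro bilinI)

lemma runit_lin_hom: "lin_hom (tensor M base) M (runit M)"
  unfolding runit_def
  by (rule tlift_lin_hom[OF M algebra_module[OF base_algebra] M runit_bilin])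

lemma runit_tens: "m \<in> carrier M \<Longrightarrow> runit M (tens M base m c) = c \<odot>\<^bsub>M\<^esub> m"
  unfolding runit_def
  by (rule tlift_tens[OF M algebra_module[OF base_algebra] M runit_bilin]) auto

end


section \<open>The brackets of \<open>L \<otimes> A\<close>\<close>

lemma tensor_ly_simps:
  "bracket (tensor_ly L A) = (\<lambda>s t. tlift L A (tensor L A) (\<lambda>x a. tlift L A (tensor L A) (\<lambda>y b.
     tens L A (bracket L x y) (a \<otimes>\<^bsub>A\<^esub> b)) t) s)"
  "triple (tensor_ly L A) = (\<lambda>s t u. tlift L A (tensor L A) (\<lambda>x a. tlift L A (tensor L A) (\<lambda>y b.
     tlift L A (tensor L A) (\<lambda>z c. tens L A (triple L x y z) (a \<otimes>\<^bsub>A\<^esub> b \<otimes>\<^bsub>A\<^esub> c)) u) t) s)"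
  by (simp_all add: tensor_ly_def module.defs ly_algebra.defs)

context
  fixes L :: "('k::field, 'l, 'x) ly_algebra_scheme" and A :: "('k, 'a, 'y) module_scheme"
  assumes L: "lie_yamaguti L" and A: "algebra base A"
begin

interpretation L: lie_yamaguti L by (rule L)
interpretation A: algebra base A by (rule A)

private lemma mod_L: "module base L"
  by (rule lie_yamaguti.axioms(1)[OF L])

private lemma mod_A: "module base A"
  by (rule algebra_module[OF A])

private lemma mod_T: "module base (tensor L A)"
  by (rule tensor_module[OF mod_L mod_A])

private lemmas mult_lin = bilinD[OF mult_bilin[OF A]]
private lemmas tens_pre = bilin_pre[OF tens_bilin[OF mod_L mod_A]]

text \<open>The bracket is bilinear and the triple bracket trilinear, with the expected values on pure tensors.\<close>

private lemma bracket_inner: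
  assumes "x \<in> carrier L" "a \<in> carrier A"
  shows "bilin L A (tensor L A) (\<lambda>y b. tens L A (bracket L x y) (a \<otimes>\<^bsub>A\<^esub> b))"
  by (intro tens_pre L.bracket_bilinear mult_lin assms)

private lemma bracket_outer:
  assumes "t \<in> carrier (tensor L A)"
  shows "bilin L A (tensor L A)
    (\<lambda>x a. tlift L A (tensor L A) (\<lambda>y b. tens L A (bracket L x y) (a \<otimes>\<^bsub>A\<^esub> b)) t)"
proof -
  have "bilin L A (tensor L A) (\<lambda>x a. tens L A (bracket L x y) (a \<otimes>\<^bsub>A\<^esub> b))"
    if "y \<in> carrier L" "b \<in> carrier A" for y b
    by (intro tens_pre L.bracket_bilinear mult_lin that)
  then show ?thesis
    by (intro bilinI tlift_fun_lin mod_L mod_A mod_T assms) (auto dest: bilinD)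
qed

lemma tensor_ly_bracket_bilin:
  "bilin (tensor L A) (tensor L A) (tensor L A) (bracket (tensor_ly L A))"
  unfolding tensor_ly_simps
  by (intro bilinI tlift_fun_lin[OF mod_L mod_A mod_T _ mod_T] tlift_lin_hom[OF mod_L mod_A mod_T] bracket_inner bracket_outer)

lemma tensor_ly_bracket_tens:
  assumes "x \<in> carrier L" "a \<in> carrier A" and "y \<in> carrier L" "b \<in> carrier A"
  shows "bracket (tensor_ly L A) (tens L A x a) (tens L A y b) = tens L A (bracket L x y) (a \<otimes>\<^bsub>A\<^esub> b)"
  by (simp only: tensor_ly_simps tlift_tens[OF mod_L mod_A mod_T bracket_outer[OF tens_closed[OF mod_L mod_A assms(3,4)]] assms(1,2)]
      tlift_tens[OF mod_L mod_A mod_T bracket_inner[OF assms(1,2)] assms(3,4)])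

private lemma triple_inner:
  assumes "x \<in> carrier L" "a \<in> carrier A" "y \<in> carrier L" "b \<in> carrier A"
  shows "bilin L A (tensor L A) (\<lambda>z c. tens L A (triple L x y z) (a \<otimes>\<^bsub>A\<^esub> b \<otimes>\<^bsub>A\<^esub> c))"
  by (intro tens_pre L.triple_trilinear mult_lin A.m_closed assms)

private lemma triple_middle:
  assumes u: "u \<in> carrier (tensor L A)" and xa: "x \<in> carrier L" "a \<in> carrier A"
  shows "bilin L A (tensor L A) (\<lambda>y b. tlift L A (tensor L A)
    (\<lambda>z c. tens L A (triple L x y z) (a \<otimes>\<^bsub>A\<^esub> b \<otimes>\<^bsub>A\<^esub> c)) u)"
proof -
  have "bilin L A (tensor L A) (\<lambda>y b. tens L A (triple L x y z) (a \<otimes>\<^bsub>A\<^esub> b \<otimes>\<^bsub>A\<^esub> c))"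
    if "z \<in> carrier L" "c \<in> carrier A" for z c
    by (rule tens_pre[OF L.triple_trilinear(2) lin_hom_comp[OF mult_lin(1) mult_lin(2)]]) (use that xa in auto)
  then show ?thesis
    by (intro bilinI tlift_fun_lin mod_L mod_A mod_T u) (auto dest: bilinD)
qed

private lemma triple_middle':
  assumes u: "u \<in> carrier (tensor L A)" and yb: "y \<in> carrier L" "b \<in> carrier A"
  shows "bilin L A (tensor L A) (\<lambda>x a. tlift L A (tensor L A)
    (\<lambda>z c. tens L A (triple L x y z) (a \<otimes>\<^bsub>A\<^esub> b \<otimes>\<^bsub>A\<^esub> c)) u)"
proof -
  have "bilin L A (tensor L A) (\<lambda>x a. tens L A (triple L x y z) (a \<otimes>\<^bsub>A\<^esub> b \<otimes>\<^bsub>A\<^esub> c))"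
    if "z \<in> carrier L" "c \<in> carrier A" for z c
    by (rule tens_pre[OF L.triple_trilinear(3) lin_hom_comp[OF mult_lin(2) mult_lin(2)]]) (use that yb in auto)
  then show ?thesis
    by (intro bilinI tlift_fun_lin mod_L mod_A mod_T u) (auto dest: bilinD)
qed

private lemma triple_outer:
  assumes t: "t \<in> carrier (tensor L A)" and u: "u \<in> carrier (tensor L A)"
  shows "bilin L A (tensor L A) (\<lambda>x a. tlift L A (tensor L A) (\<lambda>y b. tlift L A (tensor L A)
    (\<lambda>z c. tens L A (triple L x y z) (a \<otimes>\<^bsub>A\<^esub> b \<otimes>\<^bsub>A\<^esub> c)) u) t)"
  by (rule bilinI;
      rule tlift_fun_lin[OF mod_L mod_A mod_T bilinD(1)[OF triple_middle'[OF u]] mod_A t]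
        tlift_fun_lin[OF mod_L mod_A mod_T bilinD(2)[OF triple_middle'[OF u]] mod_L t]; assumption)

lemma tensor_ly_triple_trilin:
  assumes s: "s \<in> carrier (tensor L A)" and t: "t \<in> carrier (tensor L A)"
  shows "lin_hom (tensor L A) (tensor L A) (\<lambda>u. triple (tensor_ly L A) s t u)"
    and "lin_hom (tensor L A) (tensor L A) (\<lambda>u. triple (tensor_ly L A) s u t)"
    and "lin_hom (tensor L A) (tensor L A) (\<lambda>u. triple (tensor_ly L A) u s t)"
  unfolding tensor_ly_simps
  by (intro tlift_fun_lin[OF mod_L mod_A mod_T _ mod_T] tlift_lin_hom[OF mod_L mod_A mod_T] triple_inner triple_middle triple_outer s t; assumption)+

lemma tensor_ly_triple_tens:
  assumes x: "x \<in> carrier L" "a \<in> carrier A" and y: "y \<in> carrier L" "b \<in> carrier A"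
    and z: "z \<in> carrier L" "c \<in> carrier A"
  shows "triple (tensor_ly L A) (tens L A x a) (tens L A y b) (tens L A z c)
    = tens L A (triple L x y z) (a \<otimes>\<^bsub>A\<^esub> b \<otimes>\<^bsub>A\<^esub> c)"
proof -
  note ty = tens_closed[OF mod_L mod_A y] and tz = tens_closed[OF mod_L mod_A z]
  show ?thesis
    by (simp only: tensor_ly_simps tlift_tens[OF mod_L mod_A mod_T triple_outer[OF ty tz] x]
        tlift_tens[OF mod_L mod_A mod_T triple_middle[OF tz x] y] tlift_tens[OF mod_L mod_A mod_T triple_inner[OF x y] z])
qed

end


section \<open>The universal algebra\<close>

lemma poly_alg_sum:
  assumes "\<And>i. i \<in> I \<Longrightarrow> g i \<in> carrier (poly_alg V)"
  shows "sum g I = (\<Oplus>\<^bsub>poly_alg V\<^esub>i\<in>I. g i)"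
proof -
  interpret P: algebra base "poly_alg V" by (rule poly_alg_algebra)
  show ?thesis
    using assms
    by (induction I rule: infinite_finite_induct) (simp_all add: poly_alg_simps Pi_def)
qed

lemma poly_alg_sum_closed:
  assumes "\<And>i. i \<in> I \<Longrightarrow> g i \<in> carrier (poly_alg V)"
  shows "sum g I \<in> carrier (poly_alg V)"
proof -
  interpret P: algebra base "poly_alg V" by (rule poly_alg_algebra)
  show ?thesis by (subst poly_alg_sum) (use assms in auto)
qed

lemma alg_hom_sum:
  assumes "algebra base A" and "alg_hom (poly_alg V) A F"
    and "\<And>i. i \<in> I \<Longrightarrow> g i \<in> carrier (poly_alg V)"
  shows "F (sum g I) = (\<Oplus>\<^bsub>A\<^esub>i\<in>I. F (g i))"
  by (subst poly_alg_sum, erule assms(3), rule lin_hom_finsum[OF algebra_module[OF poly_alg_algebra] algebra_module[OF assms(1)]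
      alg_homD(1)[OF assms(2)]]) (use assms(3) in auto)

text \<open>
  A Lie-Yamaguti algebra with a chosen finite basis \<open>e\<close> and structure constants \<open>\<tau>\<close>, \<open>\<omega>\<close>. The
  universal algebra \<open>A\<close> is the quotient of the polynomial algebra \<open>P\<close> by the ideal \<open>J\<close>, and \<open>x s i\<close>
  is the class of the variable \<open>(s, i)\<close>.
\<close>

locale ly_basis =
  fixes L :: "('k::field, 'l, 'x) ly_algebra_scheme" and n :: nat and e :: "nat \<Rightarrow> 'l"
  assumes ly: "lie_yamaguti L" and basis: "is_basis L n e"
begin

abbreviation "vars \<equiv> {..<n} \<times> {..<n}"
abbreviation "P \<equiv> poly_alg vars :: ('k, (nat \<times> nat \<Rightarrow>\<^sub>0 nat) \<Rightarrow>\<^sub>0 'k) module"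
abbreviation "J \<equiv> univ_ideal L n e"
abbreviation "A \<equiv> univ_alg L n e"
abbreviation "x \<equiv> univ_gen L n e"
abbreviation "\<tau> i j \<equiv> coord L n e (bracket L (e i) (e j))"
abbreviation "\<omega> i j k \<equiv> coord L n e (triple L (e i) (e j) (e k))"

abbreviation "bracket_lhs a i j \<equiv> \<Sum>u<n. \<tau> i j u \<odot>\<^bsub>P\<^esub> var (a, u)"
abbreviation "bracket_rhs a i j \<equiv> \<Sum>s<n. \<Sum>t<n. \<tau> s t a \<odot>\<^bsub>P\<^esub> (var (s, i) * var (t, j))"
abbreviation "triple_lhs a i j k \<equiv> \<Sum>u<n. \<omega> i j k u \<odot>\<^bsub>P\<^esub> var (a, u)"
abbreviation "triple_rhs a i j k \<equiv>
  \<Sum>r<n. \<Sum>s<n. \<Sum>t<n. \<omega> r s t a \<odot>\<^bsub>P\<^esub> (var (r, i) * var (s, j) * var (t, k))"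

text \<open>The generators of \<open>J\<close>\<close>

definition relators :: "((nat \<times> nat \<Rightarrow>\<^sub>0 nat) \<Rightarrow>\<^sub>0 'k) set" where
  "relators = {bracket_lhs a i j - bracket_rhs a i j | a i j. a < n \<and> i < n \<and> j < n} \<union>
     {triple_lhs a i j k - triple_rhs a i j k | a i j k. a < n \<and> i < n \<and> j < n \<and> k < n}"

lemma J_eq: "J = Idl\<^bsub>P\<^esub> relators"
  by (simp add: univ_ideal_def Let_def relators_def)

interpretation L: lie_yamaguti L by (rule ly)
interpretation P: algebra base P by (rule poly_alg_algebra)

lemma mod_L: "module base L"
  by (rule lie_yamaguti.axioms(1)[OF ly])

lemmas e_closed = basis_closed[OF mod_L basis]

lemma var_closed: "i < n \<Longrightarrow> j < n \<Longrightarrow> var (i, j) \<in> carrier P"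
  by (rule var_carrier) simp

lemma mult_closed: "p \<in> carrier P \<Longrightarrow> q \<in> carrier P \<Longrightarrow> p * q \<in> carrier P"
  using P.m_closed by (simp add: poly_alg_simps)

lemma diff_closed: "p \<in> carrier P \<Longrightarrow> q \<in> carrier P \<Longrightarrow> p - q \<in> carrier P"
  using keys_diff_subset[of p q] by (auto simp: is_free_simps[OF is_free_poly_alg])

lemma relator_closed:
  "a < n \<Longrightarrow> bracket_lhs a i j \<in> carrier P"
  "i < n \<Longrightarrow> j < n \<Longrightarrow> bracket_rhs a i j \<in> carrier P"
  "a < n \<Longrightarrow> triple_lhs a i j k \<in> carrier P"
  "i < n \<Longrightarrow> j < n \<Longrightarrow> k < n \<Longrightarrow> triple_rhs a i j k \<in> carrier P"
  by (auto intro!: poly_alg_sum_closed P.smult_closed mult_closed var_closed)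

lemma relators_carrier: "relators \<subseteq> carrier P"
  by (auto simp: relators_def intro!: diff_closed relator_closed)

lemma J_ideal: "ideal J P"
  unfolding J_eq by (rule P.genideal_ideal[OF relators_carrier])

sublocale A: alg_quotient P J
  rewrites "quot_module P J = A"
  by (intro alg_quotient.intro poly_alg_algebra J_ideal) (simp add: univ_alg_def)

lemma x_eq: "x s i = A.proj (var (s, i))"
  by (simp add: univ_gen_def)

lemma x_closed: "s < n \<Longrightarrow> i < n \<Longrightarrow> x s i \<in> carrier A"
  unfolding x_eq by (rule lin_hom_closed[OF A.proj_lin_hom var_closed])

text \<open>
  A morphism on \<open>P\<close> that identifies the two sides of every relation vanishes on \<open>J\<close>, and therefore
  factors through \<open>A\<close>.
\<close>

lemma ideal_null:
  assumes B: "algebra base B" and F: "alg_hom P B F"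
    and br: "\<And>a i j. a < n \<Longrightarrow> i < n \<Longrightarrow> j < n \<Longrightarrow> F (bracket_lhs a i j) = F (bracket_rhs a i j)"
    and tr: "\<And>a i j k. a < n \<Longrightarrow> i < n \<Longrightarrow> j < n \<Longrightarrow> k < n \<Longrightarrow> F (triple_lhs a i j k) = F (triple_rhs a i j k)"
    and p: "p \<in> J"
  shows "F p = \<zero>\<^bsub>B\<^esub>"
proof -
  interpret B: algebra base B by fact
  interpret F: ring_hom_ring P B F
    by (intro ring_hom_ringI2 P.ring_axioms B.ring_axioms alg_homD(2)[OF F])
  have diff: "F (p - q) = \<zero>\<^bsub>B\<^esub>" if "p \<in> carrier P" "q \<in> carrier P" "F p = F q" for p q
    using F.hom_add[of "p - q" q] F.hom_closed[of "p - q"] F.hom_closed[of q] diff_closed[of p q] that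
    by (simp add: poly_alg_simps B.add.r_cancel_one)
  have "relators \<subseteq> a_kernel P B F"
  proof
    fix r assume r: "r \<in> relators"
    then have "F r = \<zero>\<^bsub>B\<^esub>"
      unfolding relators_def
    proof (elim UnE CollectE exE conjE)
      fix a i j assume *: "r = bracket_lhs a i j - bracket_rhs a i j" "a < n" "i < n" "j < n"
      show ?thesis
        unfolding *(1) by (rule diff[OF relator_closed(1)[OF *(2)] relator_closed(2)[OF *(3,4)] br[OF *(2-4)]])
    next
      fix a i j k assume *: "r = triple_lhs a i j k - triple_rhs a i j k" "a < n" "i < n" "j < n" "k < n"
      show ?thesis
        unfolding *(1) by (rule diff[OF relator_closed(3)[OF *(2)] relator_closed(4)[OF *(3-5)] tr[OF *(2-5)]])
    qed
    then show "r \<in> a_kernel P B F"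
      using subsetD[OF relators_carrier r] unfolding a_kernel_def' by blast
  qed
  then have "J \<subseteq> a_kernel P B F"
    unfolding J_eq by (rule P.genideal_minimal[OF F.kernel_is_ideal])
  from subsetD[OF this p] show ?thesis by (rule F.kernel_zero)
qed

text \<open>Algebra morphisms on \<open>A\<close> are determined by their values on the generators.\<close>

lemma univ_alg_eqI:
  assumes B: "algebra base B" and F: "alg_hom A B F" and G: "alg_hom A B G"
    and "\<And>s i. s < n \<Longrightarrow> i < n \<Longrightarrow> F (x s i) = G (x s i)" and X: "X \<in> carrier A"
  shows "F X = G X"
proof -
  obtain p where p: "p \<in> carrier P" "X = A.proj p" using X A.carrier_quot by blast
  have *: "H X = poly_eval B (\<lambda>(s, i). H (x s i)) p" if H: "alg_hom A B H" for H
    using alg_hom_poly_alg_eq[OF B alg_hom_comp[OF A.proj_alg_hom H] p(1)] p(2)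
    by (simp add: x_eq case_prod_unfold)
  have "poly_eval B (\<lambda>(s, i). F (x s i)) p = poly_eval B (\<lambda>(s, i). G (x s i)) p"
    by (rule poly_eval_cong[OF B p(1)])
      (use assms(4) x_closed lin_hom_closed[OF alg_homD(1)[OF G]] in auto)
  then show ?thesis using *[OF F] *[OF G] by simp
qed

lemma mod_A: "module base A"
  by (rule A.quot_module)

lemma univ_coaction_lin_hom: "lin_hom L (tensor L A) (univ_coaction L n e)"
proof -
  interpret T: module base "tensor L A" by (rule tensor_module[OF mod_L mod_A])
  show ?thesis
    unfolding univ_coaction_def Let_def
    by (intro lin_hom_finsum_fun mod_L tensor_module mod_A lin_hom_comp[OF coord_lin_hom[OF mod_L basis]]
        lin_hom_scalar T.finsum_closed) (auto intro!: tens_closed mod_L mod_A x_closed e_closed)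
qed

lemma univ_coaction_basis:
  assumes "i < n"
  shows "univ_coaction L n e (e i) = (\<Oplus>\<^bsub>tensor L A\<^esub>s\<in>{..<n}. tens L A (e s) (x s i))"
proof -
  interpret T: module base "tensor L A" by (rule tensor_module[OF mod_L mod_A])
  have closed: "(\<Oplus>\<^bsub>tensor L A\<^esub>s\<in>{..<n}. tens L A (e s) (x s j)) \<in> carrier (tensor L A)" if "j < n" for j
    by (intro T.finsum_closed) (auto intro!: tens_closed mod_L mod_A x_closed e_closed that)
  show ?thesis
    unfolding univ_coaction_def Let_def
    using T.smult_one T.smult_l_null
    by (intro finsum_delta[OF T.module_axioms assms closed])
      (auto simp: coord_basis[OF mod_L basis] closed assms)
qed

lemma univ_bialg_simps:
  "carrier (univ_bialg L n e) = carrier A" "mult (univ_bialg L n e) = mult A"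
  "one (univ_bialg L n e) = one A" "add (univ_bialg L n e) = add A"
  "zero (univ_bialg L n e) = zero A" "smult (univ_bialg L n e) = smult A"
  "comult (univ_bialg L n e) = (\<lambda>X. poly_eval (tensor_alg A A)
     (\<lambda>(i, j). \<Oplus>\<^bsub>tensor_alg A A\<^esub>s\<in>{..<n}. tens A A (x i s) (x s j)) (rep X))"
  "counit (univ_bialg L n e) = (\<lambda>X. poly_eval base (\<lambda>(i, j). if i = j then 1 else 0) (rep X))"
  by (simp_all add: univ_bialg_def Let_def module.defs bialgebra.defs)

lemma alg_hom_univ_bialg: "alg_hom (univ_bialg L n e) B F \<longleftrightarrow> alg_hom A B F"
  by (simp add: alg_hom_def lin_hom_def ring_hom_def univ_bialg_simps)

text \<open>The coaction \<open>(id \<otimes> k) \<circ> \<Phi>\<close> has the matrix with entries \<open>k(x\<^sub>s\<^sub>i)\<close>.\<close>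

lemma tmap_univ_coaction:
  assumes B: "algebra base B" and k: "lin_hom A B k" and "i < n"
  shows "tmap L A L B id k (univ_coaction L n e (e i)) = (\<Oplus>\<^bsub>tensor L B\<^esub>s\<in>{..<n}. tens L B (e s) (k (x s i)))"
proof -
  note mod_B = algebra_module[OF B]
  interpret T: module base "tensor L B" by (rule tensor_module[OF mod_L mod_B])
  have "tmap L A L B id k (univ_coaction L n e (e i))
      = (\<Oplus>\<^bsub>tensor L B\<^esub>s\<in>{..<n}. tmap L A L B id k (tens L A (e s) (x s i)))"
    unfolding univ_coaction_basis[OF assms(3)]
    by (rule lin_hom_finsum[OF tensor_module[OF mod_L mod_A] tensor_module[OF mod_L mod_B] tmap_lin_hom[OF mod_L mod_A mod_L mod_B lin_hom_id_map k]])
      (use assms(3) in \<open>auto intro!: tens_closed mod_L mod_A x_closed e_closed\<close>)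
  also have "\<dots> = (\<Oplus>\<^bsub>tensor L B\<^esub>s\<in>{..<n}. tens L B (e s) (k (x s i)))"
    by (rule T.finsum_cong')
      (use assms(3) in \<open>auto simp: tmap_tens[OF mod_L mod_A mod_L mod_B lin_hom_id_map k] x_closed e_closed
        intro!: tens_closed mod_L mod_B lin_hom_closed[OF k]\<close>)
  finally show ?thesis .
qed

end


section \<open>The bialgebra morphism of a coaction\<close>

text \<open>
  A coaction \<open>f\<close> of a commutative bialgebra \<open>H\<close> on \<open>L\<close> by a Lie-Yamaguti algebra morphism. The
  antipode of a Hopf algebra plays no role until the universal property of the free commutative
  Hopf algebra is applied.
\<close>

locale ly_coaction = ly_basis L n e
  for L :: "('k::field, 'l, 'x) ly_algebra_scheme" and n :: nat and e :: "nat \<Rightarrow> 'l" +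
  fixes H :: "('k, 'h, 'y) bialgebra_scheme" and f :: "'l \<Rightarrow> ('l \<times> 'h \<Rightarrow>\<^sub>0 'k) set"
  assumes bialg: "comm_bialgebra H" and f_ly: "ly_hom L (tensor_ly L H) f"
    and f_comod: "right_comodule L H f"
begin

interpretation L: lie_yamaguti L by (rule ly)

lemma H: "algebra base H" and comult_alg: "alg_hom H (tensor_alg H H) (comult H)"
  and counit_alg: "alg_hom H base (counit H)"
  using bialg by (simp_all add: comm_bialgebra_def)

lemma mod_H: "module base H"
  by (rule algebra_module[OF H])

interpretation H: algebra base H by (rule H)

lemma mod_LH: "module base (tensor L H)" and mod_HH: "module base (tensor H H)"
  and mod_LHH: "module base (tensor L (tensor H H))"
  by (intro tensor_module mod_L mod_H)+

interpretation LH: module base "tensor L H" by (rule mod_LH)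
interpretation HH: module base "tensor H H" by (rule mod_HH)
interpretation LHH: module base "tensor L (tensor H H)" by (rule mod_LHH)

lemma f_lin: "lin_hom L (tensor L H) f"
  using f_comod by (simp add: right_comodule_def)

text \<open>The matrix \<open>h\<close> of the coaction: \<open>f(e\<^sub>i) = \<Sum>\<^sub>s e\<^sub>s \<otimes> h\<^sub>s\<^sub>i\<close>\<close>

definition h :: "nat \<Rightarrow> nat \<Rightarrow> 'h" where
  "h s i = tcoord L n e H s (f (e i))"

abbreviation "crd \<equiv> tcoord L n e H"

lemma h_closed: "s < n \<Longrightarrow> i < n \<Longrightarrow> h s i \<in> carrier H"
  unfolding h_def
  using lin_hom_closed[OF tcoord_lin_hom[OF mod_L basis mod_H]] lin_hom_closed[OF f_lin] e_closed by blast

lemma f_basis: "i < n \<Longrightarrow> f (e i) = (\<Oplus>\<^bsub>tensor L H\<^esub>s\<in>{..<n}. tens L H (e s) (h s i))"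
  unfolding h_def
  by (rule tensor_expansion[OF mod_L basis mod_H]) (rule lin_hom_closed[OF f_lin e_closed])

lemma tens_h_closed: "i < n \<Longrightarrow> s < n \<Longrightarrow> t < n \<Longrightarrow> tens L H (e s) (h t i) \<in> carrier (tensor L H)"
  by (intro tens_closed mod_L mod_H e_closed h_closed)

lemma f_e_closed: "i < n \<Longrightarrow> f (e i) \<in> carrier (tensor L H)"
  by (rule lin_hom_closed[OF f_lin e_closed])

lemma lin_hom_f_basis:
  assumes "module base Q" and "lin_hom (tensor L H) Q F" and "i < n"
  shows "F (f (e i)) = (\<Oplus>\<^bsub>Q\<^esub>s\<in>{..<n}. F (tens L H (e s) (h s i)))"
  unfolding f_basis[OF assms(3)]
  by (rule lin_hom_finsum[OF mod_LH assms(1,2)]) (use assms(3) tens_h_closed in auto)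

lemma crd_f:
  assumes "a < n" and v: "v \<in> carrier L"
  shows "crd a (f v) = (\<Oplus>\<^bsub>H\<^esub>u\<in>{..<n}. coord L n e v u \<odot>\<^bsub>H\<^esub> h a u)"
proof -
  have lin: "lin_hom L H (\<lambda>v. crd a (f v))"
    by (rule lin_hom_comp[OF f_lin tcoord_lin_hom[OF mod_L basis mod_H assms(1)]])
  have "crd a (f v) = (\<Oplus>\<^bsub>H\<^esub>u\<in>{..<n}. crd a (f (coord L n e v u \<odot>\<^bsub>L\<^esub> e u)))"
    by (subst basis_expansion[OF mod_L basis v], rule lin_hom_finsum[OF mod_L mod_H lin])
      (auto intro!: L.smult_closed e_closed)
  also have "\<dots> = (\<Oplus>\<^bsub>H\<^esub>u\<in>{..<n}. coord L n e v u \<odot>\<^bsub>H\<^esub> h a u)"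
    by (rule H.finsum_cong')
      (use assms(1) in \<open>auto simp: lin_hom_smult[OF lin] e_closed h_def[symmetric] intro!: H.smult_closed h_closed\<close>)
  finally show ?thesis .
qed

text \<open>
  Comparing coefficients of \<open>e\<^sub>a\<close> in \<open>f([e\<^sub>i, e\<^sub>j]) = [f(e\<^sub>i), f(e\<^sub>j)]\<close>, and likewise for the triple
  bracket, shows that \<open>h\<close> satisfies the defining relations of \<open>A\<close>.
\<close>

lemma h_bracket:
  assumes a: "a < n" and i: "i < n" and j: "j < n"
  shows "(\<Oplus>\<^bsub>H\<^esub>u\<in>{..<n}. \<tau> i j u \<odot>\<^bsub>H\<^esub> h a u)
    = (\<Oplus>\<^bsub>H\<^esub>s\<in>{..<n}. \<Oplus>\<^bsub>H\<^esub>t\<in>{..<n}. \<tau> s t a \<odot>\<^bsub>H\<^esub> (h s i \<otimes>\<^bsub>H\<^esub> h t j))"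
proof -
  let ?B = "bracket (tensor_ly L H)"
  note bil = tensor_ly_bracket_bilin[OF ly H]
  note crd = tcoord_lin_hom[OF mod_L basis mod_H a]
  have cl: "bracket L (e s) (e t) \<in> carrier L" if "s < n" "t < n" for s t
    by (rule lin_hom_closed[OF L.bracket_bilinear(1)[OF e_closed] e_closed]) fact+
  have mc: "h s i \<otimes>\<^bsub>H\<^esub> h t j \<in> carrier H" if "s < n" "t < n" for s t
    using that i j h_closed by simp
  have inner: "crd a (?B (tens L H (e s) (h s i)) (f (e j)))
      = (\<Oplus>\<^bsub>H\<^esub>t\<in>{..<n}. \<tau> s t a \<odot>\<^bsub>H\<^esub> (h s i \<otimes>\<^bsub>H\<^esub> h t j))" if s: "s < n" for s
  proof -
    have "crd a (?B (tens L H (e s) (h s i)) (f (e j)))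
      = (\<Oplus>\<^bsub>H\<^esub>t\<in>{..<n}. crd a (?B (tens L H (e s) (h s i)) (tens L H (e t) (h t j))))"
      by (rule lin_hom_f_basis[OF mod_H lin_hom_comp[OF bilinD(1)[OF bil tens_h_closed[OF i s s]] crd] j])
    also have "\<dots> = (\<Oplus>\<^bsub>H\<^esub>t\<in>{..<n}. \<tau> s t a \<odot>\<^bsub>H\<^esub> (h s i \<otimes>\<^bsub>H\<^esub> h t j))"
      by (rule H.finsum_cong')
        (use s i j a in \<open>auto simp: tensor_ly_bracket_tens[OF ly H] e_closed h_closed cl mc
          tcoord_tens[OF mod_L basis mod_H] intro!: H.smult_closed\<close>)
    finally show ?thesis .
  qed
  have "(\<Oplus>\<^bsub>H\<^esub>u\<in>{..<n}. \<tau> i j u \<odot>\<^bsub>H\<^esub> h a u) = crd a (f (bracket L (e i) (e j)))"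
    by (rule crd_f[OF a cl[OF i j], symmetric])
  also have "\<dots> = crd a (?B (f (e i)) (f (e j)))"
    using f_ly e_closed i j by (simp add: ly_hom_def)
  also have "\<dots> = (\<Oplus>\<^bsub>H\<^esub>s\<in>{..<n}. crd a (?B (tens L H (e s) (h s i)) (f (e j))))"
    by (rule lin_hom_f_basis[OF mod_H lin_hom_comp[OF bilinD(2)[OF bil f_e_closed[OF j]] crd] i])
  also have "\<dots> = (\<Oplus>\<^bsub>H\<^esub>s\<in>{..<n}. \<Oplus>\<^bsub>H\<^esub>t\<in>{..<n}. \<tau> s t a \<odot>\<^bsub>H\<^esub> (h s i \<otimes>\<^bsub>H\<^esub> h t j))"
    by (rule H.finsum_cong') (auto simp: inner intro!: H.finsum_closed H.smult_closed mc)
  finally show ?thesis .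
qed

lemma h_triple:
  assumes a: "a < n" and i: "i < n" and j: "j < n" and k: "k < n"
  shows "(\<Oplus>\<^bsub>H\<^esub>u\<in>{..<n}. \<omega> i j k u \<odot>\<^bsub>H\<^esub> h a u)
    = (\<Oplus>\<^bsub>H\<^esub>r\<in>{..<n}. \<Oplus>\<^bsub>H\<^esub>s\<in>{..<n}. \<Oplus>\<^bsub>H\<^esub>t\<in>{..<n}.
        \<omega> r s t a \<odot>\<^bsub>H\<^esub> (h r i \<otimes>\<^bsub>H\<^esub> h s j \<otimes>\<^bsub>H\<^esub> h t k))"
proof -
  let ?T = "triple (tensor_ly L H)"
  note tri = tensor_ly_triple_trilin[OF ly H]
  note crd = tcoord_lin_hom[OF mod_L basis mod_H a]
  have cl: "triple L (e r) (e s) (e t) \<in> carrier L" if "r < n" "s < n" "t < n" for r s t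
    by (rule lin_hom_closed[OF L.triple_trilinear(1)[OF e_closed e_closed] e_closed]) fact+
  have mc: "h r i \<otimes>\<^bsub>H\<^esub> h s j \<otimes>\<^bsub>H\<^esub> h t k \<in> carrier H" if "r < n" "s < n" "t < n" for r s t
    using that i j k h_closed by simp
  have inner: "crd a (?T (tens L H (e r) (h r i)) (tens L H (e s) (h s j)) (f (e k)))
      = (\<Oplus>\<^bsub>H\<^esub>t\<in>{..<n}. \<omega> r s t a \<odot>\<^bsub>H\<^esub> (h r i \<otimes>\<^bsub>H\<^esub> h s j \<otimes>\<^bsub>H\<^esub> h t k))"
    if r: "r < n" and s: "s < n" for r s
  proof -
    have "crd a (?T (tens L H (e r) (h r i)) (tens L H (e s) (h s j)) (f (e k)))
      = (\<Oplus>\<^bsub>H\<^esub>t\<in>{..<n}. crd a (?T (tens L H (e r) (h r i)) (tens L H (e s) (h s j)) (tens L H (e t) (h t k))))"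
      by (rule lin_hom_f_basis[OF mod_H lin_hom_comp[OF tri(1)[OF tens_h_closed[OF i r r] tens_h_closed[OF j s s]] crd] k])
    also have "\<dots> = (\<Oplus>\<^bsub>H\<^esub>t\<in>{..<n}. \<omega> r s t a \<odot>\<^bsub>H\<^esub> (h r i \<otimes>\<^bsub>H\<^esub> h s j \<otimes>\<^bsub>H\<^esub> h t k))"
      by (rule H.finsum_cong')
        (use r s i j k a in \<open>auto simp: tensor_ly_triple_tens[OF ly H] e_closed h_closed cl mc
          tcoord_tens[OF mod_L basis mod_H] intro!: H.smult_closed\<close>)
    finally show ?thesis .
  qed
  have middle: "crd a (?T (tens L H (e r) (h r i)) (f (e j)) (f (e k)))
      = (\<Oplus>\<^bsub>H\<^esub>s\<in>{..<n}. \<Oplus>\<^bsub>H\<^esub>t\<in>{..<n}. \<omega> r s t a \<odot>\<^bsub>H\<^esub> (h r i \<otimes>\<^bsub>H\<^esub> h s j \<otimes>\<^bsub>H\<^esub> h t k))"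
    if r: "r < n" for r
  proof -
    have "crd a (?T (tens L H (e r) (h r i)) (f (e j)) (f (e k)))
      = (\<Oplus>\<^bsub>H\<^esub>s\<in>{..<n}. crd a (?T (tens L H (e r) (h r i)) (tens L H (e s) (h s j)) (f (e k))))"
      by (rule lin_hom_f_basis[OF mod_H lin_hom_comp[OF tri(2)[OF tens_h_closed[OF i r r] f_e_closed[OF k]] crd] j])
    also have "\<dots> = (\<Oplus>\<^bsub>H\<^esub>s\<in>{..<n}. \<Oplus>\<^bsub>H\<^esub>t\<in>{..<n}. \<omega> r s t a \<odot>\<^bsub>H\<^esub> (h r i \<otimes>\<^bsub>H\<^esub> h s j \<otimes>\<^bsub>H\<^esub> h t k))"
      by (rule H.finsum_cong') (auto simp: inner r intro!: H.finsum_closed H.smult_closed mc)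
    finally show ?thesis .
  qed
  have "(\<Oplus>\<^bsub>H\<^esub>u\<in>{..<n}. \<omega> i j k u \<odot>\<^bsub>H\<^esub> h a u) = crd a (f (triple L (e i) (e j) (e k)))"
    by (rule crd_f[OF a cl[OF i j k], symmetric])
  also have "\<dots> = crd a (?T (f (e i)) (f (e j)) (f (e k)))"
    using f_ly e_closed i j k by (simp add: ly_hom_def)
  also have "\<dots> = (\<Oplus>\<^bsub>H\<^esub>r\<in>{..<n}. crd a (?T (tens L H (e r) (h r i)) (f (e j)) (f (e k))))"
    by (rule lin_hom_f_basis[OF mod_H lin_hom_comp[OF tri(3)[OF f_e_closed[OF j] f_e_closed[OF k]] crd] i])
  also have "\<dots> = (\<Oplus>\<^bsub>H\<^esub>r\<in>{..<n}. \<Oplus>\<^bsub>H\<^esub>s\<in>{..<n}. \<Oplus>\<^bsub>H\<^esub>t\<in>{..<n}.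
        \<omega> r s t a \<odot>\<^bsub>H\<^esub> (h r i \<otimes>\<^bsub>H\<^esub> h s j \<otimes>\<^bsub>H\<^esub> h t k))"
    by (rule H.finsum_cong') (auto simp: middle intro!: H.finsum_closed H.smult_closed mc)
  finally show ?thesis .
qed

text \<open>The comodule axioms say that \<open>h\<close> is comultiplied and counited like the generators of \<open>A\<close>.\<close>

lemma h_comult:
  assumes i: "i < n" and a: "a < n"
  shows "comult H (h a i) = (\<Oplus>\<^bsub>tensor H H\<^esub>s\<in>{..<n}. tens H H (h a s) (h s i))"
proof -
  have com: "lin_hom H (tensor H H) (comult H)"
    using alg_homD(1)[OF comult_alg] same_space_lin_hom[of H H, OF _ same_space_tensor_alg[of H H]]
    by (simp add: same_space_def)
  have com_closed: "comult H (h s i) \<in> carrier (tensor H H)" if "s < n" for s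
    by (rule lin_hom_closed[OF com h_closed[OF that i]])
  note crd = tcoord_lin_hom[OF mod_L basis mod_HH a]
  have hc: "tens H H (h t s) (h s i) \<in> carrier (tensor H H)" if "s < n" "t < n" for s t
    using that i h_closed by (intro tens_closed mod_H)
  \<comment> \<open>Both sides of the coassociativity of the coaction at \<open>e\<^sub>i\<close> are expanded in \<open>L \<otimes> (H \<otimes> H)\<close>.\<close>
  have "tmap L H L (tensor H H) id (comult H) (f (e i))
      = (\<Oplus>\<^bsub>tensor L (tensor H H)\<^esub>s\<in>{..<n}. tmap L H L (tensor H H) id (comult H) (tens L H (e s) (h s i)))"
    by (rule lin_hom_f_basis[OF mod_LHH tmap_lin_hom[OF mod_L mod_H mod_L mod_HH lin_hom_id_map com] i])
  also have "\<dots> = (\<Oplus>\<^bsub>tensor L (tensor H H)\<^esub>s\<in>{..<n}. tens L (tensor H H) (e s) (comult H (h s i)))"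
    by (rule LHH.finsum_cong')
      (auto simp: tmap_tens[OF mod_L mod_H mod_L mod_HH lin_hom_id_map com] e_closed h_closed i
        intro!: tens_closed mod_L mod_HH com_closed)
  finally have left: "tcoord L n e (tensor H H) a (tmap L H L (tensor H H) id (comult H) (f (e i))) = comult H (h a i)"
    using tcoord_finsum[OF mod_L basis mod_HH a, of "\<lambda>s. comult H (h s i)"] com_closed by simp

  let ?c = "\<lambda>y. tcoord L n e (tensor H H) a (tassoc L H H y)"
  have clin: "lin_hom (tensor (tensor L H) H) (tensor H H) ?c"
    by (rule lin_hom_comp[OF tassoc_lin_hom[OF mod_L mod_H mod_H] crd])
  have each: "?c (tens (tensor L H) H (f (e s)) (h s i)) = tens H H (h a s) (h s i)" if s: "s < n" for s
  proof -
    have "?c (tens (tensor L H) H (f (e s)) (h s i))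
        = (\<Oplus>\<^bsub>tensor H H\<^esub>t\<in>{..<n}. ?c (tens (tensor L H) H (tens L H (e t) (h t s)) (h s i)))"
      by (rule lin_hom_f_basis[OF mod_HH lin_hom_comp[OF bilinD(2)[OF tens_bilin[OF mod_LH mod_H] h_closed[OF s i]] clin] s])
    also have "\<dots> = tens H H (h a s) (h s i)"
      by (intro finsum_delta[OF mod_HH a hc[OF s a]])
        (use HH.smult_one HH.smult_l_null in \<open>auto simp: tassoc_tens[OF mod_L mod_H mod_H] e_closed h_closed s i a hc
            tcoord_tens[OF mod_L basis mod_HH] coord_basis[OF mod_L basis]\<close>)
    finally show ?thesis .
  qed
  have "?c (tmap L H (tensor L H) H f id (f (e i)))
      = (\<Oplus>\<^bsub>tensor H H\<^esub>s\<in>{..<n}. ?c (tmap L H (tensor L H) H f id (tens L H (e s) (h s i))))"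
    by (rule lin_hom_f_basis[OF mod_HH lin_hom_comp[OF tmap_lin_hom[OF mod_L mod_H mod_LH mod_H f_lin lin_hom_id_map] clin] i])
  also have "\<dots> = (\<Oplus>\<^bsub>tensor H H\<^esub>s\<in>{..<n}. tens H H (h a s) (h s i))"
    by (rule HH.finsum_cong')
      (auto simp: tmap_tens[OF mod_L mod_H mod_LH mod_H f_lin lin_hom_id_map] e_closed h_closed i a each hc)
  finally show ?thesis
    using left f_comod e_closed[OF i] by (simp add: right_comodule_def)
qed

lemma h_counit:
  assumes i: "i < n" and a: "a < n"
  shows "counit H (h a i) = (if a = i then 1 else 0)"
proof -
  note mod_base = algebra_module[OF base_algebra]
  note cou = alg_homD(1)[OF counit_alg]
  let ?r = "\<lambda>y. runit L (tmap L H L base id (counit H) y)"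
  have lin: "lin_hom (tensor L H) L ?r"
    by (rule lin_hom_comp[OF tmap_lin_hom[OF mod_L mod_H mod_L mod_base lin_hom_id_map cou] runit_lin_hom[OF mod_L]])
  have "e i = ?r (f (e i))"
    using f_comod e_closed[OF i] by (simp add: right_comodule_def)
  also have "\<dots> = (\<Oplus>\<^bsub>L\<^esub>s\<in>{..<n}. ?r (tens L H (e s) (h s i)))"
    by (rule lin_hom_f_basis[OF mod_L lin i])
  also have "\<dots> = (\<Oplus>\<^bsub>L\<^esub>s\<in>{..<n}. counit H (h s i) \<odot>\<^bsub>L\<^esub> e s)"
    by (rule L.finsum_cong')
      (auto simp: tmap_tens[OF mod_L mod_H mod_L mod_base lin_hom_id_map cou] runit_tens[OF mod_L] e_closed h_closed i
        intro!: L.smult_closed)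
  finally have "coord L n e (e i) a = counit H (h a i)"
    by (rule coord_unique[OF mod_L basis _ a])
  then show ?thesis using coord_basis[OF mod_L basis a i] by simp
qed

text \<open>
  The algebra morphism \<open>\<phi> : A \<rightarrow> H\<close> with \<open>\<phi>(x\<^sub>s\<^sub>i) = h\<^sub>s\<^sub>i\<close>: the substitution \<open>h\<close>, called \<open>ev\<close> below,
  applied to the representative that is also used in the definition of \<open>\<Delta>\<close> and \<open>\<epsilon>\<close> on \<open>A\<close>
\<close>

definition \<phi> :: "((nat \<times> nat \<Rightarrow>\<^sub>0 nat) \<Rightarrow>\<^sub>0 'k) set \<Rightarrow> 'h" where
  "\<phi> X = poly_eval H (\<lambda>(s, i). h s i) (rep X)"

lemma h_vars: "v \<in> vars \<Longrightarrow> (\<lambda>(s, i). h s i) v \<in> carrier H"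
  by (auto simp: h_closed)

abbreviation "ev \<equiv> poly_eval H (\<lambda>(s, i). h s i)"

lemma ev_alg_hom: "alg_hom P H ev"
  by (rule poly_eval_alg_hom[OF H h_vars])

lemma ev_var: "s < n \<Longrightarrow> i < n \<Longrightarrow> ev (var (s, i)) = h s i"
  using poly_eval_var[where V = vars and \<xi> = "\<lambda>(s, i). h s i", OF H h_vars, of "(s, i)"] by simp

lemma ev_null:
  assumes "p \<in> J"
  shows "ev p = \<zero>\<^bsub>H\<^esub>"
proof (rule ideal_null[OF H ev_alg_hom _ _ assms])
  interpret P: algebra base P by (rule poly_alg_algebra)
  note sum = alg_hom_sum[OF H ev_alg_hom]
  note smult = lin_hom_smult[OF alg_homD(1)[OF ev_alg_hom]]
  have mult: "ev (p * q) = ev p \<otimes>\<^bsub>H\<^esub> ev q" if "p \<in> carrier P" "q \<in> carrier P" for p q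
    using ring_hom_mult[OF alg_homD(2)[OF ev_alg_hom] that] by (simp add: poly_alg_simps)
  have lhs: "ev (\<Sum>u<n. c u \<odot>\<^bsub>P\<^esub> var (a, u)) = (\<Oplus>\<^bsub>H\<^esub>u\<in>{..<n}. c u \<odot>\<^bsub>H\<^esub> h a u)" if "a < n" for a c
    by (subst sum) (auto simp: that var_closed smult ev_var intro!: H.finsum_cong' P.smult_closed H.smult_closed h_closed)
  fix a i j assume *: "a < n" "i < n" "j < n"
  have inner: "ev (\<Sum>t<n. c t \<odot>\<^bsub>P\<^esub> (var (s, i) * var (t, j))) = (\<Oplus>\<^bsub>H\<^esub>t\<in>{..<n}. c t \<odot>\<^bsub>H\<^esub> (h s i \<otimes>\<^bsub>H\<^esub> h t j))"
    if "s < n" for s c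
    using * that by (subst sum)
      (auto simp: var_closed mult_closed smult mult ev_var h_closed
        intro!: H.finsum_cong' P.smult_closed H.smult_closed)
  have "ev (bracket_rhs a i j) = (\<Oplus>\<^bsub>H\<^esub>s\<in>{..<n}. \<Oplus>\<^bsub>H\<^esub>t\<in>{..<n}. \<tau> s t a \<odot>\<^bsub>H\<^esub> (h s i \<otimes>\<^bsub>H\<^esub> h t j))"
    using * by (subst sum)
      (auto simp: inner var_closed mult_closed h_closed
        intro!: H.finsum_cong' P.smult_closed H.smult_closed H.finsum_closed poly_alg_sum_closed)
  then show "ev (bracket_lhs a i j) = ev (bracket_rhs a i j)"
    using lhs[OF *(1)] h_bracket[OF *] by simp
  fix k assume k: "k < n"
  have inner1: "ev (\<Sum>t<n. c t \<odot>\<^bsub>P\<^esub> (var (r, i) * var (s, j) * var (t, k)))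
      = (\<Oplus>\<^bsub>H\<^esub>t\<in>{..<n}. c t \<odot>\<^bsub>H\<^esub> (h r i \<otimes>\<^bsub>H\<^esub> h s j \<otimes>\<^bsub>H\<^esub> h t k))"
    if "r < n" "s < n" for r s c
    using * k that by (subst sum)
      (auto simp: var_closed mult_closed smult mult ev_var h_closed
        intro!: H.finsum_cong' P.smult_closed H.smult_closed)
  have inner2: "ev (\<Sum>s<n. \<Sum>t<n. c s t \<odot>\<^bsub>P\<^esub> (var (r, i) * var (s, j) * var (t, k)))
      = (\<Oplus>\<^bsub>H\<^esub>s\<in>{..<n}. \<Oplus>\<^bsub>H\<^esub>t\<in>{..<n}. c s t \<odot>\<^bsub>H\<^esub> (h r i \<otimes>\<^bsub>H\<^esub> h s j \<otimes>\<^bsub>H\<^esub> h t k))"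
    if "r < n" for r c
    using * k that by (subst sum)
      (auto simp: inner1 var_closed mult_closed h_closed
        intro!: H.finsum_cong' P.smult_closed H.smult_closed H.finsum_closed poly_alg_sum_closed)
  have "ev (triple_rhs a i j k) = (\<Oplus>\<^bsub>H\<^esub>r\<in>{..<n}. \<Oplus>\<^bsub>H\<^esub>s\<in>{..<n}. \<Oplus>\<^bsub>H\<^esub>t\<in>{..<n}.
        \<omega> r s t a \<odot>\<^bsub>H\<^esub> (h r i \<otimes>\<^bsub>H\<^esub> h s j \<otimes>\<^bsub>H\<^esub> h t k))"
    using * k by (subst sum)
      (auto simp: inner2 var_closed mult_closed h_closed
        intro!: H.finsum_cong' P.smult_closed H.smult_closed H.finsum_closed poly_alg_sum_closed)
  then show "ev (triple_lhs a i j k) = ev (triple_rhs a i j k)"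
    using lhs[OF *(1)] h_triple[OF * k] by simp
qed

lemma phi_alg_hom: "alg_hom A H \<phi>"
proof -
  have "\<phi> = (\<lambda>X. ev (rep X))" by (simp add: fun_eq_iff \<phi>_def)
  then show ?thesis using A.lift_alg_hom[OF H ev_alg_hom ev_null] by simp
qed

lemma phi_x: "s < n \<Longrightarrow> i < n \<Longrightarrow> \<phi> (x s i) = h s i"
  unfolding \<phi>_def x_eq
  using A.lift_proj[OF mod_H alg_homD(1)[OF ev_alg_hom] ev_null var_closed] ev_var by simp

text \<open>
  All maps involved are substitutions in the same polynomial \<open>rep X\<close>, so compatibility with \<open>\<Delta>\<close> and
  \<open>\<epsilon>\<close> reduces to the values on variables. In particular \<open>\<Delta>\<close> and \<open>\<epsilon>\<close> need not be known to be
  independent of the representative.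
\<close>

lemma phi_bialg_hom: "bialg_hom (univ_bialg L n e) H \<phi>"
proof -
  let ?B = "univ_bialg L n e"
  let ?TA = "tensor_alg A A" and ?TH = "tensor_alg H H"
  note algA = A.quot_algebra
  have algTA: "algebra base ?TA" by (rule tensor_alg_algebra[OF algA algA])
  have algTH: "algebra base ?TH" by (rule tensor_alg_algebra[OF H H])
  interpret TA: algebra base ?TA by (rule algTA)
  interpret TH: algebra base ?TH by (rule algTH)
  have carA: "carrier ?TA = carrier (tensor A A)" and carH: "carrier ?TH = carrier (tensor H H)"
    using same_space_tensor_alg[of A A] same_space_tensor_alg[of H H] by (simp_all add: same_space_def)
  have xx: "tens A A (x i s) (x s j) \<in> carrier ?TA" if "i < n" "j < n" "s < n" for i j s
    unfolding carA by (intro tens_closed mod_A x_closed that)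
  have tm: "alg_hom ?TA ?TH (tmap A A H H \<phi> \<phi>)"
    by (rule tmap_alg_hom[OF algA algA H H phi_alg_hom phi_alg_hom])
  have tmap_eq: "tmap ?B ?B H H \<phi> \<phi> = tmap A A H H \<phi> \<phi>"
    by (simp add: tmap_def tlift_def fun_eq_iff)
  let ?\<xi> = "\<lambda>(i, j). \<Oplus>\<^bsub>?TA\<^esub>s\<in>{..<n}. tens A A (x i s) (x s j)"
  have \<xi>: "?\<xi> v \<in> carrier ?TA" if "v \<in> vars" for v
    using that by (auto intro!: TA.finsum_closed xx)
  have \<xi>H: "tmap A A H H \<phi> \<phi> (?\<xi> v) = comult H (case v of (s, i) \<Rightarrow> h s i)" if vv: "v \<in> vars" for v
  proof -
    obtain i j where v: "v = (i, j)" "i < n" "j < n" using vv by auto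
    have "tmap A A H H \<phi> \<phi> (?\<xi> v) = (\<Oplus>\<^bsub>?TH\<^esub>s\<in>{..<n}. tmap A A H H \<phi> \<phi> (tens A A (x i s) (x s j)))"
      unfolding v(1) prod.case
      by (rule lin_hom_finsum[OF algebra_module[OF algTA] algebra_module[OF algTH] alg_homD(1)[OF tm]])
        (use v xx in auto)
    also have "\<dots> = (\<Oplus>\<^bsub>?TH\<^esub>s\<in>{..<n}. tens H H (h i s) (h s j))"
      by (rule TH.finsum_cong')
        (use v in \<open>auto simp: tmap_tens[OF mod_A mod_A mod_H mod_H alg_homD(1)[OF phi_alg_hom] alg_homD(1)[OF phi_alg_hom]]
          x_closed phi_x carH intro!: tens_closed mod_H h_closed\<close>)
    also have "\<dots> = comult H (h i j)"
      by (simp add: h_comult[OF v(3,2)] same_space_finsum[OF same_space_tensor_alg[of H H]])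
    finally show ?thesis using v by simp
  qed
  show ?thesis
    unfolding bialg_hom_def alg_hom_univ_bialg
  proof (intro conjI ballI phi_alg_hom)
    fix X assume "X \<in> carrier ?B"
    then have r: "rep X \<in> carrier P" by (simp add: univ_bialg_simps A.rep_carrier)
    have "comult H (\<phi> X) = poly_eval ?TH (\<lambda>v. comult H (case v of (s, i) \<Rightarrow> h s i)) (rep X)"
      unfolding \<phi>_def by (rule alg_hom_poly_eval[OF H h_vars algTH comult_alg r])
    also have "\<dots> = poly_eval ?TH (\<lambda>v. tmap A A H H \<phi> \<phi> (?\<xi> v)) (rep X)"
      by (rule poly_eval_cong[OF algTH r]) (use \<xi>H lin_hom_closed[OF alg_homD(1)[OF tm] \<xi>] in auto)
    also have "\<dots> = tmap A A H H \<phi> \<phi> (poly_eval ?TA ?\<xi> (rep X))"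
      by (rule alg_hom_poly_eval[OF algTA \<xi> algTH tm r, symmetric])
    finally show "comult H (\<phi> X) = tmap ?B ?B H H \<phi> \<phi> (comult ?B X)"
      by (simp add: univ_bialg_simps tmap_eq)
    have "counit H (\<phi> X) = poly_eval base (\<lambda>v. counit H (case v of (s, i) \<Rightarrow> h s i)) (rep X)"
      unfolding \<phi>_def by (rule alg_hom_poly_eval[OF H h_vars base_algebra counit_alg r])
    also have "\<dots> = poly_eval base (\<lambda>(i, j). if i = j then 1 else 0) (rep X)"
      by (rule poly_eval_cong[OF base_algebra r]) (auto simp: h_counit)
    finally show "counit H (\<phi> X) = counit ?B X"
      by (simp add: univ_bialg_simps)
  qed
qed

text \<open>An algebra morphism on \<open>A(L)\<close> recovers the coaction if and only if it equals \<open>\<phi>\<close>.\<close>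

lemma recovers_iff:
  assumes k: "alg_hom A H k"
  shows "(\<forall>v\<in>carrier L. tmap L A L H id k (univ_coaction L n e v) = f v) \<longleftrightarrow> (\<forall>X\<in>carrier A. k X = \<phi> X)"
proof
  note kl = alg_homD(1)[OF k]
  assume *: "\<forall>v\<in>carrier L. tmap L A L H id k (univ_coaction L n e v) = f v"
  have "k (x s i) = \<phi> (x s i)" if s: "s < n" and i: "i < n" for s i
  proof -
    have "h s i = crd s (\<Oplus>\<^bsub>tensor L H\<^esub>t\<in>{..<n}. tens L H (e t) (k (x t i)))"
      using * tmap_univ_coaction[OF H kl i] e_closed[OF i] by (simp add: h_def)
    also have "\<dots> = k (x s i)"
      by (rule tcoord_finsum[OF mod_L basis mod_H s lin_hom_closed[OF kl x_closed[OF _ i]]])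
    finally show ?thesis using phi_x s i by simp
  qed
  then show "\<forall>X\<in>carrier A. k X = \<phi> X"
    using univ_alg_eqI[OF H k phi_alg_hom] by blast
next
  note kl = alg_homD(1)[OF k]
  assume *: "\<forall>X\<in>carrier A. k X = \<phi> X"
  show "\<forall>v\<in>carrier L. tmap L A L H id k (univ_coaction L n e v) = f v"
  proof
    fix v assume v: "v \<in> carrier L"
    show "tmap L A L H id k (univ_coaction L n e v) = f v"
    proof (rule basis_lin_eqI[OF mod_L basis mod_LH _ f_lin _ v])
      show "lin_hom L (tensor L H) (\<lambda>v. tmap L A L H id k (univ_coaction L n e v))"
        by (rule lin_hom_comp[OF univ_coaction_lin_hom tmap_lin_hom[OF mod_L mod_A mod_L mod_H lin_hom_id_map kl]])
      fix i assume i: "i < n"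
      show "tmap L A L H id k (univ_coaction L n e (e i)) = f (e i)"
        unfolding tmap_univ_coaction[OF H kl i] f_basis[OF i]
        by (rule LH.finsum_cong') (use i * x_closed phi_x tens_h_closed in auto)
    qed
  qed
qed

end


section \<open>The universal property\<close>

lemma tmap_comp:
  assumes "module base M" "module base N" "module base N'" "module base N''"
    and "lin_hom N N' f" "lin_hom N' N'' g" and "t \<in> carrier (tensor M N)"
  shows "tmap M N' M N'' id g (tmap M N M N' id f t) = tmap M N M N'' id (\<lambda>y. g (f y)) t"
  by (rule tensor_lin_eqI[OF assms(1,2) lin_hom_comp[OF tmap_lin_hom tmap_lin_hom] tmap_lin_hom _ assms(7)])
    (use assms lin_hom_closed[OF assms(5)] in \<open>simp_all add: tmap_tens lin_hom_comp[OF assms(5,6)] lin_hom_id_map\<close>)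

theorem theorem3p16:
  fixes L :: "('k::field_char_0, 'l) ly_algebra"
    and n :: nat and e :: "nat \<Rightarrow> 'l"
    and U :: "('k, 'u) hopf_algebra" and X :: "'l \<Rightarrow> ('l \<times> 'u \<Rightarrow>\<^sub>0 'k) set"
    and H :: "('k, 'h) hopf_algebra" and f :: "'l \<Rightarrow> ('l \<times> 'h \<Rightarrow>\<^sub>0 'k) set"
  assumes "lie_yamaguti L"
    and "is_basis L n e"
    and "universal_coacting_hopf TYPE('h) L n e U X"
    and "comm_hopf_algebra H"
    and "ly_hom L (tensor_ly L H) f"
    and "right_comodule L H f"
  shows "\<exists>!g. g \<in> extensional (carrier U) \<and> hopf_hom U H g \<and>
              (\<forall>v\<in>carrier L. tmap L U L H id g (X v) = f v)"
proof -
  interpret C: ly_coaction L n e H f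
    using assms by (intro ly_coaction.intro ly_basis.intro ly_coaction_axioms.intro)
      (simp_all add: comm_hopf_algebra_def)
  let ?B = "univ_bialg L n e" and ?A = "univ_alg L n e"
  obtain \<mu> where free: "free_comm_hopf TYPE('h) ?B U \<mu>"
    and X: "\<And>v. v \<in> carrier L \<Longrightarrow> X v = tmap L ?A L U id \<mu> (univ_coaction L n e v)"
    using assms(3) by (auto simp: universal_coacting_hopf_def)
  have \<mu>: "alg_hom ?A U \<mu>" and U: "algebra base U"
    using free by (auto simp: free_comm_hopf_def bialg_hom_def C.alg_hom_univ_bialg
        comm_hopf_algebra_def comm_bialgebra_def)
  have ex1: "\<exists>!g. g \<in> extensional (carrier U) \<and> hopf_hom U H g \<and> (\<forall>b\<in>carrier ?B. g (\<mu> b) = C.\<phi> b)"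
    using free assms(4) C.phi_bialg_hom by (simp add: free_comm_hopf_def)
  have iff: "(\<forall>v\<in>carrier L. tmap L U L H id g (X v) = f v) \<longleftrightarrow> (\<forall>b\<in>carrier ?B. g (\<mu> b) = C.\<phi> b)"
    if "hopf_hom U H g" for g
  proof -
    have g: "alg_hom U H g" using that by (simp add: hopf_hom_def bialg_hom_def)
    have "tmap L U L H id g (X v) = tmap L ?A L H id (\<lambda>a. g (\<mu> a)) (univ_coaction L n e v)"
      if "v \<in> carrier L" for v
      unfolding X[OF that]
      by (rule tmap_comp[OF C.mod_L C.mod_A algebra_module[OF U] C.mod_H alg_homD(1)[OF \<mu>] alg_homD(1)[OF g]
          lin_hom_closed[OF C.univ_coaction_lin_hom that]])
    then show ?thesis
      using C.recovers_iff[OF alg_hom_comp[OF \<mu> g]] by (simp add: C.univ_bialg_simps)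
  qed
  show ?thesis
    using ex1 iff by (metis (no_types, lifting))
qed

end
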